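(* Let $0<\alpha_2<\alpha_1<1$, $c_1>0$, $c_2\ge0$, $c_1+c_2=1$. The inter-arrival times of the mixed time-changed Erlang queue $\{\mathcal Q^{\alpha_1,\alpha_2}(t)\}_{t\ge0}$ are independent and identically distributed, and, with $T^{\alpha_1,\alpha_2}$ denoting a generic inter-arrival time, for $t>0$ $$\Pr(T^{\alpha_1,\alpha_2}>t)=\sum_{r=0}^\infty\Big(-\frac{c_2}{c_1}\Big)^rt^{(\alpha_1-\alpha_2)r}E^{r+1}_{\alpha_1,(\alpha_1-\alpha_2)r+1}\Big(-\frac{\lambda}{c_1}t^{\alpha_1}\Big)-\sum_{r=0}^\infty\Big(-\frac{c_2}{c_1}\Big)^{r+1}t^{(\alpha_1-\alpha_2)(r+1)}E^{r+1}_{\alpha_1,(\alpha_1-\alpha_2)(r+1)+1}\Big(-\frac{\lambda}{c_1}t^{\alpha_1}\Big).$$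
   Context: Parameters: $\lambda>0$, $\mu>0$, $k\in\mathbb N=\{1,2,\dots\}$. Erlang queue: single-server queue with Poisson arrivals of rate $\lambda$, each service consisting of $k$ successive phases, each exponential with parameter $k\mu$, all independent. $\mathcal Q(t)=(\mathcal N(t),\mathcal S(t))$, where $\mathcal N(t)$ is the number of customers in the system and $\mathcal S(t)$ is the phase of the customer being served if $\mathcal N(t)>0$ (phases are counted down: service starts at phase $k$ and ends upon completion of phase $1$), with $\mathcal S(t)=0$ if $\mathcal N(t)=0$. Thus $\mathcal Q$ is the continuous-time Markov chain on $\mathcal H_0=\mathcal H\cup\{(0,0)\}$, $\mathcal H=\{(n,s)\in\mathbb N\times\mathbb N: s\le k\}$, with $\mathcal Q(0)=(0,0)$ and transition rates: $(0,0)\to(1,k)$ at rate $\lambda$; $(n,s)\to(n+1,s)$ at rate $\lambda$; $(n,s)\to(n,s-1)$ at rate $k\mu$ if $s\ge2$; $(n,1)\to(n-1,k)$ at rate $k\mu$ if $n\ge2$; $(1,1)\to(0,0)$ at rate $k\mu$. Inverse mixed stable subordinator: $\{D_{\alpha_1,\alpha_2}(t)\}_{t\ge0}$ is the nondecreasing Lévy process (started at $0$) with $\mathbb E(e^{-zD_{\alpha_1,\alpha_2}(t)})=e^{-t(c_1z^{\alpha_1}+c_2z^{\alpha_2})}$, $z>0$; $Y_{\alpha_1,\alpha_2}(t)=\inf\{s\ge0:D_{\alpha_1,\alpha_2}(s)>t\}$, $t>0$, $Y_{\alpha_1,\alpha_2}(0)=0$. Mixed time-changed Erlang queue: $\mathcal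 Q^{\alpha_1,\alpha_2}(t)=\mathcal Q(Y_{\alpha_1,\alpha_2}(t))$, with $\mathcal Q$ and $Y_{\alpha_1,\alpha_2}$ independent. An arrival is an instant at which the first component of $\mathcal Q^{\alpha_1,\alpha_2}$ increases by one. The arrival time is the random time at which the first arrival occurs, and an inter-arrival time is the time between two successive arrivals (the first being measured from time $0$). Three-parameter Mittag-Leffler function: $E^\gamma_{\alpha,\beta}(t)=\sum_{r=0}^\infty\frac{\Gamma(\gamma+r)t^r}{r!\,\Gamma(\gamma)\Gamma(\alpha r+\beta)}$, $t\in\mathbb R$, $\alpha,\beta,\gamma>0$. Convention $0^0=1$. *)

theory Defs
  imports "HOL-Probability.Probability"
begin

section \<open>Sample paths and processes\<close>

text \<open>Processes are functions of a real time parameter, of which only the values at times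
  \<open>t \<ge> 0\<close> matter.  In a discrete state space, a right-continuous path with left limits is a step
  function with finitely many jumps in bounded time.\<close>

definition cadlag :: "(real \<Rightarrow> 'b::topological_space) \<Rightarrow> bool" where
  "cadlag x \<longleftrightarrow> (\<forall>t\<ge>0. (x \<longlongrightarrow> x t) (at_right t)) \<and> (\<forall>t>0. \<exists>l. (x \<longlongrightarrow> l) (at_left t))"

text \<open>This is \<open>prob_space.indep_var\<close> for the two path-valued random variables, written out because
  that constant requires both to have values of the same type.\<close>

definition indep_processes ::
  "'w measure \<Rightarrow> 'b measure \<Rightarrow> (real \<Rightarrow> 'w \<Rightarrow> 'b) \<Rightarrow> 'c measure \<Rightarrow> (real \<Rightarrow> 'w \<Rightarrow> 'c) \<Rightarrow> bool" where
  "indep_processes M A X B Y \<longleftrightarrow>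
     (\<forall>t\<ge>0. X t \<in> measurable M A) \<and> (\<forall>t\<ge>0. Y t \<in> measurable M B) \<and>
     prob_space.indep_set M
       (sets (vimage_algebra (space M) (\<lambda>\<omega>. \<lambda>t\<in>{0..}. X t \<omega>) (Pi\<^sub>M {0..} (\<lambda>_. A))))
       (sets (vimage_algebra (space M) (\<lambda>\<omega>. \<lambda>t\<in>{0..}. Y t \<omega>) (Pi\<^sub>M {0..} (\<lambda>_. B))))"


section \<open>Continuous-time Markov chains\<close>

text \<open>\<open>q x y\<close> (for \<open>x \<noteq> y\<close>) is the rate of the transition from \<open>x\<close> to \<open>y\<close>; values \<open>q x x\<close> are
  irrelevant.  The last two conditions are the infinitesimal description
  \<open>p h x y = q x y h + o(h)\<close> for \<open>y \<noteq> x\<close>, and \<open>p h x x = 1 - (\<Sum>y\<noteq>x. q x y) h + o(h)\<close>.\<close>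

definition transition_function_with_rates ::
  "'s set \<Rightarrow> ('s \<Rightarrow> 's \<Rightarrow> real) \<Rightarrow> (real \<Rightarrow> 's \<Rightarrow> 's \<Rightarrow> real) \<Rightarrow> bool" where
  "transition_function_with_rates S q p \<longleftrightarrow>
     (\<forall>t\<ge>0. \<forall>x\<in>S. (\<forall>y\<in>S. 0 \<le> p t x y) \<and> (p t x has_sum 1) S) \<and>
     (\<forall>x\<in>S. \<forall>y\<in>S. p 0 x y = (if x = y then 1 else 0)) \<and>
     (\<forall>s\<ge>0. \<forall>t\<ge>0. \<forall>x\<in>S. \<forall>y\<in>S. ((\<lambda>z. p s x z * p t z y) has_sum p (s + t) x y) S) \<and>
     (\<forall>x\<in>S. \<forall>y\<in>S. x \<noteq> y \<longrightarrow> ((\<lambda>h. p h x y / h) \<longlongrightarrow> q x y) (at_right 0)) \<and>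
     (\<forall>x\<in>S. q x summable_on (S - {x}) \<and>
        ((\<lambda>h. (1 - p h x x) / h) \<longlongrightarrow> (\<Sum>\<^sub>\<infinity>y\<in>S - {x}. q x y)) (at_right 0))"

text \<open>The last condition is the elementary Markov property; it is multiplied out so that no
  conditioning on null events occurs.\<close>

definition markov_chain_with_rates ::
  "'w measure \<Rightarrow> 's::topological_space set \<Rightarrow> ('s \<Rightarrow> 's \<Rightarrow> real) \<Rightarrow> 's \<Rightarrow> (real \<Rightarrow> 'w \<Rightarrow> 's) \<Rightarrow> bool"
where
  "markov_chain_with_rates M S q x0 X \<longleftrightarrow>
     (\<forall>t\<ge>0. X t \<in> measurable M (count_space UNIV)) \<and>
     (AE \<omega> in M. X 0 \<omega> = x0) \<and>
     (AE \<omega> in M. (\<forall>t\<ge>0. X t \<omega> \<in> S) \<and> cadlag (\<lambda>t. X t \<omega>)) \<and>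
     (\<exists>p. transition_function_with_rates S q p \<and>
        (\<forall>(n::nat) (t::nat \<Rightarrow> real) (x::nat \<Rightarrow> 's).
           0 \<le> t 0 \<and> (\<forall>i\<le>n. t i < t (Suc i)) \<and> (\<forall>i\<le>Suc n. x i \<in> S) \<longrightarrow>
           \<P>(\<omega> in M. \<forall>i\<le>Suc n. X (t i) \<omega> = x i) =
           \<P>(\<omega> in M. \<forall>i\<le>n. X (t i) \<omega> = x i) * p (t (Suc n) - t n) (x n) (x (Suc n))))"


section \<open>The Erlang queue\<close>

text \<open>A state is a pair (number of customers in the system, current phase).\<close>

definition erlang_states :: "nat \<Rightarrow> (nat \<times> nat) set" where
  "erlang_states k = insert (0, 0) {(n, s). 1 \<le> n \<and> 1 \<le> s \<and> s \<le> k}"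

definition erlang_rate :: "real \<Rightarrow> real \<Rightarrow> nat \<Rightarrow> nat \<times> nat \<Rightarrow> nat \<times> nat \<Rightarrow> real" where
  "erlang_rate lam mu k x y =
     (case x of (n, s) \<Rightarrow>
        if (n, s) = (0, 0) \<and> y = (1, k) then lam
        else if n \<ge> 1 \<and> s \<ge> 1 \<and> y = (n + 1, s) then lam
        else if n \<ge> 1 \<and> s \<ge> 2 \<and> y = (n, s - 1) then real k * mu
        else if n \<ge> 2 \<and> s = 1 \<and> y = (n - 1, k) then real k * mu
        else if (n, s) = (1, 1) \<and> y = (0, 0) then real k * mu
        else 0)"

definition erlang_queue ::
  "'w measure \<Rightarrow> real \<Rightarrow> real \<Rightarrow> nat \<Rightarrow> (real \<Rightarrow> 'w \<Rightarrow> nat \<times> nat) \<Rightarrow> bool" where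
  "erlang_queue M lam mu k Q \<longleftrightarrow>
     markov_chain_with_rates M (erlang_states k) (erlang_rate lam mu k) (0, 0) Q"


section \<open>The mixed stable subordinator and its inverse\<close>

definition levy_process :: "'w measure \<Rightarrow> (real \<Rightarrow> 'w \<Rightarrow> real) \<Rightarrow> bool" where
  "levy_process M X \<longleftrightarrow>
     (\<forall>t\<ge>0. X t \<in> borel_measurable M) \<and>
     (AE \<omega> in M. X 0 \<omega> = 0) \<and>
     (AE \<omega> in M. cadlag (\<lambda>t. X t \<omega>)) \<and>
     (\<forall>(n::nat) (t::nat \<Rightarrow> real). 0 \<le> t 0 \<and> (\<forall>i<n. t i < t (Suc i)) \<longrightarrow>
        prob_space.indep_vars M (\<lambda>_. borel) (\<lambda>i \<omega>. X (t (Suc i)) \<omega> - X (t i) \<omega>) {..<n}) \<and>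
     (\<forall>s\<ge>0. \<forall>t\<ge>0. distr M borel (\<lambda>\<omega>. X (s + t) \<omega> - X s \<omega>) = distr M borel (X t))"

definition mixed_stable_subordinator ::
  "'w measure \<Rightarrow> real \<Rightarrow> real \<Rightarrow> real \<Rightarrow> real \<Rightarrow> (real \<Rightarrow> 'w \<Rightarrow> real) \<Rightarrow> bool" where
  "mixed_stable_subordinator M c1 c2 \<alpha>1 \<alpha>2 D \<longleftrightarrow>
     levy_process M D \<and>
     (AE \<omega> in M. \<forall>s t. 0 \<le> s \<and> s \<le> t \<longrightarrow> D s \<omega> \<le> D t \<omega>) \<and>
     (\<forall>t\<ge>0. \<forall>z>0. prob_space.expectation M (\<lambda>\<omega>. exp (- z * D t \<omega>)) =
        exp (- t * (c1 * z powr \<alpha>1 + c2 * z powr \<alpha>2)))"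

text \<open>For an unbounded path (which is the almost sure case for the mixed stable subordinator) the
  infimum is over a nonempty set.\<close>

definition inverse_path :: "(real \<Rightarrow> real) \<Rightarrow> real \<Rightarrow> real" where
  "inverse_path d t = (if t = 0 then 0 else Inf {s. 0 \<le> s \<and> t < d s})"

definition inverse_process :: "(real \<Rightarrow> 'w \<Rightarrow> real) \<Rightarrow> real \<Rightarrow> 'w \<Rightarrow> real" where
  "inverse_process D t \<omega> = inverse_path (\<lambda>s. D s \<omega>) t"

definition time_change :: "(real \<Rightarrow> 'w \<Rightarrow> 'b) \<Rightarrow> (real \<Rightarrow> 'w \<Rightarrow> real) \<Rightarrow> real \<Rightarrow> 'w \<Rightarrow> 'b" where
  "time_change X Y t \<omega> = X (Y t \<omega>) \<omega>"


section \<open>Arrival and inter-arrival times\<close>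

text \<open>The first component at time \<open>t\<close> exceeds its left limit at \<open>t\<close> by one.\<close>

definition arrival_at :: "(real \<Rightarrow> nat \<times> nat) \<Rightarrow> real \<Rightarrow> bool" where
  "arrival_at x t \<longleftrightarrow> t > 0 \<and> (\<forall>\<^sub>F s in at_left t. fst (x t) = fst (x s) + 1)"

text \<open>\<open>nth_arrival_time x n\<close> is the time of the \<open>n\<close>-th arrival, with the convention that the zeroth
  one is at time 0.  It is \<open>\<infinity>\<close> if there are fewer than \<open>n\<close> arrivals.\<close>

primrec nth_arrival_time :: "(real \<Rightarrow> nat \<times> nat) \<Rightarrow> nat \<Rightarrow> ereal" where
  "nth_arrival_time x 0 = 0"
| "nth_arrival_time x (Suc n) = Inf {ereal t | t. arrival_at x t \<and> nth_arrival_time x n < ereal t}"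

text \<open>\<open>interarrival_time X 0\<close> is the time of the first arrival, measured from time 0.\<close>

definition interarrival_time :: "(real \<Rightarrow> 'w \<Rightarrow> nat \<times> nat) \<Rightarrow> nat \<Rightarrow> 'w \<Rightarrow> ereal" where
  "interarrival_time X n \<omega> =
     nth_arrival_time (\<lambda>t. X t \<omega>) (Suc n) - nth_arrival_time (\<lambda>t. X t \<omega>) n"


section \<open>The three-parameter Mittag-Leffler function\<close>

definition mittag_leffler3 :: "real \<Rightarrow> real \<Rightarrow> real \<Rightarrow> real \<Rightarrow> real" where
  "mittag_leffler3 \<gamma> \<alpha> \<beta> t =
     (\<Sum>r. Gamma (\<gamma> + real r) * t ^ r / (fact r * Gamma \<gamma> * Gamma (\<alpha> * real r + \<beta>)))"

end

theory Submission
  imports Defs "HOL-Real_Asymp.Real_Asymp"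
begin

text \<open>Arrivals form a Poisson process of rate \<open>\<lambda>\<close>, independent of the subordinator \<open>D\<close>, and the time
  change sends the \<open>i\<close>-th arrival epoch \<open>A\<^sub>i\<close> to the left limit \<open>D (A\<^sub>i -)\<close>.  Hence the inter-arrival
  times are the increments \<open>D (A\<^bsub>i+1\<^esub> -) - D (A\<^sub>i -)\<close>, which are independent with Laplace transform
  \<open>\<lambda> / (\<lambda> + \<phi> z)\<close>, where \<open>\<phi> z = c\<^sub>1 z\<^bsup>\<alpha>1\<^esup> + c\<^sub>2 z\<^bsup>\<alpha>2\<^esup>\<close>; the tail has transform \<open>\<phi> z / (z (\<lambda> + \<phi> z))\<close>,
  whose geometric expansion for large \<open>z\<close> is inverted term by term.

  The Poisson property and the conditioning on \<open>D\<close> are obtained together by observing the queue on a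
  grid of mesh \<open>h\<close>.  Over one step an arrival is seen with probability \<open>\<lambda> h + O(h\<^sup>2)\<close>, uniformly in
  the past; for small \<open>h\<close> no grid interval in a bounded time window contains two arrivals.  The joint
  transform of the discretised increments satisfies a renewal inequality whose bounds converge to
  \<open>\<Prod>\<^sub>i \<lambda> / (\<lambda> + \<phi> z\<^sub>i)\<close> as \<open>h \<rightarrow> 0\<close>.\<close>

section \<open>Laplace transforms\<close>

text \<open>The Markov property is given at finitely many fixed times only, and the rates are
  pointwise limits; holding times and a jump chain are not at hand. A bounded window holds about
  \<open>1 / h\<close> grid steps, so the error of one step must be of order
  \<open>h\<^sup>2\<close> with one constant for all states. That constant is
  \<open>2 * C\<^sup>2\<close>, where \<open>C = lam + real k * mu\<close> bounds every exit rate.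
  Arguments of the joint transform are first kept above some \<open>zmin > 0\<close>. Each step then
  has a weight below 1, so the sum over the unknown step of an arrival converges, and paths that
  lack this arrival contribute nothing in the limit. Only afterwards do the arguments tend to 0,
  which shows that all arrivals are finite and admits arguments equal to 0, hence marginals. Arrival
  times are infima over conditions at uncountably many times, so their measurability is not evident.
  It is inherited from almost everywhere limits of grid quantities, and this is where completeness
  of the measure enters.\<close>

lemma integral_exp_approx:
  fixes F X :: "'a \<Rightarrow> real" and g p :: "real \<Rightarrow> real"
  assumes F[measurable]: "integrable M F" and X[measurable]: "X \<in> borel_measurable M"
    and X0: "AE x in M. 0 \<le> X x"
    and g: "continuous_on UNIV g" and p: "continuous_on UNIV p"
    and gp: "\<And>u. 0 \<le> u \<Longrightarrow> u \<le> 1 \<Longrightarrow> \<bar>g u - p u\<bar> \<le> e"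
  shows "\<bar>(\<integral>x. F x * g (exp (- X x)) \<partial>M) - (\<integral>x. F x * p (exp (- X x)) \<partial>M)\<bar> \<le> e * (\<integral>x. \<bar>F x\<bar> \<partial>M)"
proof -
  have bound: "\<exists>B. \<forall>u\<in>{0..1}. \<bar>q u\<bar> \<le> B" if "continuous_on UNIV q" for q :: "real \<Rightarrow> real"
  proof -
    have "compact (q ` {0..1})"
      by (intro compact_continuous_image continuous_on_subset[OF that]) auto
    then have "bounded (q ` {0..1})"
      by (rule compact_imp_bounded)
    then show ?thesis
      unfolding bounded_real by auto
  qed
  have int: "integrable M (\<lambda>x. F x * q (exp (- X x)))" if q: "continuous_on UNIV q" for q :: "real \<Rightarrow> real"
  proof -
    obtain B where B: "\<And>u. u \<in> {0..1} \<Longrightarrow> \<bar>q u\<bar> \<le> B"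
      using bound[OF q] by blast
    have [measurable]: "q \<in> borel_measurable borel"
      using q by (rule borel_measurable_continuous_onI)
    show ?thesis
    proof (rule Bochner_Integration.integrable_bound[where f = "\<lambda>x. B * F x"])
      show "AE x in M. norm (F x * q (exp (- X x))) \<le> norm (B * F x)"
        using X0
      proof eventually_elim
        case (elim x)
        then have "\<bar>q (exp (- X x))\<bar> \<le> \<bar>B\<bar>"
          using B[of "exp (- X x)"] by auto
        then show ?case
          unfolding real_norm_def abs_mult by (metis abs_ge_zero mult.commute mult_left_mono)
      qed
    qed (use F in auto)
  qed
  have "\<bar>(\<integral>x. F x * g (exp (- X x)) \<partial>M) - (\<integral>x. F x * p (exp (- X x)) \<partial>M)\<bar>
      = \<bar>\<integral>x. F x * g (exp (- X x)) - F x * p (exp (- X x)) \<partial>M\<bar>"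
    by (simp add: int g p)
  also have "\<dots> \<le> (\<integral>x. \<bar>F x * g (exp (- X x)) - F x * p (exp (- X x))\<bar> \<partial>M)"
    by (rule integral_abs_bound)
  also have "\<dots> \<le> (\<integral>x. e * \<bar>F x\<bar> \<partial>M)"
  proof (rule integral_mono_AE)
    show "integrable M (\<lambda>x. \<bar>F x * g (exp (- X x)) - F x * p (exp (- X x))\<bar>)"
      by (intro integrable_abs Bochner_Integration.integrable_diff int g p)
    show "AE x in M. \<bar>F x * g (exp (- X x)) - F x * p (exp (- X x))\<bar> \<le> e * \<bar>F x\<bar>"
      using X0
    proof eventually_elim
      case (elim x)
      have "F x * g (exp (- X x)) - F x * p (exp (- X x)) = F x * (g (exp (- X x)) - p (exp (- X x)))"
        by (simp add: algebra_simps)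
      then show ?case
        using gp[of "exp (- X x)"] elim
        by (simp only: abs_mult) (metis abs_ge_zero exp_ge_zero exp_le_one_iff mult.commute mult_left_mono neg_le_0_iff_le)
    qed
  qed (use F in auto)
  finally show ?thesis
    by simp
qed

text \<open>In the variable \<open>u = exp (- X)\<close>, which lies in \<open>[0, 1]\<close>, the
  transforms at integers are all the moments. Linearity gives polynomials, Stone-Weierstrass
  continuous functions, and dominated convergence indicators of rays. The weights may be signed, so
  the lemma serves for densities as well as for several variables, where the other coordinates are
  put into the weight.\<close>

lemma laplace_unique:
  fixes F X :: "'a \<Rightarrow> real" and G Y :: "'b \<Rightarrow> real" and a :: ereal
  assumes F: "integrable M F" and G: "integrable N G"
    and X: "X \<in> borel_measurable M" and Y: "Y \<in> borel_measurable N"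
    and X0: "AE x in M. 0 \<le> X x" and Y0: "AE y in N. 0 \<le> Y y"
    and eq: "\<And>n::nat. (\<integral>x. F x * exp (- (real n * X x)) \<partial>M) = (\<integral>y. G y * exp (- (real n * Y y)) \<partial>N)"
  shows "(\<integral>x. F x * indicator {a<..} (ereal (X x)) \<partial>M) = (\<integral>y. G y * indicator {a<..} (ereal (Y y)) \<partial>N)"
proof -
  note [measurable] = borel_measurable_integrable[OF F] borel_measurable_integrable[OF G] X Y
  have bnd: "integrable M (\<lambda>x. F x * exp (- X x) ^ i)" for i :: nat
    by (rule Bochner_Integration.integrable_bound[OF F])
       (use X0 in \<open>auto elim!: eventually_mono simp: abs_mult power_le_one intro!: mult_left_le\<close>)
  have bndG: "integrable N (\<lambda>x. G x * exp (- Y x) ^ i)" for i :: nat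
    by (rule Bochner_Integration.integrable_bound[OF G])
       (use Y0 in \<open>auto elim!: eventually_mono simp: abs_mult power_le_one intro!: mult_left_le\<close>)
  have poly: "(\<integral>x. F x * p (exp (- X x)) \<partial>M) = (\<integral>y. G y * p (exp (- Y y)) \<partial>N)"
    if p: "real_polynomial_function p" for p :: "real \<Rightarrow> real"
  proof -
    obtain c n where p: "p = (\<lambda>x. \<Sum>i\<le>n. c i * x ^ i)"
      using p unfolding real_polynomial_function_iff_sum by blast
    have pw: "(\<integral>x. F x * exp (- X x) ^ i \<partial>M) = (\<integral>y. G y * exp (- Y y) ^ i \<partial>N)" for i
      using eq[of i] by (simp add: exp_of_nat_mult[symmetric] mult.commute)
    have "(\<integral>x. F x * p (exp (- X x)) \<partial>M) = (\<integral>x. (\<Sum>i\<le>n. c i * (F x * exp (- X x) ^ i)) \<partial>M)"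
      by (simp add: p sum_distrib_left mult_ac)
    also have "\<dots> = (\<Sum>i\<le>n. c i * (\<integral>x. F x * exp (- X x) ^ i \<partial>M))"
      using bnd by simp
    also have "\<dots> = (\<Sum>i\<le>n. c i * (\<integral>x. G x * exp (- Y x) ^ i \<partial>N))"
      by (simp add: pw)
    also have "\<dots> = (\<integral>x. (\<Sum>i\<le>n. c i * (G x * exp (- Y x) ^ i)) \<partial>N)"
      using bndG by simp
    also have "\<dots> = (\<integral>y. G y * p (exp (- Y y)) \<partial>N)"
      by (simp add: p sum_distrib_left mult_ac)
    finally show ?thesis .
  qed
  have cont: "(\<integral>x. F x * g (exp (- X x)) \<partial>M) = (\<integral>y. G y * g (exp (- Y y)) \<partial>N)"
    if g: "continuous_on UNIV g" for g :: "real \<Rightarrow> real"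
  proof -
    let ?I = "(\<integral>x. F x * g (exp (- X x)) \<partial>M)" and ?J = "(\<integral>y. G y * g (exp (- Y y)) \<partial>N)"
    let ?K = "(\<integral>x. \<bar>F x\<bar> \<partial>M) + (\<integral>x. \<bar>G x\<bar> \<partial>N)"
    have bnd_e: "\<bar>?I - ?J\<bar> \<le> e * ?K" if "e > 0" for e
    proof -
      obtain p where p: "real_polynomial_function p" and pe: "\<And>x. x \<in> {0..1} \<Longrightarrow> \<bar>g x - p x\<bar> < e"
        using Stone_Weierstrass_real_polynomial_function[of "{0..1}" g e] g \<open>e > 0\<close>
        by (metis compact_Icc continuous_on_subset top_greatest)
      have pc: "continuous_on UNIV p"
        using continuous_on_polymonial_function[of p UNIV] p
        by (simp add: continuous_on_polymonial_function real_polynomial_function_eq)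
      show ?thesis
        using integral_exp_approx[OF F X X0 g pc, of e] integral_exp_approx[OF G Y Y0 g pc, of e] pe poly[OF p]
        by (force simp: algebra_simps abs_le_iff less_imp_le)
    qed
    have eps: "\<bar>?I - ?J\<bar> \<le> 0 + e" if "e > 0" for e
    proof -
      define K where "K = ?K"
      have K: "0 \<le> K" by (simp add: K_def)
      have "\<bar>?I - ?J\<bar> \<le> e / (K + 1) * K"
        using K that unfolding K_def by (intro bnd_e divide_pos_pos) linarith+
      also have "\<dots> \<le> e"
        using K that by (simp add: pos_divide_le_eq ring_distribs)
      finally show ?thesis by simp
    qed
    have "\<bar>?I - ?J\<bar> \<le> 0"
      by (rule field_le_epsilon) (rule eps)
    then show ?thesis by simp
  qed
  show ?thesis
  proof (cases a)
    case PInf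
    then show ?thesis by simp
  next
    case MInf
    then show ?thesis using eq[of 0] by simp
  next
    case (real r)
    \<comment> \<open>A ramp in \<open>u\<close> that vanishes for \<open>u \<ge> exp (- r)\<close>,
      that is for \<open>X \<le> r\<close>, and tends to 1 below; so the limit is the indicator of
      the strict inequality \<open>r < X\<close>.\<close>
    define g where "g k u = min 1 (max 0 (real k * (exp (- r) - u)))" for k u
    have gc: "continuous_on UNIV (g k)" for k
      unfolding g_def by (intro continuous_intros)
    have [measurable]: "g k \<in> borel_measurable borel" for k
      using gc by (rule borel_measurable_continuous_onI)
    have glim: "(\<lambda>k. g k (exp (- x))) \<longlonglongrightarrow> indicator {a<..} (ereal x)" for x
    proof (cases "r < x")
      case True
      then have pos: "exp (- r) - exp (- x) > 0" by simp
      have "\<forall>\<^sub>F k in sequentially. g k (exp (- x)) = 1"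
        using eventually_ge_at_top[of "nat \<lceil>1 / (exp (- r) - exp (- x))\<rceil>"]
      proof eventually_elim
        case (elim k)
        then have "1 / (exp (- r) - exp (- x)) \<le> real k" by linarith
        then have "1 \<le> real k * (exp (- r) - exp (- x))"
          using pos by (simp add: pos_divide_le_eq)
        then show ?case by (simp add: g_def)
      qed
      then show ?thesis
        using True real by (simp add: tendsto_eventually)
    next
      case False
      then have "exp (- r) - exp (- x) \<le> 0" by simp
      then have "real k * (exp (- r) - exp (- x)) \<le> 0" for k
        by (rule mult_nonneg_nonpos[rotated]) simp
      then have "g k (exp (- x)) = 0" for k
        unfolding g_def by (simp add: max_absorb1)
      then show ?thesis using False real by simp
    qed
    have g01: "\<bar>g k u\<bar> \<le> 1" for k u by (auto simp: g_def)
    have 1: "(\<lambda>k. \<integral>x. F x * g k (exp (- X x)) \<partial>M) \<longlonglongrightarrow> (\<integral>x. F x * indicator {a<..} (ereal (X x)) \<partial>M)"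
      by (rule integral_dominated_convergence[where w = "\<lambda>x. \<bar>F x\<bar>"])
         (use F g01 in \<open>auto intro!: tendsto_mult glim mult_left_le simp: abs_mult\<close>)
    have 2: "(\<lambda>k. \<integral>x. G x * g k (exp (- Y x)) \<partial>N) \<longlonglongrightarrow> (\<integral>x. G x * indicator {a<..} (ereal (Y x)) \<partial>N)"
      by (rule integral_dominated_convergence[where w = "\<lambda>x. \<bar>G x\<bar>"])
         (use G g01 in \<open>auto intro!: tendsto_mult glim mult_left_le simp: abs_mult\<close>)
    show ?thesis
      using 1 2 unfolding cont[OF gc] by (rule LIMSEQ_unique)
  qed
qed

section \<open>Tails of distributions and their Laplace transforms\<close>

lemma nn_integral_exp_Ioo:
  assumes "0 < z" "0 \<le> x"
  shows "(\<integral>\<^sup>+t. ennreal (indicator {0<..} t * exp (- (z * t)) * indicator {..<x} t) \<partial>lborel) = ennreal ((1 - exp (- (z * x))) / z)"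
proof -
  have "(\<integral>\<^sup>+t. ennreal (indicator {0<..} t * exp (- (z * t)) * indicator {..<x} t) \<partial>lborel)
    = (\<integral>\<^sup>+t. ennreal (exp (- (z * t))) * indicator {0..x} t \<partial>lborel)"
    using AE_lborel_singleton[of 0] AE_lborel_singleton[of x]
    by (intro nn_integral_cong_AE, eventually_elim) (auto simp: indicator_def)
  also have "\<dots> = ennreal (- exp (- (z * x)) / z - (- exp (- (z * 0)) / z))"
    using assms
    by (intro nn_integral_FTC_Icc) (auto intro!: derivative_eq_intros)
  finally show ?thesis by (simp add: diff_divide_distrib)
qed

text \<open>Fubini on the region \<open>0 < t < X x\<close>: for fixed \<open>x\<close> the integral
  over \<open>t\<close> is \<open>(1 - exp (- (z * x'))) / z\<close> with
  \<open>x' = X x\<close>.\<close>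

lemma (in prob_space) tail_laplace:
  assumes X[measurable]: "X \<in> borel_measurable M" and X0: "AE x in M. 0 \<le> X x" and z: "0 < z"
  shows "has_bochner_integral lborel (\<lambda>t. indicator {0<..} t * exp (- (z * t)) * prob {x \<in> space M. t < X x})
     ((1 - (\<integral>x. exp (- (z * X x)) \<partial>M)) / z)"
proof -
  interpret P: pair_sigma_finite lborel M ..
  have [measurable]: "(\<lambda>t. prob {x \<in> space M. t < X x}) \<in> borel_measurable lborel"
    by measurable
  have "(\<integral>\<^sup>+t. ennreal (indicator {0<..} t * exp (- (z * t)) * prob {x \<in> space M. t < X x}) \<partial>lborel)
    = (\<integral>\<^sup>+t. (\<integral>\<^sup>+x. ennreal (indicator {0<..} t * exp (- (z * t)) * indicator {..<X x} t) \<partial>M) \<partial>lborel)"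
  proof (rule nn_integral_cong)
    fix t :: real
    have "(\<integral>\<^sup>+x. ennreal (indicator {0<..} t * exp (- (z * t)) * indicator {..<X x} t) \<partial>M)
      = (\<integral>\<^sup>+x. ennreal (indicator {0<..} t * exp (- (z * t))) * indicator {x \<in> space M. t < X x} x \<partial>M)"
      by (intro nn_integral_cong) (auto simp: indicator_def)
    also have "\<dots> = ennreal (indicator {0<..} t * exp (- (z * t))) * emeasure M {x \<in> space M. t < X x}"
      by (intro nn_integral_cmult_indicator) measurable
    also have "\<dots> = ennreal (indicator {0<..} t * exp (- (z * t)) * prob {x \<in> space M. t < X x})"
      by (simp add: emeasure_eq_measure ennreal_mult'')
    finally show "ennreal (indicator {0<..} t * exp (- (z * t)) * prob {x \<in> space M. t < X x}) = (\<integral>\<^sup>+x. ennreal (indicator {0<..} t * exp (- (z * t)) * indicator {..<X x} t) \<partial>M)"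
      by simp
  qed
  also have "\<dots> = (\<integral>\<^sup>+x. (\<integral>\<^sup>+t. ennreal (indicator {0<..} t * exp (- (z * t)) * indicator {..<X x} t) \<partial>lborel) \<partial>M)"
  proof (rule P.Fubini'[symmetric])
    have "(\<lambda>(t, x). ennreal (indicator {0<..} t * exp (- (z * t)) * (if t < X x then 1 else 0))) \<in> borel_measurable (lborel \<Otimes>\<^sub>M M)"
      by measurable
    then show "(\<lambda>(t, x). ennreal (indicator {0<..} t * exp (- (z * t)) * indicator {..<X x} t)) \<in> borel_measurable (lborel \<Otimes>\<^sub>M M)"
      by (simp add: indicator_def)
  qed
  also have "\<dots> = (\<integral>\<^sup>+x. ennreal ((1 - exp (- (z * X x))) / z) \<partial>M)"
    using X0 by (intro nn_integral_cong_AE, eventually_elim) (rule nn_integral_exp_Ioo[OF z])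
  also have "\<dots> = ennreal (\<integral>x. (1 - exp (- (z * X x))) / z \<partial>M)"
  proof (rule nn_integral_eq_integral)
    show "integrable M (\<lambda>x. (1 - exp (- (z * X x))) / z)"
      by (rule integrable_const_bound[where B = "1 / z"])
         (use X0 z in \<open>auto elim!: eventually_mono intro!: divide_right_mono simp: abs_le_iff\<close>)
    show "AE x in M. 0 \<le> (1 - exp (- (z * X x))) / z"
      using X0 z by (auto elim!: eventually_mono)
  qed
  also have "(\<integral>x. (1 - exp (- (z * X x))) / z \<partial>M) = (1 - (\<integral>x. exp (- (z * X x)) \<partial>M)) / z"
  proof -
    have "integrable M (\<lambda>x. exp (- (z * X x)))"
      by (rule integrable_const_bound[where B = 1]) (use X0 z in \<open>auto elim!: eventually_mono\<close>)
    then show ?thesis by (simp add: prob_space)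
  qed
  finally show ?thesis
  proof (rule has_bochner_integral_nn_integral[rotated 3])
    have "(\<integral>x. exp (- (z * X x)) \<partial>M) \<le> (\<integral>x. 1 \<partial>M)"
      by (rule integral_mono_AE')
         (use X0 z in \<open>auto elim!: eventually_mono\<close>)
    then show "0 \<le> (1 - (\<integral>x. exp (- (z * X x)) \<partial>M)) / z"
      using z by (simp add: prob_space)
  qed auto
qed

text \<open>The tail is one minus the distribution function. Transforms control only integrals of
  the tail; right continuity is what turns this into an identity at every point.\<close>

lemma (in prob_space) tail_right_continuous:
  assumes X[measurable]: "X \<in> borel_measurable M"
  shows "continuous (at_right t) (\<lambda>t. prob {x \<in> space M. t < (X x :: real)})"
proof -
  interpret D: real_distribution "distr M borel X"
    by (rule real_distribution_distr) fact
  have "prob {x \<in> space M. t < X x} = 1 - cdf (distr M borel X) t" for t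
  proof -
    have "{x \<in> space M. t < X x} = space M - X -` {..t} \<inter> space M"
      by auto
    then show ?thesis
      by (simp add: cdf_def measure_distr prob_compl)
  qed
  then show ?thesis
    by (simp add: continuous_diff D.cdf_is_right_cont)
qed

text \<open>If \<open>f s\<close> were nonzero, right continuity would keep the sign of
  \<open>f\<close> and a size of at least half of \<open>\<bar>f s\<bar>\<close> on some
  \<open>{s<..m}\<close>. The weighted integral over that interval is a difference of two vanishing
  integrals over rays.\<close>

lemma integral_Ioi_zero_imp_zero:
  fixes f :: "real \<Rightarrow> real"
  assumes F: "integrable lborel (\<lambda>t. indicator {0<..} t * exp (- (z * t)) * f t)" and z: "0 < z"
    and zero: "\<And>a. (\<integral>t. indicator {0<..} t * exp (- (z * t)) * f t * indicator {a<..} t \<partial>lborel) = 0"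
    and s: "0 < s" and cont: "continuous (at_right s) f"
  shows "f s = 0"
proof (rule ccontr)
  assume ne: "f s \<noteq> 0"
  let ?F = "\<lambda>t. indicator {0<..} t * exp (- (z * t)) * f t"
  have "(f \<longlongrightarrow> f s) (at_right s)"
    using cont by (simp add: continuous_within)
  then have "\<forall>\<^sub>F t in at_right s. dist (f t) (f s) < \<bar>f s\<bar> / 2"
    using ne by (intro tendstoD) auto
  then obtain b where b: "s < b" "\<And>t. s < t \<Longrightarrow> t < b \<Longrightarrow> \<bar>f t - f s\<bar> < \<bar>f s\<bar> / 2"
    unfolding eventually_at_right_field dist_real_def by blast
  define m where "m = (s + b) / 2"
  have m: "s < m" "m < b" using b by (auto simp: m_def)
  have int: "integrable lborel (\<lambda>t. ?F t * indicator A t)" if "A \<in> sets borel" for A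
    using that F by (intro integrable_real_mult_indicator) auto
  have "(\<integral>t. ?F t * indicator {s<..m} t \<partial>lborel) = (\<integral>t. ?F t * indicator {s<..} t - ?F t * indicator {m<..} t \<partial>lborel)"
    using m by (intro Bochner_Integration.integral_cong) (auto simp: indicator_def)
  also have "\<dots> = 0"
    using int by (subst Bochner_Integration.integral_diff) (auto simp: zero)
  finally have 0: "(\<integral>t. sgn (f s) * (?F t * indicator {s<..m} t) \<partial>lborel) = 0"
    by simp
  have "exp (- (z * m)) * (\<bar>f s\<bar> / 2) * (m - s) = (\<integral>t. exp (- (z * m)) * (\<bar>f s\<bar> / 2) * indicator {s<..m} t \<partial>lborel)"
    using m by simp
  also have "\<dots> \<le> (\<integral>t. sgn (f s) * (?F t * indicator {s<..m} t) \<partial>lborel)"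
  proof (rule integral_mono)
    show "integrable lborel (\<lambda>t. sgn (f s) * (?F t * indicator {s<..m} t))"
      by (intro integrable_mult_right int) auto
    fix t
    show "exp (- (z * m)) * (\<bar>f s\<bar> / 2) * indicator {s<..m} t \<le> sgn (f s) * (?F t * indicator {s<..m} t)"
    proof (cases "t \<in> {s<..m}")
      case True
      then have "\<bar>f t - f s\<bar> < \<bar>f s\<bar> / 2" using b m by auto
      then have "\<bar>f s\<bar> / 2 \<le> sgn (f s) * f t"
        by (auto simp: sgn_if abs_if split: if_splits)
      moreover have "exp (- (z * m)) \<le> exp (- (z * t))"
        using True z by simp
      ultimately have "exp (- (z * m)) * (\<bar>f s\<bar> / 2) \<le> exp (- (z * t)) * (sgn (f s) * f t)"
        by (intro mult_mono) auto
      then show ?thesis using True s by (simp add: mult_ac)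
    qed simp
  qed (use m in auto)
  finally have "exp (- (z * m)) * (\<bar>f s\<bar> / 2) * (m - s) \<le> 0"
    unfolding 0 .
  moreover have "exp (- (z * m)) * (\<bar>f s\<bar> / 2) * (m - s) > 0"
    using ne m by simp
  ultimately show False by linarith
qed

text \<open>Agreement from \<open>z0\<close> on is enough: \<open>exp (- (z0 * t))\<close> becomes
  part of the weight, and the arguments \<open>z0 + n\<close> are the integer arguments needed for
  uniqueness. This matters because a series for \<open>g\<close> can be transformed term by term
  only at large arguments.\<close>

lemma (in prob_space) tail_eq_of_laplace:
  assumes X[measurable]: "X \<in> borel_measurable M" and X0: "AE x in M. 0 \<le> X x" and z0: "0 < z0"
    and g: "\<And>z. z0 \<le> z \<Longrightarrow> has_bochner_integral lborel (\<lambda>t. indicator {0<..} t * exp (- (z * t)) * g t)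
       ((1 - (\<integral>x. exp (- (z * X x)) \<partial>M)) / z)"
    and cont: "\<And>t. 0 < t \<Longrightarrow> isCont g t" and s: "0 < s"
  shows "prob {x \<in> space M. s < X x} = g s"
proof -
  define f where "f t = prob {x \<in> space M. t < X x} - g t" for t
  have f: "has_bochner_integral lborel (\<lambda>t. indicator {0<..} t * exp (- (z * t)) * f t) 0" if "z0 \<le> z" for z
    using has_bochner_integral_diff[OF tail_laplace[OF X X0, of z] g[OF that]] that z0
    by (simp add: f_def right_diff_distrib)
  let ?F = "\<lambda>t. indicator {0<..} t * exp (- (z0 * t)) * f t"
  have F: "integrable lborel ?F"
    using f[of z0] by (simp add: has_bochner_integral_iff)
  \<comment> \<open>The difference of the two densities is compared with the zero weight.
    \<open>max 0 t\<close> supplies the required nonnegative variable and equals \<open>t\<close>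
    wherever \<open>?F\<close> is nonzero.\<close>
  have "(\<integral>t. ?F t * indicator {ereal a<..} (ereal (max 0 t)) \<partial>lborel) = (\<integral>t. 0 * indicator {ereal a<..} (ereal 0) \<partial>lborel)" for a
  proof (rule laplace_unique[OF F])
    fix n :: nat
    have "(\<integral>t. ?F t * exp (- (real n * max 0 t)) \<partial>lborel) = (\<integral>t. indicator {0<..} t * exp (- ((z0 + real n) * t)) * f t \<partial>lborel)"
      by (intro Bochner_Integration.integral_cong) (auto simp: indicator_def exp_add[symmetric] algebra_simps)
    then show "(\<integral>t. ?F t * exp (- (real n * max 0 t)) \<partial>lborel) = (\<integral>t. 0 * exp (- (real n * 0)) \<partial>lborel)"
      using f[of "z0 + real n"] by (simp add: has_bochner_integral_iff)
  qed auto
  moreover have "(\<lambda>t. ?F t * indicator {ereal a<..} (ereal (max 0 t))) = (\<lambda>t. ?F t * indicator {a<..} t)" for a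
    by (auto simp: indicator_def fun_eq_iff)
  ultimately have "(\<integral>t. ?F t * indicator {a<..} t \<partial>lborel) = 0" for a
    by simp
  moreover have "continuous (at_right s) f"
    unfolding f_def using cont[OF s]
    by (intro continuous_diff tail_right_continuous X) (rule continuous_at_imp_continuous_at_within)
  ultimately have "f s = 0"
    using integral_Ioi_zero_imp_zero[OF F z0] s by blast
  then show ?thesis by (simp add: f_def)
qed

section \<open>The power series\<close>

text \<open>The Riemann-Liouville kernel: division by \<open>Gamma (e + 1)\<close> makes its
  transform the pure power \<open>z powr (- e - 1)\<close>, so a power series in negative powers of
  \<open>z\<close> inverts without further constants.\<close>

definition npow :: "real \<Rightarrow> real \<Rightarrow> real" where
  "npow e t = t powr e / Gamma (e + 1)"

lemma npow_nonneg: "0 \<le> e \<Longrightarrow> 0 \<le> npow e t"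
  unfolding npow_def by (intro divide_nonneg_nonneg less_imp_le[OF Gamma_real_pos]) auto

lemma npow_mono: "0 \<le> e \<Longrightarrow> 0 \<le> s \<Longrightarrow> s \<le> t \<Longrightarrow> npow e s \<le> npow e t"
  unfolding npow_def by (intro divide_right_mono powr_mono2 less_imp_le[OF Gamma_real_pos]) auto

lemma npow_measurable[measurable]: "npow e \<in> borel_measurable borel"
  unfolding npow_def by measurable

text \<open>Euler's integral for \<open>Gamma (e + 1)\<close> after the substitution of
  \<open>z * t\<close> for the variable. Working with nonnegative integrals yields integrability
  together with the value.\<close>

lemma npow_laplace:
  assumes e: "0 \<le> e" and z: "0 < z"
  shows "has_bochner_integral lborel (\<lambda>t. indicator {0<..} t * exp (- (z * t)) * npow e t) (z powr (- e - 1))"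
proof -
  have G: "Gamma (e + 1) > 0" using e by (intro Gamma_real_pos) auto
  have "ennreal (Gamma (e + 1)) = (\<integral>\<^sup>+ t. ennreal (indicator {0..} t * t powr e / exp t) \<partial>lborel)"
    using Gamma_conv_nn_integral_real[of "e + 1"] e by simp
  also have "\<dots> = ennreal \<bar>z\<bar> * (\<integral>\<^sup>+ t. ennreal (indicator {0..} (0 + z * t) * (0 + z * t) powr e / exp (0 + z * t)) \<partial>lborel)"
    using z by (intro nn_integral_real_affine) auto
  also have "(\<integral>\<^sup>+ t. ennreal (indicator {0..} (0 + z * t) * (0 + z * t) powr e / exp (0 + z * t)) \<partial>lborel)
      = (\<integral>\<^sup>+ t. ennreal (z powr e * Gamma (e + 1)) * ennreal (indicator {0<..} t * exp (- (z * t)) * npow e t) \<partial>lborel)"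
  proof (rule nn_integral_cong_AE)
    show "AE t in lborel. ennreal (indicator {0..} (0 + z * t) * (0 + z * t) powr e / exp (0 + z * t))
        = ennreal (z powr e * Gamma (e + 1)) * ennreal (indicator {0<..} t * exp (- (z * t)) * npow e t)"
      using AE_lborel_singleton[of 0]
    proof eventually_elim
      case (elim t)
      show ?case
      proof (cases "t > 0")
        case True
        then show ?thesis using z G
          by (subst ennreal_mult[symmetric])
             (auto simp: npow_def powr_mult exp_minus field_simps)
      next
        case False
        then show ?thesis using elim z by (auto simp: indicator_def zero_le_mult_iff)
      qed
    qed
  qed
  also have "\<dots> = ennreal (z powr e * Gamma (e + 1)) * (\<integral>\<^sup>+ t. ennreal (indicator {0<..} t * exp (- (z * t)) * npow e t) \<partial>lborel)"
    by (rule nn_integral_cmult) measurable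
  finally have 0: "ennreal (Gamma (e + 1)) = ennreal \<bar>z\<bar> * (ennreal (z powr e * Gamma (e + 1)) * (\<integral>\<^sup>+ t. ennreal (indicator {0<..} t * exp (- (z * t)) * npow e t) \<partial>lborel))" .
  define I where "I = (\<integral>\<^sup>+ t. ennreal (indicator {0<..} t * exp (- (z * t)) * npow e t) \<partial>lborel)"
  define c where "c = z * (z powr e * Gamma (e + 1))"
  have c: "c > 0" using z G by (simp add: c_def)
  have *: "ennreal (Gamma (e + 1)) = ennreal c * I"
    using 0 z G unfolding I_def[symmetric] c_def by (simp add: ennreal_mult' mult.assoc)
  have "z powr (- e - 1) = inverse (z powr (e + 1))"
    by (simp add: powr_minus[symmetric])
  also have "\<dots> = inverse c * Gamma (e + 1)"
    using z G by (simp add: c_def powr_add)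
  finally have "ennreal (z powr (- e - 1)) = ennreal (inverse c) * ennreal (Gamma (e + 1))"
    using c G by (simp add: ennreal_mult)
  also have "\<dots> = ennreal (inverse c * c) * I"
    unfolding * using c by (simp only: ennreal_mult' mult.assoc inverse_nonnegative_iff_nonnegative less_imp_le)
  also have "\<dots> = I"
    using c by simp
  also have "I = (\<integral>\<^sup>+ t. ennreal (indicator {0<..} t * exp (- (z * t)) * npow e t) \<partial>lborel)"
    by (rule I_def)
  finally show ?thesis
    by (intro has_bochner_integral_nn_integral) (auto simp: npow_nonneg e)
qed

text \<open>A null set contains no interval of length 1. This provides points of convergence
  arbitrarily far to the right.\<close>

lemma AE_lborel_imp_greater:
  assumes "AE x in lborel. P (x::real)"
  shows "\<exists>x>t. P x"
proof (rule ccontr)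
  assume not: "\<not> ?thesis"
  obtain N where N: "{x \<in> space lborel. \<not> P x} \<subseteq> N" "emeasure lborel N = 0" "N \<in> sets lborel"
    using assms by (rule AE_E)
  have "{t<..t+1} \<subseteq> N" using N(1) not by auto
  then have "emeasure lborel {t<..t+1} \<le> emeasure lborel N"
    using N(3) by (rule emeasure_mono)
  then show False using N(2) by simp
qed

text \<open>Both series of the theorem are instances: \<open>al\<close> is \<open>\<alpha>1\<close>,
  \<open>ga\<close> is \<open>\<alpha>1 - \<alpha>2\<close>, and the offset \<open>be\<close> is 0
  for the first and \<open>\<alpha>1 - \<alpha>2\<close> for the second.\<close>

locale npow_series =
  fixes al ga be :: real
  assumes al: "0 < al" and ga: "0 < ga" and be: "0 \<le> be"
begin

definition expo :: "nat \<Rightarrow> nat \<Rightarrow> real" where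
  "expo r j = ga * real r + al * real j + be"

text \<open>The inverse transform of one monomial in the expansion of
  \<open>z powr (- be - 1) / (1 - rho A B z)\<close>, with the binomial coefficient from the power
  \<open>r + j\<close> of \<open>rho\<close>. Summation over \<open>j\<close> gives a Mittag-Leffler
  function, summation along \<open>r + j = n\<close> gives \<open>diag\<close>, whose transform is a
  single power of \<open>rho\<close>.\<close>

definition dterm :: "real \<Rightarrow> real \<Rightarrow> real \<Rightarrow> nat \<Rightarrow> nat \<Rightarrow> real" where
  "dterm A B t r j = real (r + j choose r) * A ^ r * B ^ j * npow (expo r j) t"

definition diag :: "real \<Rightarrow> real \<Rightarrow> real \<Rightarrow> nat \<Rightarrow> real" where
  "diag A B t n = (\<Sum>r\<le>n. dterm A B t r (n - r))"

lemma expo_nonneg: "0 \<le> expo r j"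
  using al ga be by (simp add: expo_def)

lemma Gamma_expo: "Gamma (expo r j + 1) \<noteq> 0"
  using Gamma_real_pos[of "expo r j + 1"] expo_nonneg[of r j] by linarith

lemma abs_dterm: "\<bar>dterm A B t r j\<bar> = dterm \<bar>A\<bar> \<bar>B\<bar> t r j"
  by (simp add: dterm_def abs_mult power_abs npow_nonneg expo_nonneg)

lemma dterm_nonneg: "0 \<le> A \<Longrightarrow> 0 \<le> B \<Longrightarrow> 0 \<le> dterm A B t r j"
  by (simp add: dterm_def npow_nonneg expo_nonneg)

lemma diag_nonneg: "0 \<le> A \<Longrightarrow> 0 \<le> B \<Longrightarrow> 0 \<le> diag A B t n"
  unfolding diag_def by (intro sum_nonneg dterm_nonneg)

lemma abs_diag_le: "\<bar>diag A B t n\<bar> \<le> diag \<bar>A\<bar> \<bar>B\<bar> t n"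
  unfolding diag_def abs_dterm[symmetric] by (rule sum_abs)

lemma diag_mono:
  assumes "0 \<le> A" "0 \<le> B" "0 \<le> s" "s \<le> t"
  shows "diag A B s n \<le> diag A B t n"
  unfolding diag_def dterm_def
  using assms by (intro sum_mono mult_left_mono npow_mono expo_nonneg) auto

lemma diag_measurable[measurable]: "(\<lambda>t. diag A B t n) \<in> borel_measurable borel"
  unfolding diag_def dterm_def by measurable

definition rho :: "real \<Rightarrow> real \<Rightarrow> real \<Rightarrow> real" where
  "rho A B z = A * z powr - ga + B * z powr - al"

text \<open>Under the transform this is the binomial theorem for \<open>rho A B z ^ n\<close>; the
  powers of \<open>z\<close> multiply correctly because \<open>expo\<close> is affine in
  \<open>r\<close> and \<open>j\<close>.\<close>

lemma diag_laplace:
  assumes z: "0 < z"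
  shows "has_bochner_integral lborel (\<lambda>t. indicator {0<..} t * exp (- (z * t)) * diag A B t n)
     (z powr (- be - 1) * rho A B z ^ n)"
proof -
  have "has_bochner_integral lborel
     (\<lambda>t. \<Sum>r\<le>n. (real (n choose r) * A ^ r * B ^ (n - r)) * (indicator {0<..} t * exp (- (z * t)) * npow (expo r (n - r)) t))
     (\<Sum>r\<le>n. (real (n choose r) * A ^ r * B ^ (n - r)) * z powr (- expo r (n - r) - 1))"
    by (intro has_bochner_integral_sum has_bochner_integral_mult_right npow_laplace expo_nonneg z)
  moreover have "(\<lambda>t. \<Sum>r\<le>n. (real (n choose r) * A ^ r * B ^ (n - r)) * (indicator {0<..} t * exp (- (z * t)) * npow (expo r (n - r)) t))
     = (\<lambda>t. indicator {0<..} t * exp (- (z * t)) * diag A B t n)"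
    by (rule ext) (auto simp: diag_def dterm_def sum_distrib_left mult_ac intro!: sum.cong)
  moreover have "(\<Sum>r\<le>n. (real (n choose r) * A ^ r * B ^ (n - r)) * z powr (- expo r (n - r) - 1))
     = z powr (- be - 1) * rho A B z ^ n"
  proof -
    have pw: "z powr (- expo r (n - r) - 1) = z powr (- be - 1) * (z powr - ga) ^ r * (z powr - al) ^ (n - r)" for r
    proof -
      have "- expo r (n - r) - 1 = (- be - 1) + (- ga) * real r + (- al) * real (n - r)"
        by (simp add: expo_def)
      then have "z powr (- expo r (n - r) - 1) = z powr (- be - 1) * z powr ((- ga) * real r) * z powr ((- al) * real (n - r))"
        by (simp only: powr_add)
      then show ?thesis
        using z by (simp only: powr_powr[symmetric] powr_realpow powr_gt_zero)
    qed
    show ?thesis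
      unfolding rho_def binomial_ring pw sum_distrib_left
      by (intro sum.cong) (auto simp: power_mult_distrib mult_ac)
  qed
  ultimately show ?thesis by simp
qed

lemma rho_eventually: "\<forall>\<^sub>F z in at_top. rho \<bar>A\<bar> \<bar>B\<bar> z < 1"
proof -
  have "(rho \<bar>A\<bar> \<bar>B\<bar> \<longlongrightarrow> \<bar>A\<bar> * 0 + \<bar>B\<bar> * 0) at_top"
    unfolding rho_def using al ga
    by (intro tendsto_intros tendsto_neg_powr filterlim_ident) auto
  then show ?thesis
    by (intro order_tendstoD(2)[of _ 0]) auto
qed

lemma rho_nonneg: "0 \<le> rho \<bar>A\<bar> \<bar>B\<bar> z"
  by (simp add: rho_def)

lemma abs_rho_le: "\<bar>rho A B z\<bar> \<le> rho \<bar>A\<bar> \<bar>B\<bar> z"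
  unfolding rho_def by (rule order_trans[OF abs_triangle_ineq]) (simp add: abs_mult)

text \<open>Summability needs no growth estimate for \<open>Gamma\<close>: the Laplace transform of the series of
  absolute values is finite for large \<open>z\<close>, so that series converges almost everywhere, and its
  terms increase with \<open>t\<close>.\<close>

lemma summable_abs_diag:
  assumes t: "0 \<le> t"
  shows "summable (diag \<bar>A\<bar> \<bar>B\<bar> t)"
proof -
  have "\<forall>\<^sub>F z in at_top. rho \<bar>A\<bar> \<bar>B\<bar> z < 1 \<and> 0 < z"
    by (intro eventually_conj rho_eventually eventually_gt_at_top)
  then obtain z where z: "rho \<bar>A\<bar> \<bar>B\<bar> z < 1" "0 < z"
    unfolding eventually_at_top_linorder by blast
  define f where "f n t = indicator {0<..} t * exp (- (z * t)) * diag \<bar>A\<bar> \<bar>B\<bar> t n" for n t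
  have [measurable]: "f n \<in> borel_measurable borel" for n
    unfolding f_def by measurable
  have f0: "0 \<le> f n t" for n t
    by (simp add: f_def diag_nonneg)
  have "(\<integral>\<^sup>+t. f n t \<partial>lborel) = ennreal (z powr (- be - 1) * rho \<bar>A\<bar> \<bar>B\<bar> z ^ n)" for n
    using diag_laplace[OF z(2), of "\<bar>A\<bar>" "\<bar>B\<bar>" n] f0 unfolding f_def[symmetric]
    by (simp add: has_bochner_integral_iff nn_integral_eq_integral)
  then have "(\<integral>\<^sup>+t. (\<Sum>n. ennreal (f n t)) \<partial>lborel) = (\<Sum>n. ennreal (z powr (- be - 1) * rho \<bar>A\<bar> \<bar>B\<bar> z ^ n))"
    by (subst nn_integral_suminf) auto
  also have "\<dots> \<noteq> \<infinity>"
    using z by (simp add: infinity_ennreal_def ennreal_suminf_neq_top summable_mult summable_geometric rho_nonneg)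
  finally have "AE t in lborel. (\<Sum>n. ennreal (f n t)) \<noteq> \<infinity>"
    by (intro nn_integral_PInf_AE) auto
  then obtain s where s: "s > max 0 t" "(\<Sum>n. ennreal (f n s)) \<noteq> \<infinity>"
    using AE_lborel_imp_greater by blast
  then have "summable (\<lambda>n. f n s)"
    by (intro summable_suminf_not_top f0) (simp add: infinity_ennreal_def)
  then have "summable (\<lambda>n. exp (z * s) * f n s)"
    by (rule summable_mult)
  also have "(\<lambda>n. exp (z * s) * f n s) = diag \<bar>A\<bar> \<bar>B\<bar> s"
    using s by (auto simp: f_def exp_minus)
  finally have *: "summable (diag \<bar>A\<bar> \<bar>B\<bar> s)" .
  show ?thesis
    using s t by (intro summable_comparison_test'[OF *, of 0]) (auto simp: diag_nonneg diag_mono)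
qed

definition dsum :: "real \<Rightarrow> real \<Rightarrow> real \<Rightarrow> real" where
  "dsum A B t = (\<Sum>n. diag A B t n)"

text \<open>The terms with absolute coefficients increase in \<open>t\<close>, so their values at
  \<open>K\<close> are majorants for the Weierstrass test. The point 0 is left out because
  \<open>0 powr 0 = 0\<close> breaks continuity of the constant term.\<close>

lemma continuous_on_dsum: "continuous_on {0<..<K} (dsum A B)"
proof (cases "0 \<le> K")
  case True
  have "uniform_limit {0<..<K} (\<lambda>n t. \<Sum>i<n. diag A B t i) (\<lambda>t. \<Sum>i. diag A B t i) sequentially"
  proof (rule Weierstrass_m_test)
    show "summable (diag \<bar>A\<bar> \<bar>B\<bar> K)"
      by (rule summable_abs_diag[OF True])
    fix n t assume "t \<in> {0<..<K}"
    then show "norm (diag A B t n) \<le> diag \<bar>A\<bar> \<bar>B\<bar> K n"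
      using order_trans[OF abs_diag_le diag_mono[of "\<bar>A\<bar>" "\<bar>B\<bar>" t K]] by auto
  qed
  moreover have "continuous_on {0<..<K} (\<lambda>t. \<Sum>i<n. diag A B t i)" for n
    unfolding diag_def dterm_def npow_def
    by (intro continuous_intros) (use Gamma_expo in auto)
  ultimately show ?thesis
    unfolding dsum_def by (intro uniform_limit_theorem[where F = sequentially]) auto
qed simp

lemma isCont_dsum:
  assumes "0 < t"
  shows "isCont (dsum A B) t"
  using continuous_on_dsum[of "t + 1" A B] assms
  by (simp add: continuous_on_eq_continuous_at)

text \<open>The integrals of the absolute values are dominated by a geometric series with ratio
  \<open>rho \<bar>A\<bar> \<bar>B\<bar> z\<close>, which permits the exchange of sum and integral;
  a geometric series with ratio \<open>rho A B z\<close> remains.\<close>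

lemma dsum_laplace:
  assumes z: "0 < z" "rho \<bar>A\<bar> \<bar>B\<bar> z < 1"
  shows "has_bochner_integral lborel (\<lambda>t. indicator {0<..} t * exp (- (z * t)) * dsum A B t)
     (z powr (- be - 1) / (1 - rho A B z))"
proof -
  define f where "f n t = indicator {0<..} t * exp (- (z * t)) * diag A B t n" for n t
  define g where "g n t = indicator {0<..} t * exp (- (z * t)) * diag \<bar>A\<bar> \<bar>B\<bar> t n" for n t
  have fg: "\<bar>f n t\<bar> \<le> g n t" for n t
    unfolding f_def g_def by (auto simp: abs_mult abs_diag_le intro!: mult_left_mono)
  have int_f: "integrable lborel (f n)" and f: "(\<integral>t. f n t \<partial>lborel) = z powr (- be - 1) * rho A B z ^ n"
   and int_g: "integrable lborel (g n)" and g: "(\<integral>t. g n t \<partial>lborel) = z powr (- be - 1) * rho \<bar>A\<bar> \<bar>B\<bar> z ^ n" for n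
    using diag_laplace[OF z(1), of A B n] diag_laplace[OF z(1), of "\<bar>A\<bar>" "\<bar>B\<bar>" n]
    unfolding f_def[symmetric] g_def[symmetric] has_bochner_integral_iff by auto
  have AE: "AE t in lborel. summable (\<lambda>n. norm (f n t))"
  proof (rule AE_I2)
    fix t :: real
    show "summable (\<lambda>n. norm (f n t))"
    proof (cases "0 < t")
      case True
      then have "summable (\<lambda>n. exp (- (z * t)) * diag \<bar>A\<bar> \<bar>B\<bar> t n)"
        by (intro summable_mult summable_abs_diag) auto
      then show ?thesis
        by (rule summable_comparison_test'[where N = 0])
           (use True in \<open>auto simp: f_def abs_mult abs_diag_le\<close>)
    qed (simp add: f_def)
  qed
  have sum: "summable (\<lambda>n. \<integral>t. norm (f n t) \<partial>lborel)"
  proof (rule summable_comparison_test'[where N = 0])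
    show "summable (\<lambda>n. z powr (- be - 1) * rho \<bar>A\<bar> \<bar>B\<bar> z ^ n)"
      using z by (intro summable_mult summable_geometric) (auto simp: rho_nonneg)
    fix n
    have "(\<integral>t. norm (f n t) \<partial>lborel) \<le> (\<integral>t. g n t \<partial>lborel)"
      using int_f int_g fg by (intro integral_mono) auto
    then show "norm (\<integral>t. norm (f n t) \<partial>lborel) \<le> z powr (- be - 1) * rho \<bar>A\<bar> \<bar>B\<bar> z ^ n"
      unfolding g by simp
  qed
  have eq: "(\<lambda>t. \<Sum>n. f n t) = (\<lambda>t. indicator {0<..} t * exp (- (z * t)) * dsum A B t)"
  proof
    fix t
    show "(\<Sum>n. f n t) = indicator {0<..} t * exp (- (z * t)) * dsum A B t"
    proof (cases "0 < t")
      case True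
      have "summable (diag A B t)"
        by (rule summable_comparison_test'[OF summable_abs_diag[of t A B], of 0])
           (use True in \<open>auto simp: abs_diag_le\<close>)
      then show ?thesis
        unfolding f_def dsum_def by (rule suminf_mult)
    qed (simp add: f_def)
  qed
  have "(\<Sum>n. z powr (- be - 1) * rho A B z ^ n) = z powr (- be - 1) / (1 - rho A B z)"
    using z abs_rho_le[of A B z] by (subst suminf_mult) (auto simp: suminf_geometric summable_geometric)
  then show ?thesis
    using integrable_suminf[OF int_f AE sum] integral_suminf[OF int_f AE sum]
    unfolding eq f by (simp add: has_bochner_integral_iff)
qed

text \<open>Absolute summability over the triangle \<open>r \<le> n\<close> makes the order of
  summation free. Diagonals suit the transform, whereas the theorem sums by rows.\<close>

lemma dterm_has_sum:
  assumes t: "0 \<le> t"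
  shows "((\<lambda>(r, j). dterm A B t r j) has_sum dsum A B t) (UNIV \<times> UNIV)"
proof -
  define d where "d = (\<lambda>(n, r). dterm A B t r (n - r))"
  have "(\<lambda>n. \<Sum>r\<le>n. norm (d (n, r))) = diag \<bar>A\<bar> \<bar>B\<bar> t"
    by (simp add: d_def diag_def abs_dterm fun_eq_iff)
  moreover have "diag \<bar>A\<bar> \<bar>B\<bar> t summable_on UNIV"
    using summable_abs_diag[OF t, of A B] by (intro norm_summable_imp_summable_on) (simp add: diag_nonneg)
  ultimately have "(\<lambda>x. norm (d x)) summable_on (SIGMA n:UNIV. {..n})"
    by (intro Infinite_Sum.abs_summable_on_Sigma_iff[THEN iffD2])
       (simp add: diag_nonneg sum_nonneg)
  then have "d summable_on (SIGMA n:UNIV. {..n})"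
    by (rule abs_summable_summable)
  then have 1: "(d has_sum infsum d (SIGMA n:UNIV. {..n})) (SIGMA n:UNIV. {..n})"
    by (rule has_sum_infsum)
  then have "(diag A B t has_sum infsum d (SIGMA n:UNIV. {..n})) UNIV"
    by (rule has_sum_SigmaD) (auto simp: d_def diag_def)
  then have "diag A B t sums infsum d (SIGMA n:UNIV. {..n})"
    by (rule has_sum_imp_sums)
  then have "infsum d (SIGMA n:UNIV. {..n}) = dsum A B t"
    by (simp add: dsum_def sums_iff)
  with 1 have "(d has_sum dsum A B t) (SIGMA n:UNIV. {..n})"
    by simp
  then show ?thesis
    by (rule has_sum_reindex_bij_witness[of _ "\<lambda>(r, j). (r + j, r)" "\<lambda>(n, r). (r, n - r)", THEN iffD1, rotated -1])
       (auto simp: d_def)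
qed

lemma dterm_iterated:
  assumes t: "0 \<le> t"
  shows "summable (dterm A B t r)" "(\<lambda>r. \<Sum>j. dterm A B t r j) sums dsum A B t"
proof -
  have inner: "dterm A B t r summable_on UNIV" for r
    using summable_on_SigmaD1[of "dterm A B t" UNIV "\<lambda>_. UNIV" r] dterm_has_sum[OF t, of A B]
    by (auto simp: summable_on_def)
  then show "summable (dterm A B t r)"
    by (rule summable_on_imp_summable)
  have "(dterm A B t r has_sum (\<Sum>j. dterm A B t r j)) UNIV" for r
    using has_sum_infsum[OF inner, of r] has_sum_imp_sums sums_unique by metis
  then have "((\<lambda>r. \<Sum>j. dterm A B t r j) has_sum dsum A B t) UNIV"
    by (intro has_sum_SigmaD[OF dterm_has_sum[OF t]]) auto
  then show "(\<lambda>r. \<Sum>j. dterm A B t r j) sums dsum A B t"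
    by (rule has_sum_imp_sums)
qed

lemma mittag_leffler3_dterm:
  assumes t: "0 < t"
  shows "A ^ r * t powr (ga * real r + be) * mittag_leffler3 (real r + 1) al (ga * real r + be + 1) (B * t powr al)
    = (\<Sum>j. dterm A B t r j)"
proof -
  have "dterm A B t r j = A ^ r * t powr (ga * real r + be) *
     (Gamma (real r + 1 + real j) * (B * t powr al) ^ j / (fact j * Gamma (real r + 1) * Gamma (al * real j + (ga * real r + be + 1))))" for j
  proof -
    have 1: "Gamma (real r + 1) = fact r" "Gamma (real r + 1 + real j) = fact (r + j)"
      using Gamma_fact[of r, where 'a = real] Gamma_fact[of "r + j", where 'a = real] by (simp_all add: add_ac)
    have 2: "(B * t powr al) ^ j = B ^ j * t powr (al * real j)"
      using t by (simp add: power_mult_distrib powr_powr[symmetric] powr_realpow)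
    have 3: "t powr expo r j = t powr (ga * real r + be) * t powr (al * real j)"
      by (simp add: expo_def powr_add[symmetric] add_ac)
    have 4: "real (r + j choose r) = fact (r + j) / (fact r * fact j)"
      using binomial_fact[of r "r + j", where 'a = real] by simp
    show ?thesis
      unfolding dterm_def npow_def 1 2 3 4 by (simp add: expo_def add_ac mult_ac)
  qed
  note eq = this
  show ?thesis
  \<comment> \<open>If \<open>A = 0\<close>, which happens for \<open>c2 = 0\<close>, the factor
    \<open>A ^ r\<close> cannot be cancelled to obtain summability of the Mittag-Leffler series, but
    then both sides are 0.\<close>
  proof (cases "A ^ r = 0")
    case True
    then have "A = 0" "0 < r" by auto
    then show ?thesis by (simp add: dterm_def zero_power)
  next
    case False
    then have "summable (\<lambda>j. Gamma (real r + 1 + real j) * (B * t powr al) ^ j / (fact j * Gamma (real r + 1) * Gamma (al * real j + (ga * real r + be + 1))))"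
      using dterm_iterated(1)[of t A B r] t unfolding eq summable_cmult_iff by auto
    then show ?thesis
      unfolding eq mittag_leffler3_def by (rule suminf_mult[symmetric])
  qed
qed

end

section \<open>The embedded grid chain of the Erlang queue\<close>

lemma trans_nonneg:
  "transition_function_with_rates S q p \<Longrightarrow> 0 \<le> t \<Longrightarrow> x \<in> S \<Longrightarrow> y \<in> S \<Longrightarrow> 0 \<le> p t x y"
  unfolding transition_function_with_rates_def by blast

text \<open>The Chapman-Kolmogorov equation with the nonnegative contributions outside
  \<open>F\<close> dropped. Selecting a few intermediate states in this way is the source of all
  lower bounds on \<open>p\<close>.\<close>

lemma trans_step_ge:
  assumes tf: "transition_function_with_rates S q p" and st: "0 \<le> s" "0 \<le> t" and xy: "x \<in> S" "y \<in> S"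
    and F: "finite F" "F \<subseteq> S"
  shows "(\<Sum>z\<in>F. p s x z * p t z y) \<le> p (s + t) x y"
proof -
  have "((\<lambda>z. p s x z * p t z y) has_sum p (s + t) x y) S"
    using tf st xy unfolding transition_function_with_rates_def by blast
  then show ?thesis
    by (rule has_sum_mono_neutral[OF has_sum_finite[OF F(1)]])
       (use F xy trans_nonneg[OF tf st(1) xy(1)] trans_nonneg[OF tf st(2) _ xy(2)] in auto)
qed

text \<open>Passes from a rate at 0 to many equal steps that fill \<open>[0, h]\<close>;
  \<open>Suc n\<close> excludes a division by 0.\<close>

lemma tendsto_at_right_scaled:
  assumes "((\<lambda>h. f h / h) \<longlongrightarrow> (c::real)) (at_right 0)" and h: "0 < h"
  shows "(\<lambda>n. real (Suc n) * f (h / real (Suc n))) \<longlonglongrightarrow> h * c"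
proof -
  have "filterlim (\<lambda>n. h / real (Suc n)) (at_right 0) sequentially"
    using h by real_asymp
  then have "(\<lambda>n. f (h / real (Suc n)) / (h / real (Suc n))) \<longlonglongrightarrow> c"
    by (rule filterlim_compose[OF assms(1)])
  then have "(\<lambda>n. h * (f (h / real (Suc n)) / (h / real (Suc n)))) \<longlonglongrightarrow> h * c"
    by (intro tendsto_intros)
  also have "(\<lambda>n. h * (f (h / real (Suc n)) / (h / real (Suc n)))) = (\<lambda>n. real (Suc n) * f (h / real (Suc n)))"
    using h by (simp add: mult.commute del: of_nat_Suc)
  finally show ?thesis .
qed

text \<open>Resting at \<open>x\<close> in each of \<open>n\<close> equal steps is one way to be at
  \<open>x\<close> at time \<open>h\<close>. Bernoulli's inequality makes the bound linear in the
  defect of a single step, and letting \<open>n\<close> grow replaces that defect by the exit rate,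
  without an error term and for every \<open>h\<close>.\<close>

lemma trans_stay:
  assumes tf: "transition_function_with_rates S q p" and x: "x \<in> S" and h: "0 \<le> h"
  shows "1 - h * (\<Sum>\<^sub>\<infinity>y\<in>S - {x}. q x y) \<le> p h x x"
proof (cases "h = 0")
  case True
  then show ?thesis using tf x by (simp add: transition_function_with_rates_def)
next
  case False
  then have h: "0 < h" using h by simp
  have pow: "p e x x ^ n \<le> p (real n * e) x x" if "0 \<le> e" for e n
  proof (induction n)
    case 0
    then show ?case using tf x by (simp add: transition_function_with_rates_def)
  next
    case (Suc n)
    have "p e x x ^ Suc n \<le> p e x x * p (real n * e) x x"
      using Suc trans_nonneg[OF tf that x x] by (simp add: mult_left_mono)
    also have "\<dots> \<le> p (e + real n * e) x x"
      using trans_step_ge[OF tf that _ x x, of "real n * e" "{x}"] that x by simp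
    finally show ?case by (simp add: algebra_simps)
  qed
  have "1 - real (Suc n) * (1 - p (h / real (Suc n)) x x) \<le> p h x x" for n
  proof -
    have "0 \<le> p (h / real (Suc n)) x x"
      using h by (intro trans_nonneg[OF tf _ x x]) auto
    then have "1 + real (Suc n) * (p (h / real (Suc n)) x x - 1) \<le> (1 + (p (h / real (Suc n)) x x - 1)) ^ Suc n"
      by (intro Bernoulli_inequality) auto
    also have "\<dots> \<le> p h x x"
      using pow[of "h / real (Suc n)" "Suc n"] h by simp
    finally show ?thesis by (simp add: algebra_simps)
  qed
  moreover have "(\<lambda>n. 1 - real (Suc n) * (1 - p (h / real (Suc n)) x x)) \<longlonglongrightarrow> 1 - h * (\<Sum>\<^sub>\<infinity>y\<in>S - {x}. q x y)"
    using tf x h unfolding transition_function_with_rates_def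
    by (intro tendsto_intros tendsto_at_right_scaled[of "\<lambda>h. 1 - p h x x"]) auto
  ultimately show ?thesis
    by (intro tendsto_upperbound) auto
qed

text \<open>Split \<open>[0, h]\<close> into \<open>n\<close> equal steps and keep only the paths that move from \<open>x\<close> to \<open>y\<close> in one of
  the steps and rest in all others.\<close>

lemma trans_move:
  assumes tf: "transition_function_with_rates S q p" and x: "x \<in> S" and y: "y \<in> S" and ne: "x \<noteq> y"
    and C: "(\<Sum>\<^sub>\<infinity>z\<in>S - {x}. q x z) \<le> C" "(\<Sum>\<^sub>\<infinity>z\<in>S - {y}. q y z) \<le> C"
    and h: "0 < h" "C * h \<le> 1" and C0: "0 \<le> C"
  shows "h * q x y * (1 - C * h)\<^sup>2 \<le> p h x y"
proof -
  have stay: "1 - C * e \<le> p e x x" "1 - C * e \<le> p e y y" if "0 \<le> e" for e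
    using trans_stay[OF tf x that] trans_stay[OF tf y that] C that
    by (smt (verit, best) mult.commute mult_left_mono)+
  have "real (Suc n) * p (h / real (Suc n)) x y * (1 - C * h)\<^sup>2 \<le> p h x y" for n
  proof -
    define e where "e = h / real (Suc n)"
    have e: "0 < e" "C * e \<le> 1" "real (Suc n) * e = h"
    proof -
      show "0 < e" using h by (simp add: e_def)
      show "real (Suc n) * e = h" by (simp add: e_def)
      have "1 * e \<le> real (Suc n) * e" using \<open>0 < e\<close> by (intro mult_right_mono) auto
      then have "e \<le> h" using \<open>real (Suc n) * e = h\<close> by linarith
      then show "C * e \<le> 1" using h C0 by (meson mult_left_mono order_trans)
    qed
    have pe: "0 \<le> p e x y" using e by (intro trans_nonneg[OF tf _ x y]) auto
    \<comment> \<open>\<open>1 - C * h\<close> bounds the probability of resting at \<open>x\<close>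
      before the move, the power that of resting at \<open>y\<close> after it. The induction step
      distinguishes whether the move happens in the last step or earlier.\<close>
    have "real m * p e x y * (1 - C * h) * (1 - C * e) ^ m \<le> p (real m * e) x y" if "m \<le> Suc n" for m
      using that
    proof (induction m)
      case 0
      then show ?case using tf x y ne by (simp add: transition_function_with_rates_def)
    next
      case (Suc m)
      have "real m * e \<le> real (Suc n) * e" using Suc.prems e by (intro mult_right_mono) auto
      then have me: "real m * e \<le> h" "0 \<le> real m * e" using e by auto
      have a: "(1 - C * h) * p e x y \<le> p (real m * e) x x * p e x y"
      proof (rule mult_right_mono[OF _ pe])
        have "C * (real m * e) \<le> C * h" using me C0 by (intro mult_left_mono) auto
        then show "1 - C * h \<le> p (real m * e) x x" using stay(1)[OF me(2)] by linarith
      qed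
      have b: "real m * p e x y * (1 - C * h) * (1 - C * e) ^ m * (1 - C * e) \<le> p (real m * e) x y * p e y y"
        using Suc e h pe stay(2)[of e] trans_nonneg[OF tf me(2) x y] by (intro mult_mono) auto
      have c: "(1 - C * e) ^ Suc m \<le> 1"
        using e C0 by (intro power_le_one) auto
      have "real (Suc m) * p e x y * (1 - C * h) * (1 - C * e) ^ Suc m
         = (1 - C * h) * p e x y * (1 - C * e) ^ Suc m + real m * p e x y * (1 - C * h) * (1 - C * e) ^ m * (1 - C * e)"
        by (simp add: algebra_simps)
      also have "\<dots> \<le> (1 - C * h) * p e x y + real m * p e x y * (1 - C * h) * (1 - C * e) ^ m * (1 - C * e)"
        using mult_left_mono[OF c, of "(1 - C * h) * p e x y"] h pe by simp
      also have "\<dots> \<le> p (real m * e) x x * p e x y + p (real m * e) x y * p e y y"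
        using a b by linarith
      also have "\<dots> \<le> p (real m * e + e) x y"
        using trans_step_ge[OF tf me(2) _ x y, of e "{x, y}"] e x y ne by simp
      finally show ?case by (simp add: algebra_simps)
    qed
    from this[of "Suc n"] have 1: "real (Suc n) * p e x y * (1 - C * h) * (1 - C * e) ^ Suc n \<le> p h x y"
      using e by simp
    \<comment> \<open>Bernoulli reduces the power to a second factor \<open>1 - C * h\<close>, hence
      the square in the claim.\<close>
    have "1 + real (Suc n) * (- C * e) \<le> (1 + (- C * e)) ^ Suc n"
      using e by (intro Bernoulli_inequality) auto
    then have "1 - C * h \<le> (1 - C * e) ^ Suc n"
      using e(3) by (simp add: mult.left_commute[of "real (Suc n)"] del: of_nat_Suc power_Suc)
    then have "real (Suc n) * p e x y * (1 - C * h) * (1 - C * h) \<le> real (Suc n) * p e x y * (1 - C * h) * (1 - C * e) ^ Suc n"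
      using h pe by (intro mult_left_mono) auto
    from order_trans[OF this 1] show ?thesis
      by (simp only: e_def power2_eq_square mult.assoc)
  qed
  moreover have "(\<lambda>n. real (Suc n) * p (h / real (Suc n)) x y * (1 - C * h)\<^sup>2) \<longlonglongrightarrow> h * q x y * (1 - C * h)\<^sup>2"
    using tf x y ne h unfolding transition_function_with_rates_def
    by (intro tendsto_intros tendsto_at_right_scaled[of "\<lambda>h. p h x y"]) auto
  ultimately show ?thesis
    by (intro tendsto_upperbound) auto
qed

section \<open>The moves of the Erlang queue and their probabilities in a short time\<close>

definition up_state :: "nat \<Rightarrow> nat \<times> nat \<Rightarrow> nat \<times> nat" where
  "up_state k x = (if x = (0, 0) then (1, k) else (fst x + 1, snd x))"

text \<open>Completion of one phase of service. At \<open>(0, 0)\<close> nobody is served and the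
  value is a mere default, so the empty system is treated apart below.\<close>

definition down_state :: "nat \<Rightarrow> nat \<times> nat \<Rightarrow> nat \<times> nat" where
  "down_state k x = (if snd x \<ge> 2 then (fst x, snd x - 1) else if fst x \<ge> 2 then (fst x - 1, k) else (0, 0))"

lemma up_state_in: "k \<ge> 1 \<Longrightarrow> x \<in> erlang_states k \<Longrightarrow> up_state k x \<in> erlang_states k"
  and down_state_in: "k \<ge> 1 \<Longrightarrow> x \<in> erlang_states k \<Longrightarrow> down_state k x \<in> erlang_states k"
  by (auto simp: erlang_states_def up_state_def down_state_def)

lemma fst_up_state: "fst (up_state k x) = fst x + 1"
  and fst_down_state: "fst (down_state k x) \<le> fst x"
  by (auto simp: up_state_def down_state_def)

lemma rate_up_state:
  "x \<in> erlang_states k \<Longrightarrow> erlang_rate lam mu k x (up_state k x) = lam"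
  by (auto simp: erlang_states_def up_state_def erlang_rate_def)

lemma rate_down_state:
  "x \<in> erlang_states k \<Longrightarrow> x \<noteq> (0, 0) \<Longrightarrow> erlang_rate lam mu k x (down_state k x) = real k * mu"
  by (auto simp: erlang_states_def down_state_def erlang_rate_def)

lemma down_state_neq: "x \<in> erlang_states k \<Longrightarrow> x \<noteq> (0, 0) \<Longrightarrow> down_state k x \<noteq> x"
  by (auto simp: erlang_states_def down_state_def)

lemma total_rate:
  assumes k: "k \<ge> 1" and x: "x \<in> erlang_states k"
  shows "(\<Sum>\<^sub>\<infinity>y\<in>erlang_states k - {x}. erlang_rate lam mu k x y) = lam + (if x = (0, 0) then 0 else real k * mu)"
proof -
  define U where "U = (if x = (0, 0) then {up_state k x} else {up_state k x, down_state k x})"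
  have U: "finite U" "U \<subseteq> erlang_states k - {x}"
    using up_state_in[OF k x] down_state_in[OF k x] fst_up_state[of k x] down_state_neq[OF x]
    by (auto simp: U_def)
  have "erlang_rate lam mu k x y = 0" if "y \<in> erlang_states k" "y \<notin> U" for y
    using that x by (auto simp: U_def erlang_states_def erlang_rate_def up_state_def down_state_def split: if_splits)
  then have "(\<Sum>\<^sub>\<infinity>y\<in>erlang_states k - {x}. erlang_rate lam mu k x y) = (\<Sum>\<^sub>\<infinity>y\<in>U. erlang_rate lam mu k x y)"
    using U by (intro infsum_cong_neutral) auto
  also have "\<dots> = (\<Sum>y\<in>U. erlang_rate lam mu k x y)"
    using U by simp
  also have "\<dots> = lam + (if x = (0, 0) then 0 else real k * mu)"
  proof -
    have "up_state k x \<noteq> down_state k x"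
      using fst_up_state[of k x] fst_down_state[of k x] by auto
    then show ?thesis
      using rate_up_state[OF x, of lam mu] rate_down_state[OF x, of lam mu]
      by (cases "x = (0, 0)") (simp_all add: U_def)
  qed
  finally show ?thesis .
qed

text \<open>Lower bounds for resting, moving up and moving down leave at most \<open>O(h\<^sup>2)\<close> for all other moves;
  this is where uniformity in \<open>x\<close> comes from, which the pointwise rates do not give.\<close>

lemma erlang_transition_bounds:
  assumes tf: "transition_function_with_rates (erlang_states k) (erlang_rate lam mu k) p"
    and k: "k \<ge> 1" and pos: "0 < lam" "0 < mu" and x: "x \<in> erlang_states k"
    and C: "C = lam + real k * mu" and h: "0 < h" "C * h \<le> 1"
  shows "lam * h - 2 * C\<^sup>2 * h\<^sup>2 \<le> p h x (up_state k x)"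
    and "x \<noteq> (0, 0) \<Longrightarrow> 1 - p h x x - p h x (down_state k x) \<le> lam * h + 2 * C\<^sup>2 * h\<^sup>2"
    and "x = (0, 0) \<Longrightarrow> 1 - p h x x \<le> lam * h + 2 * C\<^sup>2 * h\<^sup>2"
proof -
  have C0: "0 \<le> C" and Cl: "lam \<le> C" and Cm: "real k * mu \<le> C" using pos by (auto simp: C)
  have tot: "(\<Sum>\<^sub>\<infinity>z\<in>erlang_states k - {y}. erlang_rate lam mu k y z) \<le> C" if "y \<in> erlang_states k" for y
    using pos by (simp add: total_rate[OF k that] C)
  \<comment> \<open>By \<open>(1 - x)\<^sup>2 \<ge> 1 - 2 * x\<close> at \<open>x = C * h\<close>,
    the loss is at most \<open>h * r * (2 * C * h)\<close>, and \<open>r \<le> C\<close> bounds it.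
    This is the origin of the constant \<open>2 * C\<^sup>2\<close>.\<close>
  have sq: "h * r - 2 * C\<^sup>2 * h\<^sup>2 \<le> h * r * (1 - C * h)\<^sup>2" if r: "0 \<le> r" "r \<le> C" for r
  proof -
    have "h * r - h * r * (2 * C * h) \<le> h * r * (1 - C * h)\<^sup>2"
    proof -
      have "1 - 2 * C * h \<le> (1 - C * h)\<^sup>2" by (simp add: power2_diff)
      then have "h * r * (1 - 2 * C * h) \<le> h * r * (1 - C * h)\<^sup>2"
        using h r by (intro mult_left_mono) auto
      then show ?thesis by (simp add: algebra_simps)
    qed
    moreover have "h * r * (2 * C * h) \<le> h * C * (2 * C * h)"
      using r h C0 by (intro mult_right_mono mult_left_mono) auto
    ultimately show ?thesis by (simp add: power2_eq_square mult_ac)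
  qed
  show "lam * h - 2 * C\<^sup>2 * h\<^sup>2 \<le> p h x (up_state k x)"
  proof -
    have "x \<noteq> up_state k x" using fst_up_state[of k x] by auto
    from trans_move[OF tf x up_state_in[OF k x] this tot[OF x] tot[OF up_state_in[OF k x]] h C0]
    show ?thesis using sq[of lam] pos Cl
      by (simp add: rate_up_state[OF x] mult.commute[of lam h])
  qed
  show "1 - p h x x - p h x (down_state k x) \<le> lam * h + 2 * C\<^sup>2 * h\<^sup>2" if "x \<noteq> (0, 0)"
  proof -
    have "h * (real k * mu) - 2 * C\<^sup>2 * h\<^sup>2 \<le> p h x (down_state k x)"
      using trans_move[OF tf x down_state_in[OF k x] _ tot[OF x] tot[OF down_state_in[OF k x]] h C0] sq[of "real k * mu"] pos Cm
        down_state_neq[OF x that]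
      by (auto simp: rate_down_state[OF x that])
    moreover have "1 - h * (lam + real k * mu) \<le> p h x x"
      using trans_stay[OF tf x, of h] h that by (simp add: total_rate[OF k x])
    ultimately show ?thesis by (simp add: algebra_simps)
  qed
  show "1 - p h x x \<le> lam * h + 2 * C\<^sup>2 * h\<^sup>2" if "x = (0, 0)"
  proof -
    have "1 - lam * h \<le> p h x x"
      using trans_stay[OF tf x, of h] h that unfolding total_rate[OF k x] by (simp add: mult.commute)
    moreover have "0 \<le> 2 * C\<^sup>2 * h\<^sup>2" by simp
    ultimately show ?thesis by linarith
  qed
qed

section \<open>The queue observed on a grid\<close>

text \<open>Lists over a countable type are countable, so a history can be handled through its
  countably many atoms \<open>grid_path Q h m \<omega> = l\<close>.\<close>

definition grid_path :: "(real \<Rightarrow> 'w \<Rightarrow> 'b) \<Rightarrow> real \<Rightarrow> nat \<Rightarrow> 'w \<Rightarrow> 'b list" where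
  "grid_path Q h m \<omega> = map (\<lambda>j. Q (real j * h) \<omega>) [0..<Suc m]"

text \<open>Only the ends of the step are compared, so an arrival offset by a departure in the same
  step goes unnoticed. On a cadlag path this does not occur in a bounded window once
  \<open>h\<close> is small.\<close>

definition grid_arrival :: "(real \<Rightarrow> 'w \<Rightarrow> nat \<times> nat) \<Rightarrow> real \<Rightarrow> nat \<Rightarrow> 'w \<Rightarrow> bool" where
  "grid_arrival Q h m \<omega> \<longleftrightarrow> fst (Q (real (Suc m) * h) \<omega>) = fst (Q (real m * h) \<omega>) + 1"

lemma grid_path_eq_iff:
  "grid_path Q h m \<omega> = l \<longleftrightarrow> length l = Suc m \<and> (\<forall>i\<le>m. Q (real i * h) \<omega> = l ! i)"
proof -
  have "length (grid_path Q h m \<omega>) = Suc m" and "\<And>i. i \<le> m \<Longrightarrow> grid_path Q h m \<omega> ! i = Q (real i * h) \<omega>"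
    unfolding grid_path_def by (simp_all del: upt_Suc)
  then show ?thesis
    unfolding list_eq_iff_nth_eq[of "grid_path Q h m \<omega>" l] by (auto simp: less_Suc_eq_le)
qed

definition grid_count :: "(real \<Rightarrow> 'w \<Rightarrow> nat \<times> nat) \<Rightarrow> real \<Rightarrow> nat \<Rightarrow> 'w \<Rightarrow> nat" where
  "grid_count Q h m \<omega> = card {j. j < m \<and> grid_arrival Q h j \<omega>}"

lemma grid_count_0 [simp]: "grid_count Q h 0 \<omega> = 0"
  by (simp add: grid_count_def)

lemma grid_count_Suc:
  "grid_count Q h (Suc m) \<omega> = grid_count Q h m \<omega> + of_bool (grid_arrival Q h m \<omega>)"
proof -
  have "{j. j < Suc m \<and> grid_arrival Q h j \<omega>} = {j. j < m \<and> grid_arrival Q h j \<omega>} \<union> (if grid_arrival Q h m \<omega> then {m} else {})"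
    by (auto simp: less_Suc_eq)
  then show ?thesis
    by (simp add: grid_count_def card_insert_if)
qed

lemma (in prob_space) measurable_grid_path:
  assumes Q: "\<And>t. t \<ge> 0 \<Longrightarrow> Q t \<in> measurable M (count_space UNIV)" and h: "h \<ge> 0"
  shows "grid_path (Q :: real \<Rightarrow> 'a \<Rightarrow> 'b::countable) h m \<in> measurable M (count_space UNIV)"
proof -
  have "grid_path Q h m -` {l} \<inter> space M \<in> sets M" for l
  proof -
  have [measurable]: "Q (real i * h) \<in> measurable M (count_space UNIV)" for i
    using h by (intro Q) auto
  have "{\<omega> \<in> space M. length l = Suc m \<and> (\<forall>i\<le>m. Q (real i * h) \<omega> = l ! i)} \<in> sets M"
    by measurable
  also have "{\<omega> \<in> space M. length l = Suc m \<and> (\<forall>i\<le>m. Q (real i * h) \<omega> = l ! i)} = grid_path Q h m -` {l} \<inter> space M"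
    unfolding grid_path_eq_iff[symmetric] by auto
  finally show ?thesis .
  qed
  then show ?thesis
    by (simp add: measurable_count_space_eq_countable)
qed

lemma (in prob_space) pred_grid_arrival:
  assumes Q: "\<And>t. t \<ge> 0 \<Longrightarrow> Q t \<in> measurable M (count_space UNIV)" and h: "h \<ge> 0"
  shows "Measurable.pred M (grid_arrival Q h m)"
proof -
  have [measurable]: "(\<lambda>\<omega>. fst (Q (real i * h) \<omega>)) \<in> measurable M (count_space UNIV)" for i
    using h by (intro measurable_compose[OF Q]) auto
  have "Measurable.pred M (\<lambda>\<omega>. \<exists>n. fst (Q (real m * h) \<omega>) = n \<and> fst (Q (real (Suc m) * h) \<omega>) = n + 1)"
    by measurable
  also have "(\<lambda>\<omega>. \<exists>n. fst (Q (real m * h) \<omega>) = n \<and> fst (Q (real (Suc m) * h) \<omega>) = n + 1) = grid_arrival Q h m"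
    by (simp add: grid_arrival_def fun_eq_iff)
  finally show ?thesis .
qed

text \<open>By the Markov property a history acts through its last state, and the bounds for one
  step are uniform in that state. Hence they hold for each history separately, which later allows
  arbitrary weights of the past.\<close>

lemma (in prob_space) grid_arrival_path_bounds:
  assumes Qm: "\<And>t. t \<ge> 0 \<Longrightarrow> Q t \<in> measurable M (count_space UNIV)"
    and QS: "AE \<omega> in M. \<forall>t\<ge>0. Q t \<omega> \<in> erlang_states k"
    and tf: "transition_function_with_rates (erlang_states k) (erlang_rate lam mu k) p"
    and markov: "\<And>(n::nat) (t::nat \<Rightarrow> real) x.
           0 \<le> t 0 \<Longrightarrow> (\<And>i. i\<le>n \<Longrightarrow> t i < t (Suc i)) \<Longrightarrow> (\<And>i. i\<le>Suc n \<Longrightarrow> x i \<in> erlang_states k) \<Longrightarrow>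
           prob {\<omega>\<in>space M. \<forall>i\<le>Suc n. Q (t i) \<omega> = x i} =
           prob {\<omega>\<in>space M. \<forall>i\<le>n. Q (t i) \<omega> = x i} * p (t (Suc n) - t n) (x n) (x (Suc n))"
    and k: "k \<ge> 1" and pos: "0 < lam" "0 < mu"
    and C: "C = lam + real k * mu" and h: "0 < h" "C * h \<le> 1"
  shows "(lam * h - 2 * C\<^sup>2 * h\<^sup>2) * prob {\<omega>\<in>space M. grid_path Q h m \<omega> = l}
      \<le> prob {\<omega>\<in>space M. grid_path Q h m \<omega> = l \<and> grid_arrival Q h m \<omega>}" (is ?lower)
    and "prob {\<omega>\<in>space M. grid_path Q h m \<omega> = l \<and> grid_arrival Q h m \<omega>}
      \<le> (lam * h + 2 * C\<^sup>2 * h\<^sup>2) * prob {\<omega>\<in>space M. grid_path Q h m \<omega> = l}" (is ?upper)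
proof -
  note of_nat_Suc [simp del]
  have [measurable]: "Q (real i * h) \<in> measurable M (count_space UNIV)" for i
    using h by (intro Qm) auto
  have [measurable]: "Measurable.pred M (\<lambda>\<omega>. grid_path Q h m \<omega> = l)"
    unfolding grid_path_eq_iff by measurable
  have [measurable]: "Measurable.pred M (grid_arrival Q h m)"
    using Qm h by (intro pred_grid_arrival) auto
  let ?E = "{\<omega>\<in>space M. grid_path Q h m \<omega> = l}"
  let ?A = "{\<omega>\<in>space M. grid_path Q h m \<omega> = l \<and> grid_arrival Q h m \<omega>}"
  have [measurable]: "?A \<in> sets M" "?E \<in> sets M"
    by measurable
  have le: "prob ?A \<le> prob ?E"
    by (rule finite_measure_mono) auto
  have "?lower \<and> ?upper"
  proof (cases "length l = Suc m \<and> set l \<subseteq> erlang_states k")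
    case False
    have "prob ?E = 0"
    proof (rule prob_eq_0[THEN iffD2])
      show "AE \<omega> in M. \<omega> \<notin> ?E"
        using QS
      proof eventually_elim
        case (elim \<omega>)
        show ?case
        proof
          assume "\<omega> \<in> ?E"
          then have l: "length l = Suc m" and eq: "\<And>i. i \<le> m \<Longrightarrow> Q (real i * h) \<omega> = l ! i"
            by (auto simp: grid_path_eq_iff)
          have "set l \<subseteq> erlang_states k"
          proof
            fix y assume "y \<in> set l"
            then obtain i where "i \<le> m" "y = l ! i"
              using l by (auto simp: in_set_conv_nth less_Suc_eq_le)
            then show "y \<in> erlang_states k"
              using elim h eq[of i] by (metis less_imp_le mult_nonneg_nonneg of_nat_0_le_iff)
          qed
          then show False using False l by auto
        qed
      qed
    qed auto
    moreover from this have "prob ?A = 0"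
      using le measure_nonneg[of M ?A] by linarith
    ultimately show ?thesis by simp
  next
    case True
    define x where "x = l ! m"
    have l: "l ! i \<in> erlang_states k" if "i \<le> m" for i
    proof -
      have "l ! i \<in> set l" using True that by (intro nth_mem) auto
      then show ?thesis using True by blast
    qed
    have x: "x \<in> erlang_states k" unfolding x_def by (rule l) simp
    have step: "prob {\<omega>\<in>space M. grid_path Q h m \<omega> = l \<and> Q (real (Suc m) * h) \<omega> = y} = prob ?E * p h x y"
      if y: "y \<in> erlang_states k" for y
    proof -
      define z where "z i = (if i \<le> m then l ! i else y)" for i
      have z: "z i \<in> erlang_states k" for i
        using l y by (simp add: z_def)
      have 1: "{\<omega>\<in>space M. grid_path Q h m \<omega> = l \<and> Q (real (Suc m) * h) \<omega> = y} = {\<omega>\<in>space M. \<forall>i\<le>Suc m. Q (real i * h) \<omega> = z i}"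
        using True by (auto simp: grid_path_eq_iff z_def le_Suc_eq)
      have 2: "?E = {\<omega>\<in>space M. \<forall>i\<le>m. Q (real i * h) \<omega> = z i}"
        using True by (auto simp: grid_path_eq_iff z_def)
      show ?thesis
        unfolding 1 2
      proof (subst markov)
        have "real (Suc m) * h - real m * h = h"
          by (simp add: of_nat_Suc algebra_simps)
        then show "prob {\<omega>\<in>space M. \<forall>i\<le>m. Q (real i * h) \<omega> = z i} * p (real (Suc m) * h - real m * h) (z m) (z (Suc m))
           = prob {\<omega>\<in>space M. \<forall>i\<le>m. Q (real i * h) \<omega> = z i} * p h x y"
          by (simp only: z_def x_def) simp
      qed (use h z in auto)
    qed
    have disj: "prob {\<omega>\<in>space M. grid_path Q h m \<omega> = l \<and> Q (real (Suc m) * h) \<omega> \<in> Y} = (\<Sum>y\<in>Y. prob ?E * p h x y)"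
      if Y: "finite Y" "Y \<subseteq> erlang_states k" for Y
    proof -
      have "prob {\<omega>\<in>space M. grid_path Q h m \<omega> = l \<and> Q (real (Suc m) * h) \<omega> \<in> Y}
        = prob (\<Union>y\<in>Y. {\<omega>\<in>space M. grid_path Q h m \<omega> = l \<and> Q (real (Suc m) * h) \<omega> = y})"
        by (rule arg_cong[where f = prob]) auto
      also have "\<dots> = (\<Sum>y\<in>Y. prob {\<omega>\<in>space M. grid_path Q h m \<omega> = l \<and> Q (real (Suc m) * h) \<omega> = y})"
        by (rule finite_measure_finite_Union) (use Y in \<open>auto simp: disjoint_family_on_def\<close>)
      also have "\<dots> = (\<Sum>y\<in>Y. prob ?E * p h x y)"
        using Y by (intro sum.cong step) auto
      finally show ?thesis .
    qed
    have fx: "Q (real m * h) \<omega> = x" if "grid_path Q h m \<omega> = l" for \<omega>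
      using that by (auto simp: grid_path_eq_iff x_def)
    note bounds = erlang_transition_bounds[OF tf k pos x C h]
    have "(lam * h - 2 * C\<^sup>2 * h\<^sup>2) * prob ?E \<le> p h x (up_state k x) * prob ?E"
      by (intro mult_right_mono bounds(1)) simp
    also have "\<dots> = prob ?E * p h x (up_state k x)"
      by (rule mult.commute)
    also have "\<dots> = prob {\<omega>\<in>space M. grid_path Q h m \<omega> = l \<and> Q (real (Suc m) * h) \<omega> = up_state k x}"
      by (rule step[symmetric]) (rule up_state_in[OF k x])
    also have "\<dots> \<le> prob ?A"
    proof (rule finite_measure_mono)
      show "{\<omega>\<in>space M. grid_path Q h m \<omega> = l \<and> Q (real (Suc m) * h) \<omega> = up_state k x} \<subseteq> ?A"
      proof safe
        fix \<omega> assume "Q (real (Suc m) * h) \<omega> = up_state k x" "l = grid_path Q h m \<omega>"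
        then show "grid_arrival Q h m \<omega>"
          using fx[of \<omega>] by (simp add: grid_arrival_def fst_up_state)
      qed
    qed measurable
    finally have lower: ?lower .
    \<comment> \<open>Resting and moving down do not raise the first component, so an arrival avoids
      \<open>Y\<close>. The upper bound is thus the probability of missing \<open>Y\<close>; all
      rare moves are covered by its error term.\<close>
    define Y where "Y = (if x = (0, 0) then {x} else {x, down_state k x})"
    have Y: "finite Y" "Y \<subseteq> erlang_states k"
      using x down_state_in[OF k x] by (auto simp: Y_def)
    have fY: "fst y \<le> fst x" if "y \<in> Y" for y
      using that fst_down_state[of k x] by (auto simp: Y_def split: if_splits)
    have notY: "Q (real (Suc m) * h) \<omega> \<notin> Y" if "grid_path Q h m \<omega> = l" "grid_arrival Q h m \<omega>" for \<omega>
    proof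
      assume "Q (real (Suc m) * h) \<omega> \<in> Y"
      then have "fst (Q (real (Suc m) * h) \<omega>) \<le> fst x" by (rule fY)
      then show False
        using that(2) fx[OF that(1)] by (simp add: grid_arrival_def)
    qed
    have "prob ?A \<le> prob (?E - {\<omega>\<in>space M. grid_path Q h m \<omega> = l \<and> Q (real (Suc m) * h) \<omega> \<in> Y})"
    proof (rule finite_measure_mono)
      show "?A \<subseteq> ?E - {\<omega>\<in>space M. grid_path Q h m \<omega> = l \<and> Q (real (Suc m) * h) \<omega> \<in> Y}"
        using notY by blast
    qed measurable
    also have "\<dots> = prob ?E - prob {\<omega>\<in>space M. grid_path Q h m \<omega> = l \<and> Q (real (Suc m) * h) \<omega> \<in> Y}"
      by (intro finite_measure_Diff) auto
    also have "\<dots> = prob ?E * (1 - (\<Sum>y\<in>Y. p h x y))"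
      unfolding disj[OF Y] by (simp add: sum_distrib_left[symmetric] right_diff_distrib)
    also have "\<dots> \<le> prob ?E * (lam * h + 2 * C\<^sup>2 * h\<^sup>2)"
    proof (rule mult_left_mono)
      show "1 - (\<Sum>y\<in>Y. p h x y) \<le> lam * h + 2 * C\<^sup>2 * h\<^sup>2"
      proof (cases "x = (0, 0)")
        case True
        then have "(\<Sum>y\<in>Y. p h x y) = p h x x" by (simp add: Y_def)
        then show ?thesis using bounds(3)[OF True] by simp
      next
        case False
        then have "(\<Sum>y\<in>Y. p h x y) = p h x x + p h x (down_state k x)"
          using down_state_neq[OF x False] by (auto simp: Y_def)
        then show ?thesis using bounds(2)[OF False] by simp
      qed
    qed simp
    also have "prob ?E * (lam * h + 2 * C\<^sup>2 * h\<^sup>2) = (lam * h + 2 * C\<^sup>2 * h\<^sup>2) * prob ?E"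
      by (rule mult.commute)
    finally show ?thesis using lower by blast
  qed
  then show ?lower ?upper by blast+
qed

section \<open>Renewal inequalities for weighted arrivals\<close>

text \<open>An integral of a function of a countable-valued variable is a sum over its values, so
  bounds for each history add up to bounds for every weight of the history.\<close>

lemma (in prob_space) integral_count_bounds:
  fixes f :: "'b::countable \<Rightarrow> real"
  assumes L[measurable]: "L \<in> measurable M (count_space UNIV)" and A[measurable]: "{\<omega>\<in>space M. A \<omega>} \<in> sets M"
    and f: "\<And>l. 0 \<le> f l" "\<And>l. f l \<le> 1"
  shows "(\<And>l. prob {\<omega>\<in>space M. L \<omega> = l \<and> A \<omega>} \<le> b * prob {\<omega>\<in>space M. L \<omega> = l}) \<Longrightarrow> 0 \<le> b \<Longrightarrow>
      (\<integral>\<omega>. f (L \<omega>) * of_bool (A \<omega>) \<partial>M) \<le> b * (\<integral>\<omega>. f (L \<omega>) \<partial>M)"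
    and "(\<And>l. a * prob {\<omega>\<in>space M. L \<omega> = l} \<le> prob {\<omega>\<in>space M. L \<omega> = l \<and> A \<omega>}) \<Longrightarrow> 0 \<le> a \<Longrightarrow>
      a * (\<integral>\<omega>. f (L \<omega>) \<partial>M) \<le> (\<integral>\<omega>. f (L \<omega>) * of_bool (A \<omega>) \<partial>M)"
proof -
  have nn: "ennreal (\<integral>\<omega>. f (L \<omega>) * of_bool (B \<omega>) \<partial>M)
     = (\<integral>\<^sup>+l. ennreal (f l) * ennreal (prob {\<omega>\<in>space M. L \<omega> = l \<and> B \<omega>}) \<partial>count_space UNIV)"
    if [measurable]: "{\<omega>\<in>space M. B \<omega>} \<in> sets M" for B
  proof -
    have [measurable]: "Measurable.pred M B" using that by (simp add: pred_def)
    have "ennreal (\<integral>\<omega>. f (L \<omega>) * of_bool (B \<omega>) \<partial>M) = (\<integral>\<^sup>+\<omega>. ennreal (f (L \<omega>) * of_bool (B \<omega>)) \<partial>M)"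
    proof (rule nn_integral_eq_integral[symmetric])
      show "integrable M (\<lambda>\<omega>. f (L \<omega>) * of_bool (B \<omega>))"
        by (rule integrable_const_bound[where B = 1]) (auto simp: of_bool_def f)
    qed (simp add: f)
    also have "\<dots> = (\<integral>\<^sup>+\<omega>. (\<integral>\<^sup>+l. ennreal (f l) * indicator {\<omega>\<in>space M. L \<omega> = l \<and> B \<omega>} \<omega> \<partial>count_space UNIV) \<partial>M)"
    proof (rule nn_integral_cong)
      fix \<omega> assume w: "\<omega> \<in> space M"
      have "(\<integral>\<^sup>+l. ennreal (f l) * indicator {\<omega>\<in>space M. L \<omega> = l \<and> B \<omega>} \<omega> \<partial>count_space UNIV)
         = (\<integral>\<^sup>+l. ennreal (f (L \<omega>) * of_bool (B \<omega>)) * indicator {L \<omega>} l \<partial>count_space UNIV)"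
        using w by (intro nn_integral_cong) (auto simp: indicator_def)
      also have "\<dots> = ennreal (f (L \<omega>) * of_bool (B \<omega>))"
        by (subst nn_integral_cmult_indicator) auto
      finally show "ennreal (f (L \<omega>) * of_bool (B \<omega>)) = (\<integral>\<^sup>+l. ennreal (f l) * indicator {\<omega>\<in>space M. L \<omega> = l \<and> B \<omega>} \<omega> \<partial>count_space UNIV)" ..
    qed
    also have "\<dots> = (\<integral>\<^sup>+l. (\<integral>\<^sup>+\<omega>. ennreal (f l) * indicator {\<omega>\<in>space M. L \<omega> = l \<and> B \<omega>} \<omega> \<partial>M) \<partial>count_space UNIV)"
      by (rule nn_integral_count_space_nn_integral) auto
    also have "\<dots> = (\<integral>\<^sup>+l. ennreal (f l) * ennreal (prob {\<omega>\<in>space M. L \<omega> = l \<and> B \<omega>}) \<partial>count_space UNIV)"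
      by (intro nn_integral_cong, subst nn_integral_cmult_indicator) (auto simp: emeasure_eq_measure)
    finally show ?thesis .
  qed
  have nn1: "ennreal (\<integral>\<omega>. f (L \<omega>) \<partial>M) = (\<integral>\<^sup>+l. ennreal (f l) * ennreal (prob {\<omega>\<in>space M. L \<omega> = l}) \<partial>count_space UNIV)"
    using nn[of "\<lambda>_. True"] by simp
  have nonneg: "0 \<le> (\<integral>\<omega>. f (L \<omega>) \<partial>M)" "0 \<le> (\<integral>\<omega>. f (L \<omega>) * of_bool (A \<omega>) \<partial>M)"
    using f by auto
  show "(\<integral>\<omega>. f (L \<omega>) * of_bool (A \<omega>) \<partial>M) \<le> b * (\<integral>\<omega>. f (L \<omega>) \<partial>M)"
    if le: "\<And>l. prob {\<omega>\<in>space M. L \<omega> = l \<and> A \<omega>} \<le> b * prob {\<omega>\<in>space M. L \<omega> = l}" and b: "0 \<le> b"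
  proof -
    have "ennreal (\<integral>\<omega>. f (L \<omega>) * of_bool (A \<omega>) \<partial>M) \<le> (\<integral>\<^sup>+l. ennreal b * (ennreal (f l) * ennreal (prob {\<omega>\<in>space M. L \<omega> = l})) \<partial>count_space UNIV)"
      unfolding nn[OF A]
    proof (rule nn_integral_mono)
      fix l
      have "ennreal (f l * prob {\<omega>\<in>space M. L \<omega> = l \<and> A \<omega>}) \<le> ennreal (b * (f l * prob {\<omega>\<in>space M. L \<omega> = l}))"
        using mult_left_mono[OF le f(1), of l l] by (intro ennreal_leI) (simp add: mult_ac)
      then show "ennreal (f l) * ennreal (prob {\<omega>\<in>space M. L \<omega> = l \<and> A \<omega>}) \<le> ennreal b * (ennreal (f l) * ennreal (prob {\<omega>\<in>space M. L \<omega> = l}))"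
        using f b by (simp add: ennreal_mult)
    qed
    also have "\<dots> = ennreal (b * (\<integral>\<omega>. f (L \<omega>) \<partial>M))"
      using b nonneg by (subst nn_integral_cmult) (auto simp: nn1[symmetric] ennreal_mult)
    finally show ?thesis using b nonneg by (simp add: ennreal_le_iff)
  qed
  show "a * (\<integral>\<omega>. f (L \<omega>) \<partial>M) \<le> (\<integral>\<omega>. f (L \<omega>) * of_bool (A \<omega>) \<partial>M)"
    if le: "\<And>l. a * prob {\<omega>\<in>space M. L \<omega> = l} \<le> prob {\<omega>\<in>space M. L \<omega> = l \<and> A \<omega>}" and a: "0 \<le> a"
  proof -
    have "ennreal (a * (\<integral>\<omega>. f (L \<omega>) \<partial>M)) = (\<integral>\<^sup>+l. ennreal a * (ennreal (f l) * ennreal (prob {\<omega>\<in>space M. L \<omega> = l})) \<partial>count_space UNIV)"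
      using a nonneg by (subst nn_integral_cmult) (auto simp: nn1[symmetric] ennreal_mult)
    also have "\<dots> \<le> ennreal (\<integral>\<omega>. f (L \<omega>) * of_bool (A \<omega>) \<partial>M)"
      unfolding nn[OF A]
    proof (rule nn_integral_mono)
      fix l
      have "ennreal (a * (f l * prob {\<omega>\<in>space M. L \<omega> = l})) \<le> ennreal (f l * prob {\<omega>\<in>space M. L \<omega> = l \<and> A \<omega>})"
        using mult_left_mono[OF le f(1), of l l] by (intro ennreal_leI) (simp add: mult_ac)
      then show "ennreal a * (ennreal (f l) * ennreal (prob {\<omega>\<in>space M. L \<omega> = l})) \<le> ennreal (f l) * ennreal (prob {\<omega>\<in>space M. L \<omega> = l \<and> A \<omega>})"
        using f a by (simp add: ennreal_mult)
    qed
    finally show ?thesis using nonneg by (simp add: ennreal_le_iff)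
  qed
qed

text \<open>\<open>b m i\<close> is the weight of the paths with \<open>i\<close> arrivals before step \<open>m\<close>, and \<open>c m i\<close> the part of it
  with an arrival at step \<open>m\<close>; each step spent at level \<open>i\<close> costs a factor \<open>w i\<close>.\<close>

lemma renewal_bounds:
  fixes b c :: "nat \<Rightarrow> nat \<Rightarrow> real" and w :: "nat \<Rightarrow> real"
  assumes b0: "\<And>i. b 0 i = of_bool (i = 0)"
    and rec0: "\<And>m. b (Suc m) 0 = w 0 * (b m 0 - c m 0)"
    and recS: "\<And>m i. b (Suc m) (Suc i) = w (Suc i) * (b m (Suc i) - c m (Suc i)) + w i * c m i"
    and bc: "\<And>m i. \<alpha> * b m i \<le> c m i" "\<And>m i. c m i \<le> \<beta> * b m i"
    and b: "\<And>m i. 0 \<le> b m i" "\<And>m i. b m i \<le> v ^ m"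
    and \<alpha>: "0 \<le> \<alpha>" "0 \<le> \<beta>" and w: "\<And>i. 0 \<le> w i" "\<And>i. w i \<le> v" and v: "v < 1"
  shows "\<exists>s. (\<lambda>m. w n * c m n) sums s \<and>
     (\<Prod>i\<le>n. w i * \<alpha> / (1 - w i + w i * \<alpha>)) \<le> s \<and> s \<le> (\<Prod>i\<le>n. w i * \<beta> / (1 - w i + w i * \<beta>))"
proof -
  have v0: "0 \<le> v" using w order_trans by blast
  have c: "0 \<le> c m i" for m i
    using bc(1)[of m i] b(1)[of m i] \<alpha> by (meson mult_nonneg_nonneg order_trans)
  have sb: "summable (\<lambda>m. b m i)" for i
    using v0 v b by (intro summable_comparison_test'[OF summable_geometric[of v], of 0]) auto
  have sc: "summable (\<lambda>m. c m i)" for i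
    by (rule summable_comparison_test'[OF summable_mult[OF sb[of i], of \<beta>], of 0]) (use c bc(2) in auto)
  define B where "B i = (\<Sum>m. b m i)" for i
  define C where "C i = (\<Sum>m. c m i)" for i
  \<comment> \<open>\<open>a i\<close> is the total weight that enters level \<open>i\<close>: the
    initial mass 1 for \<open>i = 0\<close>, otherwise the arrivals from the level before. Summing
    the recursion over all steps gives the balance \<open>(1 - w i) * B i = a i - w i * C i\<close>;
    with \<open>C i\<close> between \<open>\<alpha> * B i\<close> and \<open>\<beta> * B i\<close>
    it compares \<open>a (Suc i)\<close> with \<open>a i\<close>.\<close>
  define a where "a i = (case i of 0 \<Rightarrow> 1 | Suc j \<Rightarrow> w j * C j)" for i
  have C0: "0 \<le> C i" for i
    unfolding C_def by (intro suminf_nonneg sc c)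
  have CB: "\<alpha> * B i \<le> C i" "C i \<le> \<beta> * B i" for i
    unfolding B_def C_def suminf_mult[OF sb, symmetric]
    by (intro suminf_le bc sc sb summable_mult)+
  have B: "(1 - w i) * B i = a i - w i * C i" for i
  proof -
    have "B i = b 0 i + (\<Sum>m. b (Suc m) i)"
      unfolding B_def using suminf_split_head[OF sb, of i] by simp
    also have "\<dots> = w i * (B i - C i) + a i"
    proof (cases i)
      case 0
      have "(\<Sum>m. b (Suc m) 0) = w 0 * (B 0 - C 0)"
        unfolding rec0 B_def C_def by (simp add: suminf_mult suminf_diff sb sc summable_diff)
      then show ?thesis using 0 by (simp add: b0 a_def)
    next
      case (Suc j)
      have "(\<Sum>m. b (Suc m) (Suc j)) = w (Suc j) * (B (Suc j) - C (Suc j)) + w j * C j"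
        unfolding recS B_def C_def
        by (subst suminf_add[symmetric]) (auto simp: suminf_mult suminf_diff sb sc summable_diff summable_mult)
      then show ?thesis using Suc by (simp add: b0 a_def)
    qed
    finally show ?thesis by (simp add: algebra_simps)
  qed
  have den: "0 < 1 - w i + w i * x" if "0 \<le> x" for i x
    using w[of i] v that by (intro add_pos_nonneg mult_nonneg_nonneg) linarith+
  have step: "a i * (w i * \<alpha> / (1 - w i + w i * \<alpha>)) \<le> a (Suc i)" "a (Suc i) \<le> a i * (w i * \<beta> / (1 - w i + w i * \<beta>))" for i
  proof -
    have w1: "0 \<le> 1 - w i" using w[of i] v by linarith
    have "\<alpha> * (a i - w i * C i) \<le> C i * (1 - w i)"
      unfolding B[symmetric] using mult_right_mono[OF CB(1)[of i] w1] by (simp add: mult_ac)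
    then have "a i * \<alpha> \<le> C i * (1 - w i + w i * \<alpha>)"
      by (simp add: algebra_simps)
    then have "w i * (a i * \<alpha>) \<le> w i * (C i * (1 - w i + w i * \<alpha>))"
      using w by (intro mult_left_mono) auto
    then show "a i * (w i * \<alpha> / (1 - w i + w i * \<alpha>)) \<le> a (Suc i)"
      using den[OF \<alpha>(1), of i] by (simp add: a_def pos_divide_le_eq mult_ac)
    have "C i * (1 - w i) \<le> \<beta> * (a i - w i * C i)"
      unfolding B[symmetric] using mult_right_mono[OF CB(2)[of i] w1] by (simp add: mult_ac)
    then have "C i * (1 - w i + w i * \<beta>) \<le> a i * \<beta>"
      by (simp add: algebra_simps)
    then have "w i * (C i * (1 - w i + w i * \<beta>)) \<le> w i * (a i * \<beta>)"
      using w by (intro mult_left_mono) auto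
    then show "a (Suc i) \<le> a i * (w i * \<beta> / (1 - w i + w i * \<beta>))"
      using den[OF \<alpha>(2), of i] by (simp add: a_def pos_le_divide_eq mult_ac)
  qed
  have a0: "0 \<le> a i" for i
    using C0 w by (auto simp: a_def split: nat.split)
  have frac: "0 \<le> w i * x / (1 - w i + w i * x)" if "0 \<le> x" for i x
    using den[OF that, of i] w that by auto
  have "(\<Prod>i\<le>n. w i * \<alpha> / (1 - w i + w i * \<alpha>)) \<le> a (Suc n) \<and> a (Suc n) \<le> (\<Prod>i\<le>n. w i * \<beta> / (1 - w i + w i * \<beta>))"
  proof (induction n)
    case 0
    show ?case using step[of 0] by (simp add: a_def)
  next
    case (Suc n)
    show ?case
      unfolding prod.atMost_Suc
      using order_trans[OF mult_right_mono[OF conjunct1[OF Suc] frac[OF \<alpha>(1), of "Suc n"]] step(1)[of "Suc n"]]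
        order_trans[OF step(2)[of "Suc n"] mult_right_mono[OF conjunct2[OF Suc] frac[OF \<alpha>(2), of "Suc n"]]]
      by blast
  qed
  moreover have "(\<lambda>m. w n * c m n) sums a (Suc n)"
    unfolding a_def C_def nat.case by (intro sums_mult summable_sums sc)
  ultimately show ?thesis by blast
qed

text \<open>The arrival count read off from a recorded history, which exhibits weights depending on
  counts as functions of \<open>grid_path\<close>.\<close>

definition list_count :: "(nat \<times> nat) list \<Rightarrow> nat \<Rightarrow> nat" where
  "list_count l m = card {j. j < m \<and> fst (l ! Suc j) = fst (l ! j) + 1}"

lemma list_count_grid_path:
  assumes "j \<le> m"
  shows "list_count (grid_path Q h m \<omega>) j = grid_count Q h j \<omega>"
proof -
  have nth: "grid_path Q h m \<omega> ! i = Q (real i * h) \<omega>" if "i \<le> m" for i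
    using that grid_path_eq_iff[of Q h m \<omega> "grid_path Q h m \<omega>"] by simp
  have "i < j \<Longrightarrow> (fst (grid_path Q h m \<omega> ! Suc i) = fst (grid_path Q h m \<omega> ! i) + 1) = grid_arrival Q h i \<omega>" for i
    using assms nth[of i] nth[of "Suc i"] by (simp add: grid_arrival_def)
  then show ?thesis
    unfolding list_count_def grid_count_def by (intro arg_cong[where f = card]) blast
qed

lemma (in prob_space) measurable_grid_count:
  assumes Q: "\<And>t. t \<ge> 0 \<Longrightarrow> Q t \<in> measurable M (count_space UNIV)" and h: "h \<ge> 0"
  shows "grid_count Q h m \<in> measurable M (count_space UNIV)"
proof -
  have [measurable]: "grid_path Q h m \<in> measurable M (count_space UNIV)"
    by (rule measurable_grid_path[OF Q h])
  have "(\<lambda>\<omega>. list_count (grid_path Q h m \<omega>) m) \<in> measurable M (count_space UNIV)"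
    by (rule measurable_compose[OF measurable_grid_path[OF Q h]]) auto
  then show ?thesis by (simp add: list_count_grid_path)
qed

text \<open>The product of the factors \<open>w\<close> up to the present step depends on the
  recorded history alone, so the bounds per history pass to the weighted expectations, and these
  satisfy the recursion of \<open>renewal_bounds\<close>.\<close>

lemma (in prob_space) grid_renewal_bounds:
  fixes w :: "nat \<Rightarrow> real"
  assumes Qm: "\<And>t. t \<ge> 0 \<Longrightarrow> Q t \<in> measurable M (count_space UNIV)" and h: "h \<ge> 0"
    and step: "\<And>m l. \<alpha> * prob {\<omega>\<in>space M. grid_path Q h m \<omega> = l} \<le> prob {\<omega>\<in>space M. grid_path Q h m \<omega> = l \<and> grid_arrival Q h m \<omega>}"
      "\<And>m l. prob {\<omega>\<in>space M. grid_path Q h m \<omega> = l \<and> grid_arrival Q h m \<omega>} \<le> \<beta> * prob {\<omega>\<in>space M. grid_path Q h m \<omega> = l}"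
    and \<alpha>: "0 \<le> \<alpha>" "0 \<le> \<beta>" and w: "\<And>i. 0 \<le> w i" "\<And>i. w i \<le> v" and v: "v < 1"
  shows "\<exists>s. (\<lambda>m. \<integral>\<omega>. (\<Prod>j\<le>m. w (grid_count Q h j \<omega>)) * of_bool (grid_count Q h m \<omega> = n \<and> grid_arrival Q h m \<omega>) \<partial>M) sums s \<and>
     (\<Prod>i\<le>n. w i * \<alpha> / (1 - w i + w i * \<alpha>)) \<le> s \<and> s \<le> (\<Prod>i\<le>n. w i * \<beta> / (1 - w i + w i * \<beta>))"
proof -
  define W where "W m \<omega> = (\<Prod>j<m. w (grid_count Q h j \<omega>))" for m \<omega>
  define b where "b m i = (\<integral>\<omega>. W m \<omega> * of_bool (grid_count Q h m \<omega> = i) \<partial>M)" for m i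
  define c where "c m i = (\<integral>\<omega>. W m \<omega> * of_bool (grid_count Q h m \<omega> = i) * of_bool (grid_arrival Q h m \<omega>) \<partial>M)" for m i
  have w1: "w i \<le> 1" for i using w(2)[of i] v by linarith
  have v0: "0 \<le> v" using w order_trans by blast
  note [measurable] = pred_grid_arrival[OF Qm h] measurable_grid_count[OF Qm h]
  have [measurable]: "W m \<in> borel_measurable M" for m
  proof -
    have "(\<lambda>\<omega>. w (grid_count Q h j \<omega>)) \<in> borel_measurable M" for j
      by (rule measurable_compose[OF measurable_grid_count[OF Qm h]]) auto
    then show ?thesis unfolding W_def by (intro borel_measurable_prod)
  qed
  have [measurable]: "Measurable.pred M (\<lambda>\<omega>. grid_count Q h m \<omega> = i)" for m i
    by measurable
  have Wv: "0 \<le> W m \<omega>" "W m \<omega> \<le> v ^ m" for m \<omega>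
  proof -
    show "0 \<le> W m \<omega>" unfolding W_def by (intro prod_nonneg) (simp add: w)
    have "W m \<omega> \<le> (\<Prod>j<m. v)" unfolding W_def by (intro prod_mono) (simp add: w)
    then show "W m \<omega> \<le> v ^ m" by simp
  qed
  have W1: "W m \<omega> \<le> 1" for m \<omega>
    using Wv(2)[of m \<omega>] power_le_one[OF v0, of m] v by linarith
  have int1: "integrable M (\<lambda>\<omega>. W m \<omega> * of_bool (grid_count Q h m \<omega> = i))" for m i
    by (rule integrable_const_bound[where B = 1]) (auto simp: of_bool_def Wv W1)
  have int2: "integrable M (\<lambda>\<omega>. W m \<omega> * of_bool (grid_count Q h m \<omega> = i) * of_bool (grid_arrival Q h m \<omega>))" for m i
    by (rule integrable_const_bound[where B = 1]) (auto simp: of_bool_def Wv W1)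
  have bc: "\<alpha> * b m i \<le> c m i" "c m i \<le> \<beta> * b m i" for m i
  proof -
    define f where "f l = (\<Prod>j<m. w (list_count l j)) * of_bool (list_count l m = i)" for l
    have f: "f (grid_path Q h m \<omega>) = W m \<omega> * of_bool (grid_count Q h m \<omega> = i)" for \<omega>
      by (simp add: f_def W_def list_count_grid_path)
    have f01: "0 \<le> f l" "f l \<le> 1" for l
      unfolding f_def using w w1 by (auto simp: of_bool_def intro!: prod_nonneg prod_le_1)
    have A: "{\<omega>\<in>space M. grid_arrival Q h m \<omega>} \<in> sets M" by measurable
    show "\<alpha> * b m i \<le> c m i"
      using integral_count_bounds(2)[of "grid_path Q h m" "grid_arrival Q h m" f, OF measurable_grid_path[OF Qm h] A f01 step(1) \<alpha>(1)]
      unfolding f b_def c_def by simp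
    show "c m i \<le> \<beta> * b m i"
      using integral_count_bounds(1)[of "grid_path Q h m" "grid_arrival Q h m" f, OF measurable_grid_path[OF Qm h] A f01 step(2) \<alpha>(2)]
      unfolding f b_def c_def by simp
  qed
  have "\<exists>s. (\<lambda>m. w n * c m n) sums s \<and>
     (\<Prod>i\<le>n. w i * \<alpha> / (1 - w i + w i * \<alpha>)) \<le> s \<and> s \<le> (\<Prod>i\<le>n. w i * \<beta> / (1 - w i + w i * \<beta>))"
  proof (rule renewal_bounds[where b = b, OF _ _ _ bc _ _ \<alpha> w v])
    show "b 0 i = of_bool (i = 0)" for i
      by (auto simp: b_def W_def of_bool_def prob_space)
    show "0 \<le> b m i" for m i
      unfolding b_def by (intro Bochner_Integration.integral_nonneg) (simp add: Wv)
    show "b m i \<le> v ^ m" for m i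
    proof -
      have "b m i \<le> (\<integral>\<omega>. v ^ m \<partial>M)"
        unfolding b_def using int1 v0 Wv by (intro integral_mono) (auto simp: of_bool_def)
      then show ?thesis by (simp add: prob_space)
    qed
    show "b (Suc m) 0 = w 0 * (b m 0 - c m 0)" for m
    proof -
      have "b (Suc m) 0 = (\<integral>\<omega>. w 0 * (W m \<omega> * of_bool (grid_count Q h m \<omega> = 0) - W m \<omega> * of_bool (grid_count Q h m \<omega> = 0) * of_bool (grid_arrival Q h m \<omega>)) \<partial>M)"
        unfolding b_def by (intro Bochner_Integration.integral_cong) (auto simp: W_def grid_count_Suc of_bool_def)
      then show ?thesis
        unfolding b_def c_def using int1 int2 by simp
    qed
    show "b (Suc m) (Suc i) = w (Suc i) * (b m (Suc i) - c m (Suc i)) + w i * c m i" for m i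
    proof -
      have "b (Suc m) (Suc i) = (\<integral>\<omega>. w (Suc i) * (W m \<omega> * of_bool (grid_count Q h m \<omega> = Suc i) - W m \<omega> * of_bool (grid_count Q h m \<omega> = Suc i) * of_bool (grid_arrival Q h m \<omega>))
          + w i * (W m \<omega> * of_bool (grid_count Q h m \<omega> = i) * of_bool (grid_arrival Q h m \<omega>)) \<partial>M)"
        unfolding b_def by (intro Bochner_Integration.integral_cong) (auto simp: W_def grid_count_Suc of_bool_def)
      then show ?thesis
        unfolding b_def c_def using int1 int2 by simp
    qed
  qed
  \<comment> \<open>\<open>W m\<close> stops before step \<open>m\<close>. As the level at step
    \<open>m\<close> is \<open>n\<close>, the factor \<open>w n\<close> completes the product to
    \<open>j \<le> m\<close>.\<close>
  moreover have "w n * c m n = (\<integral>\<omega>. (\<Prod>j\<le>m. w (grid_count Q h j \<omega>)) * of_bool (grid_count Q h m \<omega> = n \<and> grid_arrival Q h m \<omega>) \<partial>M)" for m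
  proof -
    have "w n * c m n = (\<integral>\<omega>. w n * (W m \<omega> * of_bool (grid_count Q h m \<omega> = n) * of_bool (grid_arrival Q h m \<omega>)) \<partial>M)"
      unfolding c_def using int2 by simp
    also have "\<dots> = (\<integral>\<omega>. (\<Prod>j\<le>m. w (grid_count Q h j \<omega>)) * of_bool (grid_count Q h m \<omega> = n \<and> grid_arrival Q h m \<omega>) \<partial>M)"
      by (intro Bochner_Integration.integral_cong) (auto simp: W_def lessThan_Suc_atMost[symmetric] of_bool_def)
    finally show ?thesis .
  qed
  ultimately show ?thesis by simp
qed

section \<open>Arrivals along a path and their time change\<close>

text \<open>Singletons are open in a product of two discrete spaces.\<close>

lemma tendsto_nat_prod_eventually:
  fixes x :: "real \<Rightarrow> nat \<times> nat"
  assumes "(x \<longlongrightarrow> l) F"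
  shows "\<forall>\<^sub>F s in F. x s = l"
proof -
  have "open {l}"
    using open_Times[OF Topological_Spaces.open_discrete[of "{fst l}"] Topological_Spaces.open_discrete[of "{snd l}"]] by simp
  then show ?thesis
    using topological_tendstoD[OF assms] by fastforce
qed

lemma cadlag_locally_constant:
  fixes x :: "real \<Rightarrow> nat \<times> nat"
  assumes x: "cadlag x" and t: "0 \<le> t"
  shows "\<exists>e c. 0 < e \<and> (\<forall>s. t \<le> s \<and> s < t + e \<longrightarrow> x s = x t) \<and> (\<forall>s. 0 \<le> s \<and> t - e < s \<and> s < t \<longrightarrow> x s = c)"
proof -
  have "\<forall>\<^sub>F s in at_right t. x s = x t"
    using x t by (intro tendsto_nat_prod_eventually) (simp add: cadlag_def)
  then obtain b where b: "t < b" "\<And>s. t < s \<Longrightarrow> s < b \<Longrightarrow> x s = x t"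
    unfolding eventually_at_right_field by blast
  show ?thesis
  proof (cases "t = 0")
    case True
    have "x s = x t" if "t \<le> s" "s < t + (b - t)" for s
      using b(2)[of s] that by (cases "s = t") auto
    then have "\<forall>s. t \<le> s \<and> s < t + (b - t) \<longrightarrow> x s = x t" by blast
    moreover have "\<forall>s. 0 \<le> s \<and> t - (b - t) < s \<and> s < t \<longrightarrow> x s = x t"
      using True by auto
    moreover have "0 < b - t" using b(1) by simp
    ultimately show ?thesis by blast
  next
    case False
    then have "0 < t" using t by simp
    then obtain c where "(x \<longlongrightarrow> c) (at_left t)"
      using x unfolding cadlag_def by blast
    then have "\<forall>\<^sub>F s in at_left t. x s = c"
      by (rule tendsto_nat_prod_eventually)
    then obtain a where a: "a < t" "\<And>s. a < s \<Longrightarrow> s < t \<Longrightarrow> x s = c"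
      unfolding eventually_at_left_field by blast
    define e where "e = min (b - t) (t - a)"
    have "x s = x t" if "t \<le> s" "s < t + e" for s
      using b(2)[of s] that by (cases "s = t") (auto simp: e_def)
    moreover have "x s = c" if "t - e < s" "s < t" for s
      using that by (intro a(2)) (auto simp: e_def)
    moreover have "0 < e" using a b by (simp add: e_def)
    ultimately show ?thesis by blast
  qed
qed

text \<open>Each time has a neighbourhood on which the path jumps at most at its centre. Any
  \<open>\<delta>\<close> below which sets fit into one of these neighbourhoods (a Lebesgue number
  of the cover) then works. The half-open \<open>(a, b]\<close> fits right continuity: a jump at
  \<open>b\<close> is visible at \<open>b\<close>, a jump at \<open>a\<close> has already
  happened.\<close>

lemma cadlag_small_intervals:
  fixes x :: "real \<Rightarrow> nat \<times> nat"
  assumes x: "cadlag x"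
  obtains \<delta> where "0 < \<delta>"
    "\<And>a b. 0 \<le> a \<Longrightarrow> a < b \<Longrightarrow> b \<le> K \<Longrightarrow> b - a < \<delta> \<Longrightarrow>
       {t. arrival_at x t \<and> a < t \<and> t \<le> b} = {} \<and> fst (x b) \<noteq> fst (x a) + 1 \<or>
       (\<exists>t. {t. arrival_at x t \<and> a < t \<and> t \<le> b} = {t}) \<and> fst (x b) = fst (x a) + 1"
proof -
  let ?P = "\<lambda>t e c. 0 \<le> t \<longrightarrow> 0 < e \<and> (\<forall>s. t \<le> s \<and> s < t + e \<longrightarrow> x s = x t) \<and> (\<forall>s. 0 \<le> s \<and> t - e < s \<and> s < t \<longrightarrow> x s = c)"
  have "\<forall>t. \<exists>e c. ?P t e c"
    using cadlag_locally_constant[OF x] by (intro allI) simp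
  from choice[OF this] obtain e where "\<forall>t. \<exists>c. ?P t (e t) c" ..
  from choice[OF this] obtain c where ec: "\<forall>t. ?P t (e t) (c t)" ..
  have e: "\<And>t. 0 \<le> t \<Longrightarrow> 0 < e t"
    and R: "\<And>t s. 0 \<le> t \<Longrightarrow> t \<le> s \<Longrightarrow> s < t + e t \<Longrightarrow> x s = x t"
    and L: "\<And>t s. 0 \<le> t \<Longrightarrow> 0 \<le> s \<Longrightarrow> t - e t < s \<Longrightarrow> s < t \<Longrightarrow> x s = c t"
    using ec by blast+
  \<comment> \<open>For negative \<open>K\<close> the interval to be covered would be empty;
    enlarging it is harmless.\<close>
  define K' where "K' = max 0 K"
  obtain \<delta> where \<delta>: "0 < \<delta>" "\<And>T. T \<subseteq> {0..K'} \<Longrightarrow> diameter T < \<delta> \<Longrightarrow> \<exists>B\<in>(\<lambda>t. ball t (e t)) ` {0..K'}. T \<subseteq> B"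
  proof (rule Lebesgue_number_lemma[of "{0..K'}" "(\<lambda>t. ball t (e t)) ` {0..K'}"])
    show "{0..K'} \<subseteq> \<Union> ((\<lambda>t. ball t (e t)) ` {0..K'})"
      using e by fastforce
  qed (auto simp: K'_def)
  show ?thesis
  proof (rule that[OF \<delta>(1)])
    fix a b :: real
    assume ab: "0 \<le> a" "a < b" "b \<le> K" "b - a < \<delta>"
    then obtain t where t: "0 \<le> t" "{a..b} \<subseteq> ball t (e t)"
      using \<delta>(2)[of "{a..b}"] by (force simp: K'_def diameter_closed_interval)
    then have ball: "t - e t < s \<and> s < t + e t" if "a \<le> s" "s \<le> b" for s
      using that by (auto simp: subset_iff dist_real_def abs_less_iff)
    have only: "u = t" if u: "arrival_at x u" "a < u" "u \<le> b" for u
    proof (rule ccontr)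
      assume "u \<noteq> t"
      have "\<forall>\<^sub>F s in at_left u. x s = x u"
      proof (cases "t < u")
        case True
        show ?thesis
          unfolding eventually_at_left_field
        proof (intro exI conjI allI impI)
          show "t < u" by fact
          fix s assume "t < s" "s < u"
          then show "x s = x u"
            using R[OF t(1), of s] R[OF t(1), of u] ball[of u] u by auto
        qed
      next
        case False
        show ?thesis
          unfolding eventually_at_left_field
        proof (intro exI conjI allI impI)
          show "a < u" by fact
          fix s assume "a < s" "s < u"
          then show "x s = x u"
            using L[OF t(1), of s] L[OF t(1), of u] ball[of u] ball[of s] u ab False \<open>u \<noteq> t\<close> by auto
        qed
      qed
      moreover have "\<forall>\<^sub>F s in at_left u. fst (x u) = fst (x s) + 1"
        using u by (simp add: arrival_at_def)
      ultimately have "\<forall>\<^sub>F s in at_left u. False"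
        by eventually_elim simp
      then show False by simp
    qed
    show "{t. arrival_at x t \<and> a < t \<and> t \<le> b} = {} \<and> fst (x b) \<noteq> fst (x a) + 1 \<or>
       (\<exists>t. {t. arrival_at x t \<and> a < t \<and> t \<le> b} = {t}) \<and> fst (x b) = fst (x a) + 1"
    proof (cases "a < t \<and> t \<le> b")
      case True
      have xa: "x a = c t" using L[OF t(1), of a] ball[of a] ab True by auto
      have xb: "x b = x t" using R[OF t(1), of b] ball[of b] ab True by auto
      have "arrival_at x t \<longleftrightarrow> (\<forall>\<^sub>F s in at_left t. fst (x t) = fst (x s) + 1)"
        using True ab by (simp add: arrival_at_def)
      also have "\<dots> \<longleftrightarrow> (\<forall>\<^sub>F s in at_left t. fst (x t) = fst (c t) + 1)"
      proof (rule eventually_subst)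
        show "\<forall>\<^sub>F s in at_left t. (fst (x t) = fst (x s) + 1) = (fst (x t) = fst (c t) + 1)"
          unfolding eventually_at_left_field
          using L[OF t(1)] ball[of a] ab True by (intro exI[of _ a]) auto
      qed
      also have "\<dots> \<longleftrightarrow> fst (x t) = fst (c t) + 1" by simp
      finally have arr: "arrival_at x t \<longleftrightarrow> fst (x b) = fst (x a) + 1"
        by (simp add: xa xb)
      show ?thesis
      proof (cases "arrival_at x t")
        case True2: True
        then have "{t. arrival_at x t \<and> a < t \<and> t \<le> b} = {t}"
          using only True by blast
        then show ?thesis using arr True2 by blast
      next
        case False
        then have "{t. arrival_at x t \<and> a < t \<and> t \<le> b} = {}"
          using only by blast
        then show ?thesis using arr False by blast
      qed
    next
      case False
      then have "{t. arrival_at x t \<and> a < t \<and> t \<le> b} = {}"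
        using only by blast
      moreover have "x a = x b"
      proof (cases "t \<le> a")
        case True
        then show ?thesis
          using R[OF t(1), of a] R[OF t(1), of b] ball[of a] ball[of b] ab by auto
      next
        case False
        then show ?thesis
          using L[OF t(1), of a] L[OF t(1), of b] ball[of a] ball[of b] ab \<open>\<not> (a < t \<and> t \<le> b)\<close> by auto
      qed
      ultimately show ?thesis by simp
    qed
  qed
qed

definition arrival_count :: "(real \<Rightarrow> nat \<times> nat) \<Rightarrow> real \<Rightarrow> nat" where
  "arrival_count x t = card {s. arrival_at x s \<and> s \<le> t}"

lemma arrival_at_pos: "arrival_at x t \<Longrightarrow> 0 < t"
  by (simp add: arrival_at_def)

text \<open>Sums the dichotomy for short intervals over consecutive steps. In a bounded window the
  grid count is thus exact, not merely convergent, for all small \<open>h\<close>.\<close>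

lemma cadlag_grid_count:
  fixes x :: "real \<Rightarrow> nat \<times> nat"
  assumes x: "cadlag x"
  obtains \<delta> where "0 < \<delta>"
    "\<And>h m. 0 < h \<Longrightarrow> h < \<delta> \<Longrightarrow> real m * h \<le> K \<Longrightarrow> finite {s. arrival_at x s \<and> s \<le> real m * h} \<and>
       arrival_count x (real m * h) = card {j. j < m \<and> fst (x (real (Suc j) * h)) = fst (x (real j * h)) + 1}"
proof -
  obtain \<delta> where \<delta>: "0 < \<delta>"
    "\<And>a b. 0 \<le> a \<Longrightarrow> a < b \<Longrightarrow> b \<le> K \<Longrightarrow> b - a < \<delta> \<Longrightarrow>
       {t. arrival_at x t \<and> a < t \<and> t \<le> b} = {} \<and> fst (x b) \<noteq> fst (x a) + 1 \<or>
       (\<exists>t. {t. arrival_at x t \<and> a < t \<and> t \<le> b} = {t}) \<and> fst (x b) = fst (x a) + 1"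
    by (rule cadlag_small_intervals[OF x, of K]) (rule that)
  show ?thesis
  proof (rule that[OF \<delta>(1)])
    fix h :: real and m assume h: "0 < h" "h < \<delta>" and m: "real m * h \<le> K"
    show "finite {s. arrival_at x s \<and> s \<le> real m * h} \<and>
       arrival_count x (real m * h) = card {j. j < m \<and> fst (x (real (Suc j) * h)) = fst (x (real j * h)) + 1}"
      using m
    proof (induction m)
      case 0
      have "{s. arrival_at x s \<and> s \<le> real 0 * h} = {}"
        using arrival_at_pos[of x] by force
      then show ?case unfolding arrival_count_def by (simp only:) simp
    next
      case (Suc m)
      let ?a = "real m * h" and ?b = "real (Suc m) * h"
      let ?A = "{s. arrival_at x s \<and> s \<le> ?a}" and ?S = "{t. arrival_at x t \<and> ?a < t \<and> t \<le> ?b}"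
      have ab: "?a < ?b" "?b - ?a < \<delta>" "0 \<le> ?a" using h by (auto simp: algebra_simps)
      have IH: "finite ?A" "card ?A = card {j. j < m \<and> fst (x (real (Suc j) * h)) = fst (x (real j * h)) + 1}"
        using Suc.IH Suc.prems ab unfolding arrival_count_def by linarith+
      have split: "{s. arrival_at x s \<and> s \<le> ?b} = ?A \<union> ?S" using ab by auto
      have J: "{j. j < Suc m \<and> fst (x (real (Suc j) * h)) = fst (x (real j * h)) + 1} =
        {j. j < m \<and> fst (x (real (Suc j) * h)) = fst (x (real j * h)) + 1} \<union> (if fst (x ?b) = fst (x ?a) + 1 then {m} else {})"
        by (auto simp: less_Suc_eq)
      from \<delta>(2)[OF ab(3,1) Suc.prems ab(2)] show ?case
      proof
        assume "?S = {} \<and> fst (x ?b) \<noteq> fst (x ?a) + 1"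
        then have S: "?S = {}" and ne: "fst (x ?b) \<noteq> fst (x ?a) + 1" by blast+
        show ?thesis unfolding arrival_count_def split J S if_not_P[OF ne] Un_empty_right
          using IH by blast
      next
        assume "(\<exists>t. ?S = {t}) \<and> fst (x ?b) = fst (x ?a) + 1"
        then obtain t where t: "?S = {t}" "fst (x ?b) = fst (x ?a) + 1" by blast
        then have "t \<notin> ?A" by force
        then have "card (?A \<union> {t}) = Suc (card ?A)" using IH(1) by simp
        moreover have "card ({j. j < m \<and> fst (x (real (Suc j) * h)) = fst (x (real j * h)) + 1} \<union> {m})
          = Suc (card {j. j < m \<and> fst (x (real (Suc j) * h)) = fst (x (real j * h)) + 1})"
          by simp
        ultimately show ?thesis unfolding arrival_count_def split J t(1) if_P[OF t(2)] IH(2)[symmetric]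
          using IH(1) by simp
      qed
    qed
  qed
qed

lemma cadlag_finite_arrivals:
  assumes "cadlag x"
  shows "finite {s. arrival_at x s \<and> s \<le> t}"
proof -
  define T where "T = max 0 t"
  obtain \<delta> where \<delta>: "0 < \<delta>"
    "\<And>h m. 0 < h \<Longrightarrow> h < \<delta> \<Longrightarrow> real m * h \<le> T + 1 \<Longrightarrow> finite {s. arrival_at x s \<and> s \<le> real m * h} \<and>
       arrival_count x (real m * h) = card {j. j < m \<and> fst (x (real (Suc j) * h)) = fst (x (real j * h)) + 1}"
    by (rule cadlag_grid_count[OF assms, of "T + 1"]) (rule that)
  obtain m where m: "(T + 1) / \<delta> < real m"
    using reals_Archimedean2 by blast
  \<comment> \<open>The steps are shorter than \<open>\<delta>\<close> and end exactly at
    \<open>T + 1\<close>; adding 1 keeps \<open>h\<close> positive when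
    \<open>T = 0\<close>.\<close>
  define h where "h = (T + 1) / real m"
  have "0 < (T + 1) / \<delta>" using \<delta>(1) by (simp add: T_def)
  then have m0: "0 < real m" using m by linarith
  have h: "0 < h" "real m * h = T + 1" using m0 by (auto simp: h_def T_def)
  have "h < \<delta>"
    using m m0 \<delta>(1) by (simp add: h_def pos_divide_less_eq mult.commute)
  then have "finite {s. arrival_at x s \<and> s \<le> real m * h}"
    using h by (intro conjunct1[OF \<delta>(2)]) auto
  then show ?thesis
    by (rule finite_subset[rotated]) (use h in \<open>auto simp: T_def\<close>)
qed

lemma nth_arrival_time_nonneg: "0 \<le> nth_arrival_time x n"
proof (cases n)
  case (Suc m)
  show ?thesis unfolding Suc nth_arrival_time.simps
    by (intro Inf_greatest) (auto dest!: arrival_at_pos)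
qed simp

lemma nth_arrival_time_Suc_le:
  "arrival_at x t \<Longrightarrow> nth_arrival_time x n < ereal t \<Longrightarrow> nth_arrival_time x (Suc n) \<le> ereal t"
  unfolding nth_arrival_time.simps by (intro Inf_lower) blast

text \<open>With finitely many arrivals in bounded time the infimum is a minimum, hence itself an
  arrival.\<close>

lemma nth_arrival_time_Suc_attained:
  assumes fin: "\<And>t. finite {s. arrival_at x s \<and> s \<le> t}" and ne: "nth_arrival_time x (Suc n) \<noteq> \<infinity>"
  obtains a where "nth_arrival_time x (Suc n) = ereal a" "arrival_at x a" "nth_arrival_time x n < ereal a"
    "\<And>t. arrival_at x t \<Longrightarrow> nth_arrival_time x n < ereal t \<Longrightarrow> a \<le> t"
proof -
  define R where "R = {t. arrival_at x t \<and> nth_arrival_time x n < ereal t}"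
  have eq: "nth_arrival_time x (Suc n) = Inf (ereal ` R)"
    unfolding nth_arrival_time.simps R_def by (rule arg_cong[where f = Inf]) blast
  have "R \<noteq> {}"
    using ne unfolding eq by (auto simp: top_ereal_def)
  then obtain t0 where t0: "t0 \<in> R" by blast
  have finR: "finite {t\<in>R. t \<le> t0}"
    by (rule finite_subset[OF _ fin[of t0]]) (auto simp: R_def)
  define a where "a = Min {t\<in>R. t \<le> t0}"
  have a: "a \<in> R" "a \<le> t0"
    using Min_in[OF finR] t0 unfolding a_def by blast+
  have min: "a \<le> t" if "t \<in> R" for t
  proof (cases "t \<le> t0")
    case True
    then show ?thesis unfolding a_def using finR that by (intro Min_le) auto
  qed (use a in simp)
  have "Inf (ereal ` R) = ereal a"
    using a(1) min by (intro Inf_eqI) auto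
  then show ?thesis
    using a min eq by (intro that[of a]) (auto simp: R_def)
qed

lemma nth_arrival_time_le_iff:
  assumes fin: "\<And>t. finite {s. arrival_at x s \<and> s \<le> t}"
  shows "0 \<le> t \<Longrightarrow> nth_arrival_time x n \<le> ereal t \<longleftrightarrow> n \<le> arrival_count x t"
proof (induction n arbitrary: t)
  case 0
  then show ?case by simp
next
  case (Suc n)
  show ?case
  proof
    assume le: "nth_arrival_time x (Suc n) \<le> ereal t"
    then have ne: "nth_arrival_time x (Suc n) \<noteq> \<infinity>" by auto
    obtain a where a: "nth_arrival_time x (Suc n) = ereal a" "arrival_at x a" "nth_arrival_time x n < ereal a"
      by (rule nth_arrival_time_Suc_attained[OF fin ne]) blast
    obtain b where b: "nth_arrival_time x n = ereal b" "0 \<le> b" "b < a"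
      using a(3) nth_arrival_time_nonneg[of x n] by (cases "nth_arrival_time x n") auto
    have n: "n \<le> arrival_count x b" using Suc.IH[OF b(2)] b(1) by simp
    have "arrival_count x b + 1 = card (insert a {s. arrival_at x s \<and> s \<le> b})"
      using b fin by (simp add: arrival_count_def)
    also have "\<dots> \<le> arrival_count x t"
      unfolding arrival_count_def using le a b by (intro card_mono fin) auto
    finally show "Suc n \<le> arrival_count x t" using n by simp
  next
    assume le: "Suc n \<le> arrival_count x t"
    define A where "A = {s. arrival_at x s \<and> s \<le> t}"
    have A: "finite A" "Suc n \<le> card A" using fin le by (simp_all add: A_def arrival_count_def)
    then have "A \<noteq> {}" by auto
    \<comment> \<open>The last arrival up to \<open>t\<close>. If there is an earlier one, the last
      of these, \<open>r\<close>, has a count smaller by one, so the induction hypothesis places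
      arrival \<open>n\<close> at or before \<open>r\<close>, strictly before
      \<open>s\<close>.\<close>
    define s where "s = Max A"
    have s: "s \<in> A" "\<And>r. r \<in> A \<Longrightarrow> r \<le> s"
      using A \<open>A \<noteq> {}\<close> by (auto simp: s_def)
    have "nth_arrival_time x n < ereal s"
    proof (cases "A - {s} = {}")
      case True
      then have "card A \<le> card {s}" by (intro card_mono) auto
      then have "n = 0" using A(2) by simp
      then show ?thesis using s(1) by (auto simp: A_def dest!: arrival_at_pos)
    next
      case False
      define r where "r = Max (A - {s})"
      have r: "r \<in> A - {s}" "\<And>q. q \<in> A - {s} \<Longrightarrow> q \<le> r"
        unfolding r_def using False A by (auto intro: Max_in[of "A - {s}"] simp del: Max_in) (use Max_in[of "A - {s}"] in auto)
      have rs: "r < s" using r(1) s(2)[of r] by auto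
      have r0: "0 \<le> r" using r(1) by (auto simp: A_def dest!: arrival_at_pos)
      have "{q. arrival_at x q \<and> q \<le> r} = A - {s}"
        using r rs by (auto simp: A_def)
      then have "arrival_count x r = card A - 1"
        using s(1) A by (simp add: arrival_count_def)
      then have "nth_arrival_time x n \<le> ereal r"
        using Suc.IH[OF r0] A(2) by simp
      then show ?thesis using rs by (meson ereal_less_eq(3) le_less_trans less_ereal.simps(1))
    qed
    then have "nth_arrival_time x (Suc n) \<le> ereal s"
      using s(1) by (intro nth_arrival_time_Suc_le) (auto simp: A_def)
    also have "ereal s \<le> ereal t" using s(1) by (simp add: A_def)
    finally show "nth_arrival_time x (Suc n) \<le> ereal t" .
  qed
qed

section \<open>The inverse of a strictly increasing path and the time change\<close>

text \<open>For an increasing path the supremum is the left limit. The value 0 at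
  \<open>a = 0\<close> sends the zeroth arrival to time 0.\<close>

definition left_limit :: "(real \<Rightarrow> real) \<Rightarrow> real \<Rightarrow> real" where
  "left_limit d a = (if a = 0 then 0 else Sup (d ` {0..<a}))"

text \<open>Properties of almost every subordinator path, under which the time change is a
  deterministic matter. Jumps of \<open>d\<close> are allowed; they become flat stretches of the
  inverse.\<close>

locale strict_path =
  fixes d :: "real \<Rightarrow> real"
  assumes strict: "\<And>s t. 0 \<le> s \<Longrightarrow> s < t \<Longrightarrow> d s < d t"
    and d0: "d 0 = 0"
    and rc: "\<And>s. 0 \<le> s \<Longrightarrow> (d \<longlongrightarrow> d s) (at_right s)"
    and unb: "\<And>K. \<exists>s\<ge>0. K < d s"
begin

lemma mono: "0 \<le> s \<Longrightarrow> s \<le> t \<Longrightarrow> d s \<le> d t"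
  using strict[of s t] by (cases "s = t") auto

lemma nonneg: "0 \<le> s \<Longrightarrow> 0 \<le> d s"
  using mono[of 0 s] d0 by simp

lemma bdd: "bdd_above (d ` {0..<a})"
  by (intro bdd_aboveI[of _ "d a"]) (auto intro: mono)

lemma left_limit_le: "0 < a \<Longrightarrow> left_limit d a \<le> d a"
  unfolding left_limit_def by (auto intro!: cSup_least mono)

lemma less_left_limit:
  assumes "0 \<le> s" "s < a"
  shows "d s < left_limit d a"
proof -
  have "d s < d ((s + a) / 2)" using assms by (intro strict) auto
  also have "\<dots> \<le> left_limit d a"
    using assms bdd unfolding left_limit_def by (auto intro!: cSup_upper)
  finally show ?thesis .
qed

lemma less_left_limitD:
  assumes "0 < a" "y < left_limit d a"
  shows "\<exists>s. 0 \<le> s \<and> s < a \<and> y < d s"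
  using less_cSupD[of "d ` {0..<a}" y] assms by (auto simp: left_limit_def)

lemma left_limit_strict:
  assumes "0 \<le> a" "a < b"
  shows "left_limit d a < left_limit d b"
proof (cases "a = 0")
  case True
  then show ?thesis using less_left_limit[of 0 b] assms d0 by (simp add: left_limit_def)
next
  case False
  then have "left_limit d a \<le> d a" using assms by (intro left_limit_le) auto
  also have "d a < left_limit d b" using assms by (intro less_left_limit)
  finally show ?thesis .
qed

lemma left_limit_pos: "0 < a \<Longrightarrow> 0 < left_limit d a"
  using left_limit_strict[of 0 a] by (simp add: left_limit_def)

lemma left_limit_tendsto:
  assumes a: "0 < a" and u: "\<And>k. 0 \<le> u k" "\<And>k. u k < a" "u \<longlonglongrightarrow> a"
  shows "(\<lambda>k. d (u k)) \<longlonglongrightarrow> left_limit d a"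
proof (rule order_tendstoI)
  fix y assume "y < left_limit d a"
  then obtain s where s: "0 \<le> s" "s < a" "y < d s" using less_left_limitD[OF a] by blast
  have "\<forall>\<^sub>F k in sequentially. s < u k" using u(3) s(2) by (rule order_tendstoD)
  then show "\<forall>\<^sub>F k in sequentially. y < d (u k)"
    by eventually_elim (use s mono in \<open>meson less_imp_le less_le_trans\<close>)
next
  fix y assume "left_limit d a < y"
  then show "\<forall>\<^sub>F k in sequentially. d (u k) < y"
    using less_left_limit[OF u(1,2)] by (intro always_eventually) (meson less_trans)
qed

abbreviation Y where "Y \<equiv> inverse_path d"

lemma inverse_set: "{s. 0 \<le> s \<and> t < d s} \<noteq> {}" "bdd_below {s. 0 \<le> s \<and> t < d s}"
  using unb[of t] by (auto intro: bdd_belowI[of _ 0])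

lemma Y_nonneg: "0 \<le> Y t"
  unfolding inverse_path_def using inverse_set(1)[of t] by (auto intro!: cInf_greatest)

lemma Y_le: "0 < t \<Longrightarrow> 0 \<le> s \<Longrightarrow> t < d s \<Longrightarrow> Y t \<le> s"
  unfolding inverse_path_def using inverse_set(2)[of t] by (auto intro!: cInf_lower)

lemma d_le: "0 < t \<Longrightarrow> 0 \<le> s \<Longrightarrow> s < Y t \<Longrightarrow> d s \<le> t"
  using Y_le[of t s] by linarith

lemma less_d:
  assumes "0 < t" "Y t < s"
  shows "t < d s"
proof -
  have "Inf {s. 0 \<le> s \<and> t < d s} < s" using assms by (simp add: inverse_path_def)
  then obtain r where "0 \<le> r" "t < d r" "r < s"
    using cInf_lessD[OF inverse_set(1)] by blast
  then show ?thesis using strict[of r s] by linarith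
qed

lemma Y_mono:
  assumes "0 < s" "s \<le> t"
  shows "Y s \<le> Y t"
proof (rule ccontr)
  assume "\<not> Y s \<le> Y t"
  then obtain q where q: "Y t < q" "q < Y s" using dense by (auto simp: not_le)
  have "t < d q" using q assms by (intro less_d) auto
  moreover have "d q \<le> s" using q assms Y_nonneg[of t] by (intro d_le) auto
  ultimately show False using assms by simp
qed

text \<open>A jump of \<open>d\<close> at \<open>a\<close> keeps \<open>Y\<close> at the value
  \<open>a\<close> from the left limit on, so the left limit is the first time at which
  \<open>Y\<close> takes this value. Strictness of \<open>d\<close> excludes jumps of
  \<open>Y\<close>.\<close>

lemma Y_left_limit:
  assumes a: "0 < a"
  shows "Y (left_limit d a) = a" and "\<And>s. 0 < s \<Longrightarrow> s < left_limit d a \<Longrightarrow> Y s < a"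
proof -
  let ?t = "left_limit d a"
  have t: "0 < ?t" by (rule left_limit_pos[OF a])
  show "Y ?t = a"
  proof (rule antisym; rule ccontr)
    assume "\<not> Y ?t \<le> a"
    then obtain s where s: "a < s" "s < Y ?t" using dense by (auto simp: not_le)
    have "d s \<le> ?t" using s a by (intro d_le t) auto
    moreover have "?t \<le> d a" by (rule left_limit_le[OF a])
    moreover have "d a < d s" using s a by (intro strict) auto
    ultimately show False by simp
  next
    assume "\<not> a \<le> Y ?t"
    then obtain s where s: "Y ?t < s" "s < a" using dense by (auto simp: not_le)
    have "?t < d s" using s by (intro less_d t)
    moreover have "d s < ?t" using s Y_nonneg[of ?t] by (intro less_left_limit) auto
    ultimately show False by simp
  qed
  show "Y s < a" if s: "0 < s" "s < ?t" for s
  proof -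
    obtain r where "0 \<le> r" "r < a" "s < d r" using less_left_limitD[OF a s(2)] by blast
    then show ?thesis using Y_le[OF s(1), of r] by linarith
  qed
qed

text \<open>The converse: every time at which \<open>Y\<close> takes its value for the first time
  arises as a left limit of \<open>d\<close>.\<close>

lemma left_limit_Y:
  assumes t: "0 < t" and less: "\<And>s. 0 < s \<Longrightarrow> s < t \<Longrightarrow> Y s < Y t"
  shows "0 < Y t" and "left_limit d (Y t) = t"
proof -
  show pos: "0 < Y t"
    using less[of "t / 2"] Y_nonneg[of "t / 2"] t by simp
  show "left_limit d (Y t) = t"
  proof (rule antisym; rule ccontr)
    assume "\<not> left_limit d (Y t) \<le> t"
    then obtain s where "0 \<le> s" "s < Y t" "t < d s"
      using less_left_limitD[OF pos, of t] by (auto simp: not_le)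
    then show False using d_le[OF t, of s] by simp
  next
    assume "\<not> t \<le> left_limit d (Y t)"
    then obtain s where s: "left_limit d (Y t) < s" "s < t" using dense by (auto simp: not_le)
    have s0: "0 < s" using s left_limit_pos[OF pos] by linarith
    obtain r where r: "Y s < r" "r < Y t" using dense[OF less[OF s0 s(2)]] by blast
    have "s < d r" using r by (intro less_d s0)
    also have "d r < left_limit d (Y t)" using r Y_nonneg[of s] by (intro less_left_limit) auto
    finally show False using s by simp
  qed
qed

text \<open>\<open>Y\<close> carries left neighbourhoods of \<open>left_limit d a\<close> into left
  neighbourhoods of \<open>a\<close> and never reaches \<open>a\<close> there, so conditions from
  the left can be transferred.\<close>

lemma Y_eventually_greater:
  assumes a: "0 < a" and r: "r < a"
  shows "\<forall>\<^sub>F s in at_left (left_limit d a). r < Y s \<and> Y s < a"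
proof -
  define q where "q = (max r 0 + a) / 2"
  have q: "0 \<le> q" "r < q" "q < a" using a r by (auto simp: q_def max_def field_simps)
  show ?thesis
    unfolding eventually_at_left_field
  proof (intro exI conjI allI impI)
    show "d q < left_limit d a" using q by (intro less_left_limit)
    fix s assume s: "d q < s" "s < left_limit d a"
    have s0: "0 < s" using s nonneg[OF q(1)] by linarith
    show "Y s < a" by (rule Y_left_limit(2)[OF a s0 s(2)])
    show "r < Y s" using less_d[OF s0, of q] s q by linarith
  qed
qed

text \<open>An arrival of the changed path forces \<open>Y\<close> to reach a new value at
  \<open>t\<close>, which makes \<open>t\<close> the left limit of \<open>d\<close> at
  \<open>Y t\<close>; the states just before are then compared through the left
  neighbourhoods.\<close>

lemma arrival_time_change:
  assumes x: "cadlag x"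
  shows "arrival_at (\<lambda>t. x (Y t)) t \<longleftrightarrow> (\<exists>a. arrival_at x a \<and> t = left_limit d a)"
proof
  assume "\<exists>a. arrival_at x a \<and> t = left_limit d a"
  then obtain a where a: "arrival_at x a" and t: "t = left_limit d a" by blast
  have a0: "0 < a" using a by (rule arrival_at_pos)
  have "\<forall>\<^sub>F r in at_left a. fst (x a) = fst (x r) + 1"
    using a by (simp add: arrival_at_def)
  then obtain b where b: "b < a" "\<And>r. b < r \<Longrightarrow> r < a \<Longrightarrow> fst (x a) = fst (x r) + 1"
    unfolding eventually_at_left_field by blast
  have "\<forall>\<^sub>F s in at_left t. fst (x (Y t)) = fst (x (Y s)) + 1"
    using Y_eventually_greater[OF a0 b(1)] unfolding t Y_left_limit(1)[OF a0]
    by eventually_elim (use b(2) in blast)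
  then show "arrival_at (\<lambda>t. x (Y t)) t"
    using left_limit_pos[OF a0] by (simp add: arrival_at_def t)
next
  assume arr: "arrival_at (\<lambda>t. x (Y t)) t"
  then have t: "0 < t" by (rule arrival_at_pos)
  obtain u where u: "u < t" "\<And>s. u < s \<Longrightarrow> s < t \<Longrightarrow> fst (x (Y t)) = fst (x (Y s)) + 1"
    using arr unfolding arrival_at_def eventually_at_left_field by blast
  \<comment> \<open>Were \<open>Y\<close> constant up to \<open>t\<close>, the states at
    \<open>t\<close> and shortly before would agree, although their first components differ by
    one.\<close>
  have less: "Y s < Y t" if s: "0 < s" "s < t" for s
  proof -
    obtain r where r: "max s u < r" "r < t" using dense[of "max s u" t] s u by auto
    have "Y s \<le> Y r" using s r by (intro Y_mono) auto
    moreover have "Y r \<le> Y t" using s r by (intro Y_mono) auto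
    moreover have "Y r \<noteq> Y t" using u(2)[of r] r by auto
    ultimately show ?thesis by linarith
  qed
  define a where "a = Y t"
  have a: "0 < a" "t = left_limit d a" using left_limit_Y[OF t less] by (simp_all add: a_def)
  obtain e c where e: "0 < e" "\<And>s. 0 \<le> s \<Longrightarrow> a - e < s \<Longrightarrow> s < a \<Longrightarrow> x s = c"
    using cadlag_locally_constant[OF x, of a] a by auto
  have "\<forall>\<^sub>F s in at_left t. max (a - e) 0 < Y s \<and> Y s < a"
    unfolding a(2) using a e by (intro Y_eventually_greater) auto
  moreover have "\<forall>\<^sub>F s in at_left t. fst (x (Y t)) = fst (x (Y s)) + 1"
    using arr by (simp add: arrival_at_def)
  ultimately have "\<forall>\<^sub>F s in at_left t. fst (x a) = fst c + 1"
    by eventually_elim (use e(2) Y_nonneg in \<open>auto simp: a_def[symmetric]\<close>)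
  then have c: "fst (x a) = fst c + 1" by simp
  have "\<forall>\<^sub>F r in at_left a. fst (x a) = fst (x r) + 1"
    unfolding eventually_at_left_field
  proof (intro exI conjI allI impI)
    show "max (a - e) 0 < a" using a e by simp
    fix r assume "max (a - e) 0 < r" "r < a"
    then show "fst (x a) = fst (x r) + 1" using e(2)[of r] c by simp
  qed
  then have "arrival_at x a" using a by (simp add: arrival_at_def)
  then show "\<exists>a. arrival_at x a \<and> t = left_limit d a" using a by blast
qed

text \<open>\<open>left_limit d\<close> is strictly increasing and maps the arrivals of
  \<open>x\<close> onto those of the changed path, so successive minima correspond.\<close>

lemma nth_arrival_time_change:
  assumes x: "cadlag x"
  shows "nth_arrival_time x n = ereal a \<Longrightarrow> nth_arrival_time (\<lambda>t. x (Y t)) n = ereal (left_limit d a)"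
proof (induction n arbitrary: a)
  case 0
  then have "a = 0" by simp
  then show ?case by (simp add: left_limit_def)
next
  case (Suc n)
  have ne: "nth_arrival_time x (Suc n) \<noteq> \<infinity>" using Suc.prems by simp
  obtain b where b: "nth_arrival_time x (Suc n) = ereal b" "arrival_at x b" "nth_arrival_time x n < ereal b"
    and min: "\<And>t. arrival_at x t \<Longrightarrow> nth_arrival_time x n < ereal t \<Longrightarrow> b \<le> t"
    by (rule nth_arrival_time_Suc_attained[OF cadlag_finite_arrivals[OF x] ne]) blast
  have ab: "b = a" using b(1) Suc.prems by simp
  obtain c where c: "nth_arrival_time x n = ereal c" "0 \<le> c" "c < a"
    using b(3) nth_arrival_time_nonneg[of x n] ab by (cases "nth_arrival_time x n") auto
  have IH: "nth_arrival_time (\<lambda>t. x (Y t)) n = ereal (left_limit d c)"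
    by (rule Suc.IH[OF c(1)])
  have le: "left_limit d a \<le> left_limit d s" if s: "arrival_at x s" "left_limit d c < left_limit d s" for s
  proof -
    have "c < s"
    proof (rule ccontr)
      assume "\<not> c < s"
      then have "left_limit d s \<le> left_limit d c"
        using left_limit_strict[of s c] arrival_at_pos[OF s(1)] by (cases "s = c") auto
      then show False using s by simp
    qed
    then have "a \<le> s" using min[OF s(1)] c(1) ab by simp
    then show ?thesis
      using left_limit_strict[of a s] c by (cases "s = a") auto
  qed
  show ?case
    unfolding nth_arrival_time.simps IH
  proof (rule Inf_eqI)
    fix y assume "y \<in> {ereal t |t. arrival_at (\<lambda>t. x (Y t)) t \<and> ereal (left_limit d c) < ereal t}"
    then show "ereal (left_limit d a) \<le> y"
      using le unfolding arrival_time_change[OF x] by auto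
  next
    fix y assume "\<And>z. z \<in> {ereal t |t. arrival_at (\<lambda>t. x (Y t)) t \<and> ereal (left_limit d c) < ereal t} \<Longrightarrow> y \<le> z"
    moreover have "ereal (left_limit d a) \<in> {ereal t |t. arrival_at (\<lambda>t. x (Y t)) t \<and> ereal (left_limit d c) < ereal t}"
      unfolding arrival_time_change[OF x] using b(2) ab left_limit_strict[OF c(2,3)] by auto
    ultimately show "y \<le> ereal (left_limit d a)" by blast
  qed
qed

end

section \<open>Grid approximation of the arrival functional along one path\<close>

text \<open>The index of the last grid point strictly before \<open>a\<close>. Rounding down would
  return \<open>a\<close> itself when it is a grid point, and a jump of \<open>d\<close> there would
  be included by mistake.\<close>

definition grid_below :: "real \<Rightarrow> real \<Rightarrow> nat" where
  "grid_below h a = nat (\<lceil>a / h\<rceil> - 1)"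

lemma grid_below:
  assumes "0 < h" "0 < a"
  shows "real (grid_below h a) * h < a" "a \<le> real (Suc (grid_below h a)) * h"
proof -
  have pos: "0 < \<lceil>a / h\<rceil>" using assms by simp
  have r: "real (grid_below h a) = of_int \<lceil>a / h\<rceil> - 1"
    unfolding grid_below_def using pos by simp
  have "of_int \<lceil>a / h\<rceil> - 1 < a / h" by linarith
  then show "real (grid_below h a) * h < a"
    unfolding r using assms by (simp add: pos_less_divide_eq)
  have "a \<le> of_int \<lceil>a / h\<rceil> * h"
    using pos_divide_le_eq[OF assms(1), of a "of_int \<lceil>a / h\<rceil>"] le_of_int_ceiling[of "a / h"] by blast
  then show "a \<le> real (Suc (grid_below h a)) * h"
    unfolding of_nat_Suc r by simp
qed

lemma le_grid_below_iff:
  assumes "0 < h" "0 < a"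
  shows "j \<le> grid_below h a \<longleftrightarrow> real j * h < a"
proof
  assume "j \<le> grid_below h a"
  then have "real j * h \<le> real (grid_below h a) * h" using assms by (intro mult_right_mono) auto
  then show "real j * h < a" using grid_below(1)[OF assms] by linarith
next
  assume less: "real j * h < a"
  show "j \<le> grid_below h a"
  proof (rule ccontr)
    assume "\<not> ?thesis"
    then have "real (Suc (grid_below h a)) * h \<le> real j * h" using assms by (intro mult_right_mono) auto
    then show False using grid_below(2)[OF assms] less by linarith
  qed
qed

lemma grid_below_tendsto:
  assumes h: "h \<longlonglongrightarrow> 0" "\<And>k. 0 < h k" and a: "0 < a"
  shows "(\<lambda>k. real (grid_below (h k) a) * h k) \<longlonglongrightarrow> a"
proof (rule tendsto_sandwich)
  show "\<forall>\<^sub>F k in sequentially. a - h k \<le> real (grid_below (h k) a) * h k"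
    using grid_below(2)[OF h(2) a] by (intro always_eventually allI) (simp add: algebra_simps)
  show "\<forall>\<^sub>F k in sequentially. real (grid_below (h k) a) * h k \<le> a"
    using grid_below(1)[OF h(2) a] by (intro always_eventually allI less_imp_le)
  show "(\<lambda>k. a - h k) \<longlonglongrightarrow> a"
    using tendsto_diff[OF tendsto_const[of a] h(1)] by simp
qed simp

lemma grid_count_mono: "m \<le> m' \<Longrightarrow> grid_count Q h m \<omega> \<le> grid_count Q h m' \<omega>"
  unfolding grid_count_def by (intro card_mono) auto

text \<open>An arrival raises the count, so a level is left at most once. The series of
  \<open>grid_term\<close> over the steps therefore has at most one nonzero term.\<close>

lemma grid_arrival_unique:
  assumes "grid_count Q h m \<omega> = n" "grid_arrival Q h m \<omega>" "grid_count Q h m' \<omega> = n" "grid_arrival Q h m' \<omega>"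
  shows "m = m'"
proof -
  have "\<not> m < m'" if "grid_count Q h m \<omega> = n" "grid_arrival Q h m \<omega>" "grid_count Q h m' \<omega> = n" for m m'
    using grid_count_mono[of "Suc m" m' Q h \<omega>] grid_count_Suc[of Q h m \<omega>] that by auto
  from this[OF assms(1,2,3)] this[OF assms(3,4,1)] show ?thesis by simp
qed

text \<open>Step \<open>j\<close> is weighted with the increment of \<open>d\<close> over the preceding grid interval (none for \<open>j = 0\<close>,
  by truncated subtraction).  So \<open>d\<close> is read at the last grid point before each arrival, which gives
  its left limit there as \<open>h\<close> tends to 0.\<close>

definition grid_sum :: "(real \<Rightarrow> 'w \<Rightarrow> nat \<times> nat) \<Rightarrow> (real \<Rightarrow> real) \<Rightarrow> (nat \<Rightarrow> real) \<Rightarrow> real \<Rightarrow> nat \<Rightarrow> 'w \<Rightarrow> real" where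
  "grid_sum Q d z h m \<omega> = (\<Sum>j\<le>m. z (grid_count Q h j \<omega>) * (d (real j * h) - d (real (j - 1) * h)))"

definition grid_term :: "(real \<Rightarrow> 'w \<Rightarrow> nat \<times> nat) \<Rightarrow> (real \<Rightarrow> real) \<Rightarrow> (nat \<Rightarrow> real) \<Rightarrow> nat \<Rightarrow> real \<Rightarrow> nat \<Rightarrow> 'w \<Rightarrow> real" where
  "grid_term Q d z n h m \<omega> = exp (- grid_sum Q d z h m \<omega>) * of_bool (grid_count Q h m \<omega> = n \<and> grid_arrival Q h m \<omega>)"

lemma grid_term_sums:
  "grid_count Q h m \<omega> = n \<Longrightarrow> grid_arrival Q h m \<omega> \<Longrightarrow>
     (\<lambda>m. grid_term Q d z n h m \<omega>) sums exp (- grid_sum Q d z h m \<omega>)"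
proof -
  assume m: "grid_count Q h m \<omega> = n" "grid_arrival Q h m \<omega>"
  have "grid_term Q d z n h m' \<omega> = (if m' = m then exp (- grid_sum Q d z h m' \<omega>) else 0)" for m'
  proof (cases "m' = m")
    case True
    then show ?thesis using m by (simp add: grid_term_def)
  next
    case False
    then have "\<not> (grid_count Q h m' \<omega> = n \<and> grid_arrival Q h m' \<omega>)"
      using grid_arrival_unique[OF m, of m'] by blast
    then show ?thesis using False by (simp add: grid_term_def)
  qed
  then show ?thesis
    using sums_single[of m "\<lambda>m'. exp (- grid_sum Q d z h m' \<omega>)"] by simp
qed

lemma grid_term_sums_0:
  assumes "\<And>m. \<not> (grid_count Q h m \<omega> = n \<and> grid_arrival Q h m \<omega>)"
  shows "(\<lambda>m. grid_term Q d z n h m \<omega>) sums 0"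
proof -
  have "grid_term Q d z n h m \<omega> = 0" for m
    using assms[of m] by (simp add: grid_term_def)
  then show ?thesis by simp
qed

lemma summable_grid_term: "summable (\<lambda>m. grid_term Q d z n h m \<omega>)"
proof (cases "\<exists>m. grid_count Q h m \<omega> = n \<and> grid_arrival Q h m \<omega>")
  case True
  then show ?thesis using grid_term_sums by (metis sums_summable)
next
  case False
  then have "(\<lambda>m. grid_term Q d z n h m \<omega>) sums 0" by (intro grid_term_sums_0) blast
  then show ?thesis by (rule sums_summable)
qed

text \<open>The gaps with indices 0 to \<open>n\<close> need \<open>Suc n\<close> arrivals. On paths
  with fewer of them the value 0 is the limit of the grid sums, and it lets the expectation detect
  missing arrivals.\<close>

definition arrival_functional :: "(real \<Rightarrow> nat \<times> nat) \<Rightarrow> (real \<Rightarrow> real) \<Rightarrow> (nat \<Rightarrow> real) \<Rightarrow> nat \<Rightarrow> real" where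
  "arrival_functional x d z n = (if nth_arrival_time x (Suc n) = \<infinity> then 0 else
     exp (- (\<Sum>i\<le>n. z i * (left_limit d (real_of_ereal (nth_arrival_time x (Suc i)))
        - left_limit d (real_of_ereal (nth_arrival_time x i))))))"

lemma nth_arrival_time_less_Suc:
  assumes x: "cadlag x" and a: "nth_arrival_time x (Suc n) \<noteq> \<infinity>"
  shows "nth_arrival_time x n < nth_arrival_time x (Suc n)"
  by (rule nth_arrival_time_Suc_attained[OF cadlag_finite_arrivals[OF x] a]) simp

lemma nth_arrival_time_real:
  assumes x: "cadlag x" and a: "nth_arrival_time x n \<noteq> \<infinity>" and i: "i \<le> n"
  shows "nth_arrival_time x i = ereal (real_of_ereal (nth_arrival_time x i))"
    and "nth_arrival_time x i \<le> nth_arrival_time x n"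
proof -
  have "nth_arrival_time x i \<noteq> \<infinity> \<and> nth_arrival_time x i \<le> nth_arrival_time x n"
    using i a
  proof (induction rule: inc_induct)
    case (step m)
    then show ?case using nth_arrival_time_less_Suc[OF x, of m] by auto
  qed simp
  then show "nth_arrival_time x i \<le> nth_arrival_time x n"
    and "nth_arrival_time x i = ereal (real_of_ereal (nth_arrival_time x i))"
    using nth_arrival_time_nonneg[of x i] by (cases "nth_arrival_time x i"; auto)+
qed

context strict_path
begin

lemma telescope: "(\<Sum>j\<le>m. d (real j * h) - d (real (j - 1) * h)) = d (real m * h)"
  by (induction m) (simp_all add: d0 del: of_nat_Suc)

text \<open>Up to shortly after arrival \<open>Suc n\<close> the grid count is exact for small
  \<open>h\<close>. Regrouping the increments by level then leaves differences of \<open>d\<close>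
  at the last grid points before the arrivals, and these points increase to the arrivals from
  strictly below.\<close>

lemma grid_functional_tendsto:
  assumes x: "cadlag (\<lambda>t. Q t \<omega>)" and z: "0 < zmin" "\<And>i. zmin \<le> z i"
    and h: "h \<longlonglongrightarrow> 0" "\<And>k. 0 < h k"
  shows "(\<lambda>k. \<Sum>m. grid_term Q d z n (h k) m \<omega>) \<longlonglongrightarrow> arrival_functional (\<lambda>t. Q t \<omega>) d z n"
proof -
  let ?x = "\<lambda>t. Q t \<omega>"
  let ?A = "nth_arrival_time ?x"
  have count: "\<exists>\<delta>>0. \<forall>h m. 0 < h \<and> h < \<delta> \<and> real m * h \<le> K \<longrightarrow> (\<forall>i. i \<le> grid_count Q h m \<omega> \<longleftrightarrow> ?A i \<le> ereal (real m * h))" for K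
  proof -
    obtain \<delta> where \<delta>: "0 < \<delta>"
      "\<And>h m. 0 < h \<Longrightarrow> h < \<delta> \<Longrightarrow> real m * h \<le> K \<Longrightarrow> finite {s. arrival_at ?x s \<and> s \<le> real m * h} \<and>
       arrival_count ?x (real m * h) = card {j. j < m \<and> fst (?x (real (Suc j) * h)) = fst (?x (real j * h)) + 1}"
      by (rule cadlag_grid_count[OF x, of K]) (rule that)
    have "i \<le> grid_count Q h m \<omega> \<longleftrightarrow> ?A i \<le> ereal (real m * h)"
      if "0 < h" "h < \<delta>" "real m * h \<le> K" for h m i
    proof -
      have "grid_count Q h m \<omega> = arrival_count ?x (real m * h)"
        using \<delta>(2)[OF that] by (simp only: grid_count_def grid_arrival_def)
      then show ?thesis
        using nth_arrival_time_le_iff[OF cadlag_finite_arrivals[OF x], of "real m * h" i] that(1) by simp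
    qed
    then show ?thesis using \<delta>(1) by blast
  qed
  have small: "\<forall>\<^sub>F k in sequentially. h k < \<delta>" if "0 < \<delta>" for \<delta>
    using h(1) that by (rule order_tendstoD)
  show ?thesis
  proof (cases "?A (Suc n) = \<infinity>")
    case False
    define a where "a i = real_of_ereal (?A i)" for i
    have A: "?A i = ereal (a i)" "a i \<le> a (Suc n)" if "i \<le> Suc n" for i
      using nth_arrival_time_real[OF x False that] nth_arrival_time_real[OF x False order_refl]
      by (metis a_def, metis a_def ereal_less_eq(3))
    have a_mono: "a i < a (Suc i)" if "i \<le> n" for i
      using nth_arrival_time_less_Suc[OF x, of i] A[of i] A[of "Suc i"] that by simp
    have a_pos: "0 < a i" if "0 < i" "i \<le> Suc n" for i
    proof -
      from that(1) obtain j where j: "i = Suc j" by (cases i) auto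
      have "0 \<le> a j" using nth_arrival_time_nonneg[of ?x j] A[of j] that j by simp
      then show ?thesis using a_mono[of j] that j by simp
    qed
    define S where "S k i = (if i = 0 then 0 else d (real (grid_below (h k) (a i)) * h k))" for k i
    \<comment> \<open>The extra 1 keeps the grid point after arrival \<open>Suc n\<close> inside the
      window of exact counting, as \<open>h < 1\<close>.\<close>
    obtain \<delta> where \<delta>: "0 < \<delta>"
      "\<And>h m i. 0 < h \<Longrightarrow> h < \<delta> \<Longrightarrow> real m * h \<le> a (Suc n) + 1 \<Longrightarrow> i \<le> grid_count Q h m \<omega> \<longleftrightarrow> ?A i \<le> ereal (real m * h)"
      using count[of "a (Suc n) + 1"] by blast
    have "\<forall>\<^sub>F k in sequentially. h k < min \<delta> 1"
      using \<delta>(1) by (intro small) auto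
    then have ev: "\<forall>\<^sub>F k in sequentially. exp (- (\<Sum>i\<le>n. z i * (S k (Suc i) - S k i))) = (\<Sum>m. grid_term Q d z n (h k) m \<omega>)"
    proof eventually_elim
      case (elim k)
      let ?h = "h k" and ?c = "\<lambda>j. grid_count Q (h k) j \<omega>"
      define K where "K = grid_below ?h (a (Suc n))"
      have K: "real K * ?h < a (Suc n)" "a (Suc n) \<le> real (Suc K) * ?h"
        unfolding K_def using grid_below[OF h(2) a_pos[of "Suc n"]] by auto
      have cnt: "i \<le> ?c j \<longleftrightarrow> a i \<le> real j * ?h" if "i \<le> Suc n" "j \<le> Suc K" for i j
      proof -
        have "real j * ?h \<le> real (Suc K) * ?h" using that h(2)[of k] by (intro mult_right_mono) auto
        also have "\<dots> \<le> a (Suc n) + 1" using K elim by (simp add: algebra_simps)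
        finally show ?thesis using \<delta>(2)[OF h(2)[of k], of j i] elim A(1)[OF that(1)] by simp
      qed
      have "Suc n \<le> ?c (Suc K)" using cnt[of "Suc n" "Suc K"] K by simp
      moreover have "\<not> Suc n \<le> ?c K" using cnt[of "Suc n" K] K by simp
      ultimately have cK: "?c K = n" "grid_arrival Q ?h K \<omega>"
        using grid_count_Suc[of Q ?h K \<omega>] by (auto simp: of_bool_def split: if_splits)
      \<comment> \<open>The count at step \<open>j\<close> stays below \<open>i\<close> exactly
        while the grid point precedes arrival \<open>i\<close>, and the increments over these steps
        telescope.\<close>
      have below: "(\<Sum>j\<le>K. of_bool (?c j < i) * (d (real j * ?h) - d (real (j - 1) * ?h))) = S k i" if i: "i \<le> Suc n" for i
      proof (cases "i = 0")
        case True
        then show ?thesis by (simp add: S_def)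
      next
        case False
        let ?k = "grid_below ?h (a i)"
        have ai: "0 < a i" using a_pos False i by simp
        have le: "?k \<le> K"
          unfolding K_def le_grid_below_iff[OF h(2) a_pos[of "Suc n", simplified]]
          using grid_below(1)[OF h(2)[of k] ai] A(2)[OF i] by simp
        have "(\<Sum>j\<le>K. of_bool (?c j < i) * (d (real j * ?h) - d (real (j - 1) * ?h)))
          = (\<Sum>j\<le>?k. d (real j * ?h) - d (real (j - 1) * ?h))"
        proof (rule sum.mono_neutral_cong_right)
          show "\<forall>j\<in>{..K} - {..?k}. of_bool (?c j < i) * (d (real j * ?h) - d (real (j - 1) * ?h)) = 0"
            using cnt[OF i] le_grid_below_iff[OF h(2)[of k] ai] by (auto simp: not_less)
          show "of_bool (?c j < i) * (d (real j * ?h) - d (real (j - 1) * ?h)) = d (real j * ?h) - d (real (j - 1) * ?h)"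
            if "j \<in> {..?k}" for j
            using that cnt[OF i, of j] le_grid_below_iff[OF h(2)[of k] ai, of j] le by (simp add: not_le)
        qed (use le in auto)
        also have "\<dots> = S k i"
          unfolding telescope using False by (simp add: S_def)
        finally show ?thesis .
      qed
      have "grid_sum Q d z ?h K \<omega> = (\<Sum>i\<le>n. z i * (S k (Suc i) - S k i))"
      proof -
        \<comment> \<open>The difference of the two indicators is 1 exactly at
          \<open>i = ?c j\<close>. Exchanging the sums collects the increments of each level into
          two values of \<open>S\<close>.\<close>
        have "grid_sum Q d z ?h K \<omega> = (\<Sum>j\<le>K. \<Sum>i\<le>n. z i * ((of_bool (?c j < Suc i) - of_bool (?c j < i)) * (d (real j * ?h) - d (real (j - 1) * ?h))))"
          unfolding grid_sum_def
        proof (rule sum.cong[OF refl])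
          fix j assume "j \<in> {..K}"
          then have "?c j \<le> n" using grid_count_mono[of j K Q ?h \<omega>] cK by simp
          then have "(\<Sum>i\<le>n. z i * ((of_bool (?c j < Suc i) - of_bool (?c j < i)) * (d (real j * ?h) - d (real (j - 1) * ?h))))
             = (\<Sum>i\<le>n. if i = ?c j then z i * (d (real j * ?h) - d (real (j - 1) * ?h)) else 0)"
            by (intro sum.cong) (auto simp: of_bool_def)
          also have "\<dots> = z (?c j) * (d (real j * ?h) - d (real (j - 1) * ?h))"
            using \<open>?c j \<le> n\<close> by simp
          finally show "z (?c j) * (d (real j * ?h) - d (real (j - 1) * ?h)) = (\<Sum>i\<le>n. z i * ((of_bool (?c j < Suc i) - of_bool (?c j < i)) * (d (real j * ?h) - d (real (j - 1) * ?h))))" ..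
        qed
        also have "\<dots> = (\<Sum>i\<le>n. z i * ((\<Sum>j\<le>K. of_bool (?c j < Suc i) * (d (real j * ?h) - d (real (j - 1) * ?h)))
             - (\<Sum>j\<le>K. of_bool (?c j < i) * (d (real j * ?h) - d (real (j - 1) * ?h)))))"
          by (subst sum.swap) (simp only: sum_distrib_left[symmetric] left_diff_distrib sum_subtractf)
        also have "\<dots> = (\<Sum>i\<le>n. z i * (S k (Suc i) - S k i))"
        proof (rule sum.cong[OF refl])
          fix i assume "i \<in> {..n}"
          then have "i \<le> Suc n" "Suc i \<le> Suc n" by auto
          from this[THEN below] show "z i * ((\<Sum>j\<le>K. of_bool (?c j < Suc i) * (d (real j * ?h) - d (real (j - 1) * ?h)))
             - (\<Sum>j\<le>K. of_bool (?c j < i) * (d (real j * ?h) - d (real (j - 1) * ?h)))) = z i * (S k (Suc i) - S k i)"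
            by (simp only:)
        qed
        finally show ?thesis .
      qed
      then show ?case
        using sums_unique[OF grid_term_sums[OF cK, of d z]] by simp
    qed
    have S: "(\<lambda>k. S k i) \<longlonglongrightarrow> left_limit d (a i)" if "i \<le> Suc n" for i
    proof (cases "i = 0")
      case True
      then show ?thesis by (simp add: S_def a_def left_limit_def)
    next
      case False
      then have ai: "0 < a i" using a_pos that by simp
      have "(\<lambda>k. d (real (grid_below (h k) (a i)) * h k)) \<longlonglongrightarrow> left_limit d (a i)"
        using grid_below(1)[OF h(2) ai] h(2)
        by (intro left_limit_tendsto ai grid_below_tendsto h mult_nonneg_nonneg) (auto intro: less_imp_le)
      then show ?thesis using False by (simp add: S_def)
    qed
    have "(\<lambda>k. exp (- (\<Sum>i\<le>n. z i * (S k (Suc i) - S k i)))) \<longlonglongrightarrow> exp (- (\<Sum>i\<le>n. z i * (left_limit d (a (Suc i)) - left_limit d (a i))))"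
      by (intro tendsto_intros S) auto
    then have "(\<lambda>k. \<Sum>m. grid_term Q d z n (h k) m \<omega>) \<longlonglongrightarrow> exp (- (\<Sum>i\<le>n. z i * (left_limit d (a (Suc i)) - left_limit d (a i))))"
      by (rule Lim_transform_eventually) (rule ev)
    then show ?thesis
      using False by (simp add: arrival_functional_def a_def)
  next
    case True
    have nonneg: "0 \<le> (\<Sum>m. grid_term Q d z n (h k) m \<omega>)" for k
      by (intro suminf_nonneg summable_grid_term) (simp add: grid_term_def)
    \<comment> \<open>The path lacks arrival \<open>Suc n\<close>, but at late times the grid may be
      too coarse and report one. For small \<open>h\<close> that can only happen after about time
      \<open>K\<close>, where the weight is at most \<open>exp (- (zmin * d K))\<close>;
      unboundedness of \<open>d\<close> makes this arbitrarily small.\<close>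
    have ub: "\<forall>\<^sub>F k in sequentially. (\<Sum>m. grid_term Q d z n (h k) m \<omega>) \<le> exp (- (zmin * d K))" if K: "0 \<le> K" for K
    proof -
      obtain \<delta> where \<delta>: "0 < \<delta>"
        "\<And>h m i. 0 < h \<Longrightarrow> h < \<delta> \<Longrightarrow> real m * h \<le> K + 1 \<Longrightarrow> i \<le> grid_count Q h m \<omega> \<longleftrightarrow> ?A i \<le> ereal (real m * h)"
        using count[of "K + 1"] by blast
      have "\<forall>\<^sub>F k in sequentially. h k < min \<delta> 1"
        using \<delta>(1) by (intro small) auto
      then show ?thesis
      proof eventually_elim
        case (elim k)
        let ?h = "h k" and ?c = "\<lambda>j. grid_count Q (h k) j \<omega>"
        show ?case
        proof (cases "\<exists>m. ?c m = n \<and> grid_arrival Q ?h m \<omega>")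
          case False
          then have "(\<lambda>m. grid_term Q d z n ?h m \<omega>) sums 0" by (intro grid_term_sums_0) blast
          from sums_unique[OF this] show ?thesis by simp
        next
          case m_ex: True
          then obtain m where m: "?c m = n" "grid_arrival Q ?h m \<omega>" by blast
          have mK: "K \<le> real m * ?h"
          proof (rule ccontr)
            assume "\<not> K \<le> real m * ?h"
            then have "real (Suc m) * ?h \<le> K + 1" using elim by (simp add: algebra_simps)
            then have "?A (Suc n) \<le> ereal (real (Suc m) * ?h)"
              using \<delta>(2)[OF h(2)[of k], of "Suc m" "Suc n"] elim m by (simp add: grid_count_Suc)
            then show False using True by simp
          qed
          have "zmin * d K \<le> zmin * d (real m * ?h)"
            using z(1) K mK by (intro mult_left_mono mono) auto
          also have "\<dots> = (\<Sum>j\<le>m. zmin * (d (real j * ?h) - d (real (j - 1) * ?h)))"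
            by (simp only: sum_distrib_left[symmetric] telescope)
          also have "\<dots> \<le> grid_sum Q d z ?h m \<omega>"
            unfolding grid_sum_def
          proof (intro sum_mono mult_right_mono z)
            fix j
            have "real (j - 1) * ?h \<le> real j * ?h" using h(2)[of k] by (intro mult_right_mono) auto
            then show "0 \<le> d (real j * ?h) - d (real (j - 1) * ?h)"
              using mono[of "real (j - 1) * ?h" "real j * ?h"] h(2)[of k] by simp
          qed
          finally show ?thesis
            using sums_unique[OF grid_term_sums[OF m, of d z], symmetric] by simp
        qed
      qed
    qed
    have "(\<lambda>k. \<Sum>m. grid_term Q d z n (h k) m \<omega>) \<longlonglongrightarrow> 0"
    proof (rule order_tendstoI)
      fix y :: real assume "y < 0"
      then show "\<forall>\<^sub>F k in sequentially. y < (\<Sum>m. grid_term Q d z n (h k) m \<omega>)"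
        using nonneg by (intro always_eventually) (meson less_le_trans)
    next
      fix y :: real assume y: "0 < y"
      obtain K where K: "0 \<le> K" "- ln y / zmin < d K" using unb by blast
      then have "- ln y < d K * zmin" using z(1) by (simp only: pos_divide_less_eq)
      then have "- ln y < zmin * d K" by (simp only: mult.commute)
      then have "exp (- (zmin * d K)) < exp (ln y)" by simp
      then have less: "exp (- (zmin * d K)) < y" using y by simp
      show "\<forall>\<^sub>F k in sequentially. (\<Sum>m. grid_term Q d z n (h k) m \<omega>) < y"
        using ub[OF K(1)] by eventually_elim (use less in linarith)
    qed
    then show ?thesis using True by (simp add: arrival_functional_def)
  qed
qed

end

section \<open>The subordinator\<close>

text \<open>Independence is assumed for the inverse process only; \<open>D\<close> is recovered from countably many of its
  values.\<close>

lemma (in strict_path) path_from_inverse: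
  assumes s: "0 \<le> s"
  shows "(INF q\<in>{q\<in>\<rat>. 0 < q}. if s < Y q then ereal q else \<infinity>) = ereal (d s)"
proof (rule antisym)
  show "(INF q\<in>{q\<in>\<rat>. 0 < q}. if s < Y q then ereal q else \<infinity>) \<le> ereal (d s)"
  proof (rule dense_ge)
    fix y assume "ereal (d s) < y"
    then obtain y' where y': "d s < y'" "ereal y' \<le> y"
      using ereal_dense2[of "ereal (d s)" y] by (metis less_ereal.simps(1) less_imp_le)
    obtain q where q: "q \<in> \<rat>" "d s < q" "q < y'" using Rats_dense_in_real[OF y'(1)] by blast
    have q0: "0 < q" using nonneg[OF s] q by linarith
    \<comment> \<open>Right continuity gives some \<open>r > s\<close> with \<open>d r < q\<close>,
      which forces \<open>Y q\<close> beyond \<open>s\<close> and admits \<open>q\<close> in the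
      infimum.\<close>
    have "\<forall>\<^sub>F r in at_right s. d r < q"
      using rc[OF s] q(2) by (rule order_tendstoD)
    then obtain b where b: "s < b" "\<And>r. s < r \<Longrightarrow> r < b \<Longrightarrow> d r < q"
      unfolding eventually_at_right_field by blast
    obtain r where r: "s < r" "r < b" using dense[OF b(1)] by blast
    have "s < Y q"
    proof (rule ccontr)
      assume "\<not> s < Y q"
      then have "q < d r" using r by (intro less_d q0) auto
      then show False using b(2)[OF r] by simp
    qed
    then have "(INF q\<in>{q\<in>\<rat>. 0 < q}. if s < Y q then ereal q else \<infinity>) \<le> ereal q"
      using q q0 by (intro INF_lower2[of q]) auto
    also have "ereal q \<le> y" using q y' by (meson ereal_less_eq(3) less_imp_le order_trans)
    finally show "(INF q\<in>{q\<in>\<rat>. 0 < q}. if s < Y q then ereal q else \<infinity>) \<le> y" .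
  qed
  show "ereal (d s) \<le> (INF q\<in>{q\<in>\<rat>. 0 < q}. if s < Y q then ereal q else \<infinity>)"
    using s by (intro INF_greatest) (auto intro: d_le)
qed

definition path_algebra :: "'w measure \<Rightarrow> 'b measure \<Rightarrow> (real \<Rightarrow> 'w \<Rightarrow> 'b) \<Rightarrow> 'w measure" where
  "path_algebra M A X = vimage_algebra (space M) (\<lambda>\<omega>. \<lambda>t\<in>{0..}. X t \<omega>) (Pi\<^sub>M {0..} (\<lambda>_. A))"

lemma space_path_algebra [simp]: "space (path_algebra M A X) = space M"
  by (simp add: path_algebra_def)

lemma measurable_path_algebra:
  assumes X: "\<And>t. 0 \<le> t \<Longrightarrow> X t \<in> measurable M A" and t: "0 \<le> t"
  shows "X t \<in> measurable (path_algebra M A X) A"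
proof -
  have "(\<lambda>\<omega>. \<lambda>t\<in>{0..}. X t \<omega>) \<in> measurable (path_algebra M A X) (Pi\<^sub>M {0..} (\<lambda>_. A))"
    unfolding path_algebra_def
    by (rule measurable_vimage_algebra1)
       (intro funcsetI, simp only: space_PiM restrict_PiE_iff, auto intro: measurable_space[OF X])
  from measurable_compose[OF this measurable_component_singleton[of t "{0..}" "\<lambda>_. A"]]
  show ?thesis using t by simp
qed

section \<open>Independence, grid increments and almost sure path properties\<close>

context prob_space
begin

lemma indep_processes_integral:
  assumes ind: "indep_processes M A X B Y" and E: "E \<in> sets (path_algebra M A X)"
    and g: "g \<in> borel_measurable (path_algebra M B Y)" and int: "integrable M (g :: 'a \<Rightarrow> real)"
  shows "(\<integral>\<omega>. indicator E \<omega> * g \<omega> \<partial>M) = prob E * (\<integral>\<omega>. g \<omega> \<partial>M)"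
proof -
  have ind: "indep_set (sets (path_algebra M A X)) (sets (path_algebra M B Y))"
    using ind by (simp add: indep_processes_def path_algebra_def)
  have ev: "sets (path_algebra M A X) \<subseteq> events"
    using ind by (simp add: indep_sets2_eq)
  have Em: "E \<in> events" using E ev by blast
  have sub: "sigma_sets (space M) {f -` C \<inter> space M |C. C \<in> sets borel} \<subseteq> sets F"
    if f: "f \<in> borel_measurable F" and F: "space F = space M" for f :: "'a \<Rightarrow> real" and F
  proof -
    have "{f -` C \<inter> space M |C. C \<in> sets borel} \<subseteq> sets F"
      using measurable_sets[OF f] F by auto
    then show ?thesis
      using sets.sigma_sets_subset[of _ F] F by simp
  qed
  have "indep_var borel (indicator E :: 'a \<Rightarrow> real) borel g"
    unfolding indep_var_eq
  proof (intro conjI)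
    show "indep_set (sigma_sets (space M) {indicator E -` C \<inter> space M |C. C \<in> sets (borel :: real measure)})
        (sigma_sets (space M) {g -` C \<inter> space M |C. C \<in> sets borel})"
      using ind unfolding indep_set_def
    proof (rule indep_sets_mono_sets)
      fix i :: bool
      have "(indicator E :: 'a \<Rightarrow> real) \<in> borel_measurable (path_algebra M A X)"
        using E by (rule borel_measurable_indicator)
      then show "case_bool (sigma_sets (space M) {indicator E -` C \<inter> space M |C. C \<in> sets (borel :: real measure)})
        (sigma_sets (space M) {g -` C \<inter> space M |C. C \<in> sets borel}) i \<subseteq> case_bool (sets (path_algebra M A X)) (sets (path_algebra M B Y)) i"
        using sub[of _ "path_algebra M A X"] sub[OF g] by (cases i) simp_all
    qed
  qed (use Em int in auto)
  then show ?thesis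
    using Em int
    by (subst indep_var_lebesgue_integral) (auto intro!: integrable_real_indicator simp: less_top[symmetric])
qed

lemma levy_increment_laplace:
  assumes levy: "levy_process M D"
    and \<phi>: "\<And>t z. 0 \<le> t \<Longrightarrow> 0 < z \<Longrightarrow> expectation (\<lambda>\<omega>. exp (- z * D t \<omega>)) = exp (- t * \<phi> z)"
    and st: "0 \<le> s" "s \<le> t" and z: "0 < z"
  shows "expectation (\<lambda>\<omega>. exp (- (z * (D t \<omega> - D s \<omega>)))) = exp (- ((t - s) * \<phi> z))"
proof -
  have [measurable]: "D t \<in> borel_measurable M" if "0 \<le> t" for t
    using levy that by (simp add: levy_process_def)
  have [measurable]: "D t \<in> borel_measurable M" "D s \<in> borel_measurable M" "D (t - s) \<in> borel_measurable M"
    using st by auto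
  have "distr M borel (\<lambda>\<omega>. D (s + (t - s)) \<omega> - D s \<omega>) = distr M borel (D (t - s))"
    using levy st unfolding levy_process_def by (metis diff_ge_0_iff_ge)
  then have eq: "distr M borel (\<lambda>\<omega>. D t \<omega> - D s \<omega>) = distr M borel (D (t - s))"
    by simp
  have "expectation (\<lambda>\<omega>. exp (- (z * (D t \<omega> - D s \<omega>)))) = (\<integral>x. exp (- (z * x)) \<partial>distr M borel (\<lambda>\<omega>. D t \<omega> - D s \<omega>))"
    by (subst integral_distr) auto
  also have "\<dots> = expectation (\<lambda>\<omega>. exp (- (z * D (t - s) \<omega>)))"
    unfolding eq by (subst integral_distr) auto
  also have "\<dots> = exp (- ((t - s) * \<phi> z))"
  proof -
    have "0 \<le> t - s" using st by simp
    from \<phi>[OF this z] show ?thesis by (simp only: mult_minus_left)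
  qed
  finally show ?thesis .
qed

text \<open>The increment for \<open>j = 0\<close> vanishes because \<open>0 - 1 = 0\<close> on
  naturals, so \<open>m\<close> independent increments of length \<open>h\<close> remain and the
  indices on the right are shifted by one.\<close>

lemma levy_grid_laplace:
  assumes levy: "levy_process M D"
    and \<phi>: "\<And>t z. 0 \<le> t \<Longrightarrow> 0 < z \<Longrightarrow> expectation (\<lambda>\<omega>. exp (- z * D t \<omega>)) = exp (- t * \<phi> z)"
    and mono: "AE \<omega> in M. \<forall>s t. 0 \<le> s \<and> s \<le> t \<longrightarrow> D s \<omega> \<le> D t \<omega>"
    and h: "0 < h" and u: "\<And>i. 0 < u i"
  shows "expectation (\<lambda>\<omega>. \<Prod>j\<le>m. exp (- (u j * (D (real j * h) \<omega> - D (real (j - 1) * h) \<omega>)))) = (\<Prod>j<m. exp (- (h * \<phi> (u (Suc j)))))"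
proof -
  have Dm: "D t \<in> borel_measurable M" if "0 \<le> t" for t
    using levy that by (simp add: levy_process_def)
  let ?X = "\<lambda>i \<omega>. D (real (Suc i) * h) \<omega> - D (real i * h) \<omega>"
  let ?Y = "\<lambda>i \<omega>. exp (- (u (Suc i) * ?X i \<omega>))"
  have Xm: "?X i \<in> borel_measurable M" for i
    using h by (intro borel_measurable_diff Dm) auto
  have "indep_vars (\<lambda>_. borel) ?X {..<m}"
    using levy h unfolding levy_process_def by (elim conjE allE[of _ m] allE[of _ "\<lambda>i. real i * h"]) auto
  then have ind: "indep_vars (\<lambda>_. borel) ?Y {..<m}"
    by (rule indep_vars_compose2[of _ _ _ "\<lambda>i x. exp (- (u (Suc i) * x))"]) auto
  have int: "integrable M (?Y i)" for i
  proof (rule integrable_const_bound[where B = 1])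
    show "AE \<omega> in M. norm (?Y i \<omega>) \<le> 1"
      using mono
    proof eventually_elim
      case (elim \<omega>)
      have "real i * h \<le> real (Suc i) * h" using h by (intro mult_right_mono) auto
      then have "0 \<le> ?X i \<omega>" using elim h by simp
      then show ?case using u[of "Suc i"] by simp
    qed
  qed (use Xm in measurable)
  have "expectation (\<lambda>\<omega>. \<Prod>j\<le>m. exp (- (u j * (D (real j * h) \<omega> - D (real (j - 1) * h) \<omega>)))) = expectation (\<lambda>\<omega>. \<Prod>i<m. ?Y i \<omega>)"
    by (simp add: prod.atMost_shift del: of_nat_Suc)
  also have "\<dots> = (\<Prod>i<m. expectation (?Y i))"
    by (rule indep_vars_lebesgue_integral[OF _ ind int]) simp
  also have "\<dots> = (\<Prod>i<m. exp (- (h * \<phi> (u (Suc i)))))"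
  proof (rule prod.cong[OF refl])
    fix i
    have "real i * h \<le> real (Suc i) * h" using h by (intro mult_right_mono) auto
    moreover have "real (Suc i) * h - real i * h = h" by (simp add: algebra_simps)
    ultimately show "expectation (?Y i) = exp (- (h * \<phi> (u (Suc i))))"
      using levy_increment_laplace[OF levy \<phi>, of "real i * h" "real (Suc i) * h" "u (Suc i)"] h u by simp
  qed
  finally show ?thesis .
qed

text \<open>The event \<open>D s = D t\<close> has probability at most
  \<open>exp (- ((t - s) * \<phi> z))\<close> for all \<open>z > 0\<close>, hence 0; by monotonicity
  rational pairs suffice. Boundedness by a constant is excluded by the exponential Markov inequality
  at argument 1 along integer times.\<close>

lemma levy_strict_path:
  assumes levy: "levy_process M D"
    and \<phi>: "\<And>t z. 0 \<le> t \<Longrightarrow> 0 < z \<Longrightarrow> expectation (\<lambda>\<omega>. exp (- z * D t \<omega>)) = exp (- t * \<phi> z)"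
    and mono: "AE \<omega> in M. \<forall>s t. 0 \<le> s \<and> s \<le> t \<longrightarrow> D s \<omega> \<le> D t \<omega>"
    and top: "filterlim \<phi> at_top at_top" and phi1: "0 < \<phi> 1"
  shows "AE \<omega> in M. strict_path (\<lambda>t. D t \<omega>)"
proof -
  have Dm: "D t \<in> borel_measurable M" if "0 \<le> t" for t
    using levy that by (simp add: levy_process_def)
  have neq: "AE \<omega> in M. D s \<omega> \<noteq> D t \<omega>" if st: "0 \<le> s" "s < t" for s t
  proof -
    have [measurable]: "D s \<in> borel_measurable M" "D t \<in> borel_measurable M" using st by (auto intro: Dm)
    have le: "prob {\<omega>\<in>space M. D s \<omega> = D t \<omega>} \<le> exp (- ((t - s) * \<phi> z))" if z: "0 < z" for z
    proof -
      have "prob {\<omega>\<in>space M. D s \<omega> = D t \<omega>} = expectation (indicator {\<omega>\<in>space M. D s \<omega> = D t \<omega>})"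
        by simp
      also have "\<dots> \<le> expectation (\<lambda>\<omega>. exp (- (z * (D t \<omega> - D s \<omega>))))"
      proof (rule integral_mono)
        show "integrable M (\<lambda>\<omega>. exp (- (z * (D t \<omega> - D s \<omega>))))"
          by (rule integrable_const_bound[where B = 1]) (use mono st z in \<open>auto elim!: eventually_mono\<close>)
        show "integrable M (indicator {\<omega>\<in>space M. D s \<omega> = D t \<omega>} :: _ \<Rightarrow> real)"
          by (intro integrable_real_indicator) (auto simp: less_top[symmetric])
      qed (auto simp: indicator_def)
      also have "\<dots> = exp (- ((t - s) * \<phi> z))"
        using st z by (intro levy_increment_laplace[OF levy \<phi>]) auto
      finally show ?thesis .
    qed
    have "filterlim (\<lambda>z. (t - s) * \<phi> z) at_top at_top"
      using st top by (intro filterlim_tendsto_pos_mult_at_top[OF tendsto_const]) auto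
    then have "filterlim (\<lambda>z. - ((t - s) * \<phi> z)) at_bot at_top"
      by (simp add: filterlim_uminus_at_bot)
    then have "((\<lambda>z. exp (- ((t - s) * \<phi> z))) \<longlongrightarrow> 0) at_top"
      by (rule filterlim_compose[OF exp_at_bot])
    moreover have "\<forall>\<^sub>F z in at_top. prob {\<omega>\<in>space M. D s \<omega> = D t \<omega>} \<le> exp (- ((t - s) * \<phi> z))"
      using eventually_gt_at_top[of 0] by eventually_elim (rule le)
    ultimately have "prob {\<omega>\<in>space M. D s \<omega> = D t \<omega>} \<le> 0"
      by (intro tendsto_lowerbound) auto
    then have "prob {\<omega>\<in>space M. D s \<omega> = D t \<omega>} = 0"
      using measure_nonneg antisym by blast
    then show ?thesis
      by (subst (asm) prob_eq_0) (auto elim!: eventually_mono)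
  qed
  have unb: "AE \<omega> in M. \<exists>n. real K < D (real n) \<omega>" for K :: nat
  proof -
    have [measurable]: "D (real n) \<in> borel_measurable M" for n by (rule Dm) simp
    let ?B = "{\<omega>\<in>space M. \<forall>n. D (real n) \<omega> \<le> real K}"
    have le: "prob ?B \<le> exp (real K) * exp (- (real n * \<phi> 1))" for n
    proof -
      \<comment> \<open>A non-integrable function has integral 0 by convention, whereas the given
        value is positive.\<close>
      have int: "integrable M (\<lambda>\<omega>. exp (- 1 * D (real n) \<omega>))"
      proof (rule ccontr)
        assume "\<not> integrable M (\<lambda>\<omega>. exp (- 1 * D (real n) \<omega>))"
        then have "expectation (\<lambda>\<omega>. exp (- 1 * D (real n) \<omega>)) = 0" by (rule not_integrable_integral_eq)
        then show False using \<phi>[of "real n" 1] by simp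
      qed
      have "prob ?B = expectation (indicator ?B)" by simp
      also have "\<dots> \<le> expectation (\<lambda>\<omega>. exp (real K) * exp (- 1 * D (real n) \<omega>))"
      proof (rule integral_mono)
        show "indicator ?B \<omega> \<le> exp (real K) * exp (- 1 * D (real n) \<omega>)" for \<omega>
          by (auto simp: indicator_def exp_add[symmetric])
        show "integrable M (indicator ?B :: _ \<Rightarrow> real)"
          by (intro integrable_real_indicator) (auto simp: less_top[symmetric])
      qed (use int in auto)
      also have "\<dots> = exp (real K) * exp (- (real n * \<phi> 1))"
        using \<phi>[of "real n" 1] by simp
      finally show ?thesis .
    qed
    have lim: "(\<lambda>n. exp (real K) * exp (- (real n * \<phi> 1))) \<longlonglongrightarrow> 0"
      using phi1 by real_asymp
    have "prob ?B \<le> 0"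
      by (rule tendsto_lowerbound[OF lim always_eventually[OF allI[OF le]]]) simp
    then have "prob ?B = 0"
      using measure_nonneg antisym by blast
    then show ?thesis
      by (subst (asm) prob_eq_0) (auto elim!: eventually_mono simp: not_le)
  qed
  have "AE \<omega> in M. \<forall>s\<in>{s\<in>\<rat>. 0 \<le> s}. \<forall>t\<in>{t\<in>\<rat>. s < t}. D s \<omega> \<noteq> D t \<omega>"
    using neq by (intro AE_ball_countable[THEN iffD2] ballI countable_subset[OF _ countable_rat]) auto
  moreover have "AE \<omega> in M. \<forall>K::nat. \<exists>n. real K < D (real n) \<omega>"
    using unb by (simp add: AE_all_countable)
  moreover have "AE \<omega> in M. D 0 \<omega> = 0" "AE \<omega> in M. cadlag (\<lambda>t. D t \<omega>)"
    using levy by (simp_all add: levy_process_def)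
  ultimately show ?thesis
    using mono
  proof eventually_elim
    case (elim \<omega>)
    show ?case
    proof
      fix s t :: real assume st: "0 \<le> s" "s < t"
      obtain q where q: "q \<in> \<rat>" "s < q" "q < t" using Rats_dense_in_real[OF st(2)] by blast
      obtain r where r: "r \<in> \<rat>" "q < r" "r < t" using Rats_dense_in_real[OF q(3)] by blast
      have "D q \<omega> \<noteq> D r \<omega>" using elim(1) q r st by auto
      moreover have "D s \<omega> \<le> D q \<omega>" "D q \<omega> \<le> D r \<omega>" "D r \<omega> \<le> D t \<omega>"
        using elim(5) q r st by auto
      ultimately show "D s \<omega> < D t \<omega>" by linarith
    next
      show "D 0 \<omega> = 0" by (rule elim)
    next
      fix s :: real assume "0 \<le> s"
      then show "((\<lambda>t. D t \<omega>) \<longlongrightarrow> D s \<omega>) (at_right s)"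
        using elim(4) by (simp add: cadlag_def)
    next
      fix K :: real
      obtain k :: nat where "K \<le> real k" using real_arch_simple by blast
      moreover obtain n where "real k < D (real n) \<omega>" using elim(2) by blast
      ultimately show "\<exists>s\<ge>0. K < D s \<omega>" by (intro exI[of _ "real n"]) auto
    qed
  qed
qed

end

text \<open>\<open>D\<close> itself need not be measurable for the sigma-algebra of its inverse. A
  version \<open>D'\<close> rebuilt from the inverse is, and it agrees with \<open>D\<close> at all
  times almost surely; independence is applied to \<open>D'\<close> and the outcome carried back to
  \<open>D\<close>.\<close>

lemma subordinated_factor:
  assumes M: "prob_space M"
    and levy: "levy_process M D"
    and \<phi>: "\<And>t z. 0 \<le> t \<Longrightarrow> 0 < z \<Longrightarrow> prob_space.expectation M (\<lambda>\<omega>. exp (- z * D t \<omega>)) = exp (- t * \<phi> z)"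
    and mono: "AE \<omega> in M. \<forall>s t. 0 \<le> s \<and> s \<le> t \<longrightarrow> D s \<omega> \<le> D t \<omega>"
    and strict: "AE \<omega> in M. strict_path (\<lambda>t. D t \<omega>)"
    and ind: "indep_processes (completion M) (count_space UNIV) Q borel (inverse_process D)"
    and h: "0 < h" and u: "\<And>i. 0 < u i"
  shows "(\<integral>\<omega>. (\<Prod>j\<le>m. exp (- (u j * (D (real j * h) \<omega> - D (real (j - 1) * h) \<omega>)))) * indicator A (grid_path Q h (Suc m) \<omega>) \<partial>completion M)
       = (\<Prod>j<m. exp (- (h * \<phi> (u (Suc j))))) * measure (completion M) {\<omega>\<in>space (completion M). grid_path (Q :: real \<Rightarrow> 'w \<Rightarrow> nat \<times> nat) h (Suc m) \<omega> \<in> A}"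
proof -
  interpret M: prob_space M by (rule M)
  interpret N: prob_space "completion M" by (rule M.prob_space_completion)
  let ?N = "completion M"
  let ?FQ = "path_algebra ?N (count_space UNIV) Q" and ?FY = "path_algebra ?N borel (inverse_process D)"
  have Qm: "Q t \<in> measurable ?N (count_space UNIV)" and Ym: "inverse_process D t \<in> borel_measurable ?N" if "0 \<le> t" for t
    using ind that by (auto simp: indep_processes_def)
  have Dm: "D t \<in> borel_measurable M" if "0 \<le> t" for t
    using levy that by (simp add: levy_process_def)
  define D' where "D' s \<omega> = real_of_ereal (INF q\<in>{q\<in>\<rat>. 0 < q}. if s < inverse_process D q \<omega> then ereal q else \<infinity>)" for s \<omega>
  have D'm: "D' s \<in> borel_measurable ?FY" for s
  proof -
    have [measurable]: "inverse_process D q \<in> borel_measurable ?FY" if "0 < q" for q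
      using Ym that by (intro measurable_path_algebra) auto
    have "(\<lambda>\<omega>. INF q\<in>{q\<in>\<rat>. 0 < q}. if s < inverse_process D q \<omega> then ereal q else \<infinity>) \<in> borel_measurable ?FY"
    proof (rule borel_measurable_INF)
      show "countable {q::real. q \<in> \<rat> \<and> 0 < q}" by (rule countable_subset[OF _ countable_rat]) auto
      fix q :: real assume "q \<in> {q\<in>\<rat>. 0 < q}"
      then have [measurable]: "inverse_process D q \<in> borel_measurable ?FY" by simp
      show "(\<lambda>\<omega>. if s < inverse_process D q \<omega> then ereal q else \<infinity>) \<in> borel_measurable ?FY" by measurable
    qed
    then show ?thesis unfolding D'_def by measurable
  qed
  have DD': "AE \<omega> in ?N. \<forall>s\<ge>0. D' s \<omega> = D s \<omega>"
    using AE_completion[OF strict]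
  proof eventually_elim
    case (elim \<omega>)
    then show ?case
      using strict_path.path_from_inverse[OF elim] by (simp add: D'_def inverse_process_def[abs_def])
  qed
  define E where "E = {\<omega>\<in>space ?N. grid_path Q h (Suc m) \<omega> \<in> A}"
  define g where "g \<omega> = (\<Prod>j\<le>m. exp (- (u j * (D' (real j * h) \<omega> - D' (real (j - 1) * h) \<omega>))))" for \<omega>
  define g0 where "g0 \<omega> = (\<Prod>j\<le>m. exp (- (u j * (D (real j * h) \<omega> - D (real (j - 1) * h) \<omega>))))" for \<omega>
  have E: "E \<in> sets ?FQ"
  proof -
    have Qj: "Q (real j * h) \<in> measurable ?FQ (count_space UNIV)" for j
      using Qm h by (intro measurable_path_algebra) auto
    have l: "{\<omega>\<in>space ?FQ. grid_path Q h (Suc m) \<omega> = l} \<in> sets ?FQ" for l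
      unfolding grid_path_eq_iff using Qj by measurable
    have "E = (\<Union>l\<in>A. {\<omega>\<in>space ?FQ. grid_path Q h (Suc m) \<omega> = l})"
      by (auto simp: E_def)
    also have "\<dots> \<in> sets ?FQ"
      using l by (intro sets.countable_UN'') auto
    finally show ?thesis .
  qed
  have gm: "g \<in> borel_measurable ?FY"
    unfolding g_def using D'm by measurable
  have g0m: "g0 \<in> borel_measurable M"
  proof -
    have [measurable]: "(\<lambda>\<omega>. D (real j * h) \<omega> - D (real (j - 1) * h) \<omega>) \<in> borel_measurable M" for j
      using h by (intro borel_measurable_diff Dm) auto
    show ?thesis unfolding g0_def by measurable
  qed
  have g0b: "AE \<omega> in M. norm (g0 \<omega>) \<le> 1"
    using strict
  proof eventually_elim
    case (elim \<omega>)
    interpret strict_path "\<lambda>t. D t \<omega>" by (rule elim)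
    have "D (real (j - 1) * h) \<omega> \<le> D (real j * h) \<omega>" for j
      using h by (intro mono mult_right_mono) auto
    then have "g0 \<omega> \<le> 1" "0 \<le> g0 \<omega>"
      unfolding g0_def using less_imp_le[OF u] by (auto intro!: prod_le_1 prod_nonneg)
    then show ?case by simp
  qed
  have int0: "integrable ?N g0"
    by (rule N.integrable_const_bound[where B = 1]) (use AE_completion[OF g0b] measurable_completion[OF g0m] in auto)
  have gg0: "AE \<omega> in ?N. g0 \<omega> = g \<omega>"
    using DD' by eventually_elim (use h in \<open>simp add: g_def g0_def\<close>)
  have FYN: "sets ?FY \<subseteq> sets ?N" "sets ?FQ \<subseteq> sets ?N"
    using ind by (simp_all add: indep_processes_def path_algebra_def N.indep_sets2_eq)
  have gN: "g \<in> borel_measurable ?N"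
  proof (rule measurableI)
    fix C :: "real set" assume "C \<in> sets borel"
    then show "g -` C \<inter> space ?N \<in> sets ?N"
      using measurable_sets[OF gm, of C] FYN by auto
  qed simp
  have intg: "integrable ?N g"
    using int0 gg0 gN measurable_completion[OF g0m] by (subst integrable_cong_AE[of _ _ g0]) auto
  have "(\<integral>\<omega>. g0 \<omega> * indicator A (grid_path Q h (Suc m) \<omega>) \<partial>?N) = (\<integral>\<omega>. indicator E \<omega> * g0 \<omega> \<partial>?N)"
    by (intro Bochner_Integration.integral_cong) (auto simp: E_def indicator_def)
  also have "\<dots> = (\<integral>\<omega>. indicator E \<omega> * g \<omega> \<partial>?N)"
    using gg0 gN measurable_completion[OF g0m] E FYN
    by (intro integral_cong_AE) (auto elim!: eventually_mono)
  also have "\<dots> = N.prob E * (\<integral>\<omega>. g \<omega> \<partial>?N)"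
    by (rule N.indep_processes_integral[OF ind E gm intg])
  also have "(\<integral>\<omega>. g \<omega> \<partial>?N) = (\<integral>\<omega>. g0 \<omega> \<partial>?N)"
    using gg0 gN measurable_completion[OF g0m] by (intro integral_cong_AE) (auto elim!: eventually_mono)
  also have "\<dots> = (\<integral>\<omega>. g0 \<omega> \<partial>M)"
    by (rule integral_completion[OF g0m])
  also have "\<dots> = (\<Prod>j<m. exp (- (h * \<phi> (u (Suc j)))))"
    unfolding g0_def by (rule M.levy_grid_laplace[OF levy \<phi> mono h u])
  finally show ?thesis
    unfolding g0_def E_def by (simp only: mult.commute)
qed

section \<open>The law of the inter-arrival times\<close>

declare nth_arrival_time.simps(2) [simp del]

text \<open>Preimages under \<open>f\<close> and \<open>g\<close> differ by a null set, which is
  measurable by completeness. Functionals of arrival times, known only as almost everywhere limits,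
  become measurable in this way.\<close>

lemma (in complete_measure) borel_measurable_AE_eq:
  fixes f g :: "'a \<Rightarrow> 'b::topological_space"
  assumes f: "f \<in> borel_measurable M" and eq: "AE x in M. f x = g x"
  shows "g \<in> borel_measurable M"
proof (rule measurableI)
  fix A :: "'b set" assume A: "A \<in> sets borel"
  show "g -` A \<inter> space M \<in> sets M"
  proof (rule in_sets_AE)
    show "f -` A \<inter> space M \<in> sets M" using f A by (rule measurable_sets)
    show "AE x in M. (x \<in> f -` A \<inter> space M) = (x \<in> g -` A \<inter> space M)"
      using eq by eventually_elim auto
  qed auto
qed simp

lemma strict_path_increment_nonneg:
  "strict_path d \<Longrightarrow> 0 \<le> h \<Longrightarrow> 0 \<le> d (real j * h) - d (real (j - 1) * h)"
  using strict_path.mono[of d "real (j - 1) * h" "real j * h"] by (simp add: mult_right_mono)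

lemma grid_count_le: "grid_count Q h m \<omega> \<le> m"
proof -
  have "grid_count Q h m \<omega> \<le> card {..<m}"
    unfolding grid_count_def by (intro card_mono) auto
  then show ?thesis by simp
qed

lemma grid_arrival_grid_path:
  "grid_arrival Q h m \<omega> \<longleftrightarrow> fst (grid_path Q h (Suc m) \<omega> ! Suc m) = fst (grid_path Q h (Suc m) \<omega> ! m) + 1"
  using grid_path_eq_iff[of Q h "Suc m" \<omega> "grid_path Q h (Suc m) \<omega>"]
  by (simp add: grid_arrival_def del: of_nat_Suc)

section \<open>Passage from the grid to the joint transform\<close>

text \<open>What the limit argument uses of the model. Services no longer appear: the queue enters
  through the bounds per step, with error constant \<open>K\<close> and largest mesh
  \<open>h0\<close>, and independence through \<open>factor\<close>.\<close>

locale subordinated_arrivals = prob_space N for N :: "'w measure" +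
  fixes Q :: "real \<Rightarrow> 'w \<Rightarrow> nat \<times> nat" and D :: "real \<Rightarrow> 'w \<Rightarrow> real"
    and lam K h0 :: real and \<phi> :: "real \<Rightarrow> real"
  assumes complete: "complete_measure N"
    and lam: "0 < lam" and K: "0 \<le> K" and h0: "0 < h0"
    and Qm: "\<And>t. 0 \<le> t \<Longrightarrow> Q t \<in> measurable N (count_space UNIV)"
    and Qc: "AE \<omega> in N. cadlag (\<lambda>t. Q t \<omega>)"
    and step_lower: "\<And>h m l. 0 < h \<Longrightarrow> h < h0 \<Longrightarrow>
      (lam * h - K * h\<^sup>2) * prob {\<omega>\<in>space N. grid_path Q h m \<omega> = l} \<le> prob {\<omega>\<in>space N. grid_path Q h m \<omega> = l \<and> grid_arrival Q h m \<omega>}"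
    and step_upper: "\<And>h m l. 0 < h \<Longrightarrow> h < h0 \<Longrightarrow>
      prob {\<omega>\<in>space N. grid_path Q h m \<omega> = l \<and> grid_arrival Q h m \<omega>} \<le> (lam * h + K * h\<^sup>2) * prob {\<omega>\<in>space N. grid_path Q h m \<omega> = l}"
    and Dm: "\<And>t. 0 \<le> t \<Longrightarrow> D t \<in> borel_measurable N"
    and Ds: "AE \<omega> in N. strict_path (\<lambda>t. D t \<omega>)"
    and factor: "\<And>h m A (u :: nat \<Rightarrow> real). 0 < h \<Longrightarrow> (\<And>i. 0 < u i) \<Longrightarrow>
      (\<integral>\<omega>. (\<Prod>j\<le>m. exp (- (u j * (D (real j * h) \<omega> - D (real (j - 1) * h) \<omega>)))) * indicator A (grid_path Q h (Suc m) \<omega>) \<partial>N)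
       = (\<Prod>j<m. exp (- (h * \<phi> (u (Suc j))))) * prob {\<omega>\<in>space N. grid_path Q h (Suc m) \<omega> \<in> A}"
    and phi0: "\<phi> 0 = 0" and phi_pos: "\<And>x. 0 < x \<Longrightarrow> 0 < \<phi> x"
    and phi_mono: "\<And>x y. 0 \<le> x \<Longrightarrow> x \<le> y \<Longrightarrow> \<phi> x \<le> \<phi> y"
    and phi_cont: "continuous_on {0..} \<phi>"
begin

lemma measurable_increment:
  assumes "0 < h"
  shows "(\<lambda>\<omega>. D (real j * h) \<omega> - D (real (j - 1) * h) \<omega>) \<in> borel_measurable N"
  using assms by (intro borel_measurable_diff Dm) auto

lemma grid_sum_measurable:
  assumes h: "0 < h"
  shows "(\<lambda>\<omega>. grid_sum Q (\<lambda>t. D t \<omega>) z h m \<omega>) \<in> borel_measurable N"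
proof -
  have [measurable]: "(\<lambda>\<omega>. z (grid_count Q h j \<omega>)) \<in> borel_measurable N" for j
    by (rule measurable_compose[OF measurable_grid_count[OF Qm]]) (use h in auto)
  show ?thesis
    unfolding grid_sum_def
    by (intro borel_measurable_sum borel_measurable_times measurable_increment[OF h]) measurable
qed

lemma grid_term_measurable:
  assumes h: "0 < h"
  shows "(\<lambda>\<omega>. grid_term Q (\<lambda>t. D t \<omega>) z n h m \<omega>) \<in> borel_measurable N"
proof -
  note [measurable] = pred_grid_arrival[OF Qm less_imp_le[OF h]] measurable_grid_count[OF Qm less_imp_le[OF h]]
    grid_sum_measurable[OF h]
  show ?thesis unfolding grid_term_def by measurable
qed

lemma grid_term_bounds:
  assumes h: "0 < h" and z: "\<And>i. 0 \<le> z i"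
  shows "AE \<omega> in N. \<forall>m. 0 \<le> grid_term Q (\<lambda>t. D t \<omega>) z n h m \<omega> \<and> grid_term Q (\<lambda>t. D t \<omega>) z n h m \<omega> \<le> 1"
  using Ds
proof eventually_elim
  case (elim \<omega>)
  have "0 \<le> grid_sum Q (\<lambda>t. D t \<omega>) z h m \<omega>" for m
    unfolding grid_sum_def using strict_path_increment_nonneg[OF elim less_imp_le[OF h]] z
    by (intro sum_nonneg mult_nonneg_nonneg)
  then show ?case by (auto simp: grid_term_def of_bool_def)
qed

text \<open>The argument \<open>z\<close> attached to a step depends on the random level. Fixing the
  whole sequence of levels makes the arguments deterministic, so \<open>factor\<close> applies. No
  increment precedes grid point 0, and \<open>exp (h * \<phi> (z 0))\<close> compensates the factor
  for \<open>j = 0\<close> that is included in the product.\<close>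

lemma integral_grid_term:
  assumes h: "0 < h" and z: "\<And>i. 0 < z i"
  shows "(\<integral>\<omega>. grid_term Q (\<lambda>t. D t \<omega>) z n h m \<omega> \<partial>N)
    = exp (h * \<phi> (z 0)) * (\<integral>\<omega>. (\<Prod>j\<le>m. exp (- (h * \<phi> (z (grid_count Q h j \<omega>))))) * of_bool (grid_count Q h m \<omega> = n \<and> grid_arrival Q h m \<omega>) \<partial>N)"
proof -
  let ?c = "\<lambda>\<omega> j. grid_count Q h j \<omega>" and ?d = "\<lambda>\<omega> j. D (real j * h) \<omega> - D (real (j - 1) * h) \<omega>"
  \<comment> \<open>A count at step \<open>j\<close> is at most \<open>j\<close>, so sequences of
    levels with values up to \<open>m\<close> suffice, and there are finitely many.\<close>
  define C where "C = PiE {..m} (\<lambda>_. {..m})"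
  have finC: "finite C" unfolding C_def by (intro finite_PiE) auto
  define A where "A c = {l. (\<forall>j\<le>m. list_count l j = c j) \<and> c m = n \<and> fst (l ! Suc m) = fst (l ! m) + 1}" for c
  have A: "grid_path Q h (Suc m) \<omega> \<in> A c \<longleftrightarrow> (\<forall>j\<le>m. ?c \<omega> j = c j) \<and> c m = n \<and> grid_arrival Q h m \<omega>" for c \<omega>
    unfolding A_def mem_Collect_eq grid_arrival_grid_path[of Q h m \<omega>] by (simp add: list_count_grid_path)
  define V where "V \<omega> = restrict (?c \<omega>) {..m}" for \<omega>
  have V: "V \<omega> \<in> C" for \<omega>
    unfolding V_def C_def using grid_count_le[of Q h _ \<omega>] by (auto intro: order_trans)
  have Veq: "(\<forall>j\<le>m. ?c \<omega> j = c j) \<longleftrightarrow> c = V \<omega>" if "c \<in> C" for c \<omega>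
  proof
    assume "\<forall>j\<le>m. ?c \<omega> j = c j"
    then show "c = V \<omega>"
      using that unfolding C_def V_def by (intro PiE_ext[of c "{..m}" "\<lambda>_. {..m}"] V[unfolded C_def V_def]) auto
  qed (simp add: V_def)
  have decomp: "f (?c \<omega>) \<omega> * of_bool (?c \<omega> m = n \<and> grid_arrival Q h m \<omega>) = (\<Sum>c\<in>C. f c \<omega> * indicator (A c) (grid_path Q h (Suc m) \<omega>))"
    if f: "\<And>c c' \<omega>. (\<And>j. j \<le> m \<Longrightarrow> c j = c' j) \<Longrightarrow> f c \<omega> = f c' \<omega>" for f :: "(nat \<Rightarrow> nat) \<Rightarrow> 'w \<Rightarrow> real" and \<omega>
  proof -
    have "(\<Sum>c\<in>C. f c \<omega> * indicator (A c) (grid_path Q h (Suc m) \<omega>))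
       = (\<Sum>c\<in>C. if c = V \<omega> then f c \<omega> * of_bool (c m = n \<and> grid_arrival Q h m \<omega>) else 0)"
      using Veq by (intro sum.cong) (auto simp: indicator_def A)
    also have "\<dots> = f (V \<omega>) \<omega> * of_bool (V \<omega> m = n \<and> grid_arrival Q h m \<omega>)"
      using finC V by simp
    also have "f (V \<omega>) \<omega> = f (?c \<omega>) \<omega>" by (rule f) (simp add: V_def)
    finally show ?thesis by (simp add: V_def)
  qed
  note [measurable] = measurable_increment[OF h] pred_grid_arrival[OF Qm less_imp_le[OF h]] measurable_grid_count[OF Qm less_imp_le[OF h]]
  have [measurable]: "Measurable.pred N (\<lambda>\<omega>. grid_path Q h (Suc m) \<omega> \<in> A c)" for c
    unfolding A by measurable
  have ind: "(\<lambda>\<omega>. indicator (A c) (grid_path Q h (Suc m) \<omega>) :: real) = (\<lambda>\<omega>. of_bool (grid_path Q h (Suc m) \<omega> \<in> A c))" for c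
    by (simp add: indicator_def of_bool_def fun_eq_iff)
  have [measurable]: "(\<lambda>\<omega>. indicator (A c) (grid_path Q h (Suc m) \<omega>) :: real) \<in> borel_measurable N" for c
    unfolding ind by measurable
  have int_ind: "integrable N (\<lambda>\<omega>. indicator (A c) (grid_path Q h (Suc m) \<omega>) :: real)" for c
    by (rule integrable_const_bound[where B = 1]) (auto simp: indicator_def)
  have prob_A: "(\<integral>\<omega>. (indicator (A c) (grid_path Q h (Suc m) \<omega>) :: real) \<partial>N) = prob {\<omega>\<in>space N. grid_path Q h (Suc m) \<omega> \<in> A c}" for c
  proof -
    have "(\<integral>\<omega>. (indicator (A c) (grid_path Q h (Suc m) \<omega>) :: real) \<partial>N) = (\<integral>\<omega>. indicator {\<omega>\<in>space N. grid_path Q h (Suc m) \<omega> \<in> A c} \<omega> \<partial>N)"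
      by (intro Bochner_Integration.integral_cong) (auto simp: indicator_def)
    then show ?thesis by simp
  qed
  have int1: "integrable N (\<lambda>\<omega>. (\<Prod>j\<le>m. exp (- (z (c j) * ?d \<omega> j))) * indicator (A c) (grid_path Q h (Suc m) \<omega>))" for c
  proof (rule integrable_const_bound[where B = 1])
    show "AE \<omega> in N. norm ((\<Prod>j\<le>m. exp (- (z (c j) * ?d \<omega> j))) * indicator (A c) (grid_path Q h (Suc m) \<omega>)) \<le> 1"
      using Ds
    proof eventually_elim
      case (elim \<omega>)
      have "(\<Prod>j\<le>m. exp (- (z (c j) * ?d \<omega> j))) \<le> 1"
        using strict_path_increment_nonneg[OF elim less_imp_le[OF h]] less_imp_le[OF z]
        by (intro prod_le_1) auto
      then show ?case by (auto simp: indicator_def abs_prod)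
    qed
  qed measurable
  have "(\<integral>\<omega>. grid_term Q (\<lambda>t. D t \<omega>) z n h m \<omega> \<partial>N)
      = (\<integral>\<omega>. (\<Sum>c\<in>C. (\<Prod>j\<le>m. exp (- (z (c j) * ?d \<omega> j))) * indicator (A c) (grid_path Q h (Suc m) \<omega>)) \<partial>N)"
  proof (intro Bochner_Integration.integral_cong refl)
    fix \<omega>
    have "grid_term Q (\<lambda>t. D t \<omega>) z n h m \<omega> = (\<Prod>j\<le>m. exp (- (z (?c \<omega> j) * ?d \<omega> j))) * of_bool (?c \<omega> m = n \<and> grid_arrival Q h m \<omega>)"
      unfolding grid_term_def grid_sum_def sum_negf[symmetric] by (simp add: exp_sum)
    also have "\<dots> = (\<Sum>c\<in>C. (\<Prod>j\<le>m. exp (- (z (c j) * ?d \<omega> j))) * indicator (A c) (grid_path Q h (Suc m) \<omega>))"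
      by (rule decomp[of "\<lambda>c \<omega>. \<Prod>j\<le>m. exp (- (z (c j) * ?d \<omega> j))"]) (auto intro!: prod.cong)
    finally show "grid_term Q (\<lambda>t. D t \<omega>) z n h m \<omega> = (\<Sum>c\<in>C. (\<Prod>j\<le>m. exp (- (z (c j) * ?d \<omega> j))) * indicator (A c) (grid_path Q h (Suc m) \<omega>))" .
  qed
  also have "\<dots> = (\<Sum>c\<in>C. (\<Prod>j<m. exp (- (h * \<phi> (z (c (Suc j)))))) * prob {\<omega>\<in>space N. grid_path Q h (Suc m) \<omega> \<in> A c})"
    unfolding Bochner_Integration.integral_sum[OF int1]
    by (intro sum.cong refl factor[OF h, of "\<lambda>j. z (_ j)"] z)
  also have "\<dots> = (\<Sum>c\<in>C. exp (h * \<phi> (z 0)) * ((\<Prod>j\<le>m. exp (- (h * \<phi> (z (c j))))) * (\<integral>\<omega>. indicator (A c) (grid_path Q h (Suc m) \<omega>) \<partial>N)))"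
  proof (rule sum.cong[OF refl])
    fix c assume "c \<in> C"
    show "(\<Prod>j<m. exp (- (h * \<phi> (z (c (Suc j)))))) * prob {\<omega>\<in>space N. grid_path Q h (Suc m) \<omega> \<in> A c}
      = exp (h * \<phi> (z 0)) * ((\<Prod>j\<le>m. exp (- (h * \<phi> (z (c j))))) * (\<integral>\<omega>. indicator (A c) (grid_path Q h (Suc m) \<omega>) \<partial>N))"
    \<comment> \<open>The count at step 0 is 0, so the other sequences belong to empty
      events.\<close>
    proof (cases "c 0 = 0")
      case True
      then have "exp (h * \<phi> (z 0)) * (\<Prod>j\<le>m. exp (- (h * \<phi> (z (c j))))) = (\<Prod>j<m. exp (- (h * \<phi> (z (c (Suc j))))))"
        by (simp add: prod.atMost_shift exp_minus)
      then show ?thesis by (simp only: prob_A mult.assoc[symmetric])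
    next
      case False
      then have "{\<omega>\<in>space N. grid_path Q h (Suc m) \<omega> \<in> A c} = {}"
        unfolding A by fastforce
      then show ?thesis unfolding prob_A by (simp only: measure_empty mult_zero_right)
    qed
  qed
  also have "\<dots> = exp (h * \<phi> (z 0)) * (\<integral>\<omega>. (\<Sum>c\<in>C. (\<Prod>j\<le>m. exp (- (h * \<phi> (z (c j))))) * indicator (A c) (grid_path Q h (Suc m) \<omega>)) \<partial>N)"
    by (subst Bochner_Integration.integral_sum) (auto simp: int_ind sum_distrib_left)
  also have "(\<integral>\<omega>. (\<Sum>c\<in>C. (\<Prod>j\<le>m. exp (- (h * \<phi> (z (c j))))) * indicator (A c) (grid_path Q h (Suc m) \<omega>)) \<partial>N)
     = (\<integral>\<omega>. (\<Prod>j\<le>m. exp (- (h * \<phi> (z (?c \<omega> j))))) * of_bool (?c \<omega> m = n \<and> grid_arrival Q h m \<omega>) \<partial>N)"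
    by (intro Bochner_Integration.integral_cong refl decomp[symmetric]) (auto intro!: prod.cong)
  finally show ?thesis .
qed

text \<open>Numerator and denominator are divided by \<open>h\<close>. The coefficient
  \<open>k\<close> disappears in the limit, so the bounds with \<open>K\<close> and with
  \<open>- K\<close> meet.\<close>

lemma success_ratio_tendsto:
  assumes c: "0 < c"
  shows "((\<lambda>h. exp (- (h * c)) * (lam * h + k * h\<^sup>2) / (1 - exp (- (h * c)) + exp (- (h * c)) * (lam * h + k * h\<^sup>2))) \<longlongrightarrow> lam / (lam + c)) (at_right 0)"
proof -
  have 1: "((\<lambda>h. exp (- (h * c)) * (lam + k * h)) \<longlongrightarrow> lam) (at_right 0)"
    by real_asymp
  have 2: "((\<lambda>h. (1 - exp (- (h * c))) / h) \<longlongrightarrow> c) (at_right 0)"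
    by real_asymp
  have "((\<lambda>h. (exp (- (h * c)) * (lam + k * h)) / ((1 - exp (- (h * c))) / h + exp (- (h * c)) * (lam + k * h))) \<longlongrightarrow> lam / (c + lam)) (at_right 0)"
    using c lam by (intro tendsto_divide tendsto_add 1 2) auto
  moreover have "\<forall>\<^sub>F h in at_right 0. (exp (- (h * c)) * (lam + k * h)) / ((1 - exp (- (h * c))) / h + exp (- (h * c)) * (lam + k * h))
     = exp (- (h * c)) * (lam * h + k * h\<^sup>2) / (1 - exp (- (h * c)) + exp (- (h * c)) * (lam * h + k * h\<^sup>2))"
    using eventually_at_right_less[of 0]
  proof eventually_elim
    case (elim h)
    have 1: "exp (- (h * c)) * (lam * h + k * h\<^sup>2) = h * (exp (- (h * c)) * (lam + k * h))"
      by (simp add: algebra_simps power2_eq_square)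
    have 2: "1 - exp (- (h * c)) + h * (exp (- (h * c)) * (lam + k * h)) = h * ((1 - exp (- (h * c))) / h + exp (- (h * c)) * (lam + k * h))"
      using elim by (simp add: distrib_left)
    show ?case
      unfolding 1 2 using elim by simp
  qed
  ultimately show ?thesis
    by (simp add: add.commute Lim_transform_eventually)
qed

definition laplace_functional :: "(nat \<Rightarrow> real) \<Rightarrow> nat \<Rightarrow> 'w \<Rightarrow> real" where
  "laplace_functional z n \<omega> = arrival_functional (\<lambda>t. Q t \<omega>) (\<lambda>t. D t \<omega>) z n"

definition step_size :: "nat \<Rightarrow> real" where
  "step_size k = 1 / real (Suc k)"

lemma step_size: "0 < step_size k" "step_size \<longlonglongrightarrow> 0" "filterlim step_size (at_right 0) sequentially"
proof -
  show pos: "0 < step_size k" for k by (simp add: step_size_def)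
  show lim: "step_size \<longlonglongrightarrow> 0"
    unfolding step_size_def using LIMSEQ_inverse_real_of_nat by (simp add: inverse_eq_divide)
  then show "filterlim step_size (at_right 0) sequentially"
    using pos by (intro tendsto_imp_filterlim_at_right) auto
qed

text \<open>\<open>K * h \<le> lam\<close> keeps the lower arrival probability nonnegative, and
  \<open>zmin\<close> bounds all weights of a step by \<open>exp (- (h * \<phi> zmin)) < 1\<close>,
  as the renewal inequality requires.\<close>

lemma grid_expectation_bounds:
  assumes h: "0 < h" "h < h0" and hK: "K * h \<le> lam" and zmin: "0 < zmin" "\<And>i. zmin \<le> z i"
  shows "exp (h * \<phi> (z 0)) * (\<Prod>i\<le>n. exp (- (h * \<phi> (z i))) * (lam * h + - K * h\<^sup>2) / (1 - exp (- (h * \<phi> (z i))) + exp (- (h * \<phi> (z i))) * (lam * h + - K * h\<^sup>2)))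
       \<le> (\<integral>\<omega>. (\<Sum>m. grid_term Q (\<lambda>t. D t \<omega>) z n h m \<omega>) \<partial>N)" (is "?lower \<le> ?E")
    and "(\<integral>\<omega>. (\<Sum>m. grid_term Q (\<lambda>t. D t \<omega>) z n h m \<omega>) \<partial>N)
       \<le> exp (h * \<phi> (z 0)) * (\<Prod>i\<le>n. exp (- (h * \<phi> (z i))) * (lam * h + K * h\<^sup>2) / (1 - exp (- (h * \<phi> (z i))) + exp (- (h * \<phi> (z i))) * (lam * h + K * h\<^sup>2)))" (is "?E \<le> ?upper")
proof -
  have z: "0 < z i" for i using zmin(1) zmin(2)[of i] by linarith
  let ?t = "\<lambda>m \<omega>. grid_term Q (\<lambda>t. D t \<omega>) z n h m \<omega>"
  let ?w = "\<lambda>i. exp (- (h * \<phi> (z i)))"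
  have \<alpha>: "0 \<le> lam * h - K * h\<^sup>2"
  proof -
    have "K * h * h \<le> lam * h" using h hK by (intro mult_right_mono) auto
    then show ?thesis by (simp add: power2_eq_square mult.assoc)
  qed
  have \<beta>: "0 \<le> lam * h + K * h\<^sup>2" using lam K h by (intro add_nonneg_nonneg mult_nonneg_nonneg) auto
  have w: "?w i \<le> exp (- (h * \<phi> zmin))" for i
    using phi_mono[of zmin "z i"] zmin h by (simp add: mult_left_mono)
  have v: "exp (- (h * \<phi> zmin)) < 1" using h phi_pos[OF zmin(1)] by simp
  obtain s where s: "(\<lambda>m. \<integral>\<omega>. (\<Prod>j\<le>m. ?w (grid_count Q h j \<omega>)) * of_bool (grid_count Q h m \<omega> = n \<and> grid_arrival Q h m \<omega>) \<partial>N) sums s"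
    and lower: "(\<Prod>i\<le>n. ?w i * (lam * h - K * h\<^sup>2) / (1 - ?w i + ?w i * (lam * h - K * h\<^sup>2))) \<le> s"
    and upper: "s \<le> (\<Prod>i\<le>n. ?w i * (lam * h + K * h\<^sup>2) / (1 - ?w i + ?w i * (lam * h + K * h\<^sup>2)))"
    using grid_renewal_bounds[of Q h "lam * h - K * h\<^sup>2" "lam * h + K * h\<^sup>2" ?w "exp (- (h * \<phi> zmin))" n,
        OF Qm less_imp_le[OF h(1)] step_lower[OF h] step_upper[OF h] \<alpha> \<beta> exp_ge_zero w v]
    by blast
  have int: "(\<lambda>m. \<integral>\<omega>. ?t m \<omega> \<partial>N) sums (exp (h * \<phi> (z 0)) * s)"
    unfolding integral_grid_term[OF h(1) z] by (rule sums_mult[OF s])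
  have nn: "0 \<le> ?t m \<omega>" for m \<omega> by (simp add: grid_term_def)
  have "(\<integral>\<omega>. (\<Sum>m. ?t m \<omega>) \<partial>N) = (\<Sum>m. \<integral>\<omega>. ?t m \<omega> \<partial>N)"
  proof (rule integral_suminf)
    show "integrable N (?t m)" for m
      using grid_term_bounds[of h z n, OF h(1) less_imp_le[OF z]]
      by (intro integrable_const_bound[where B = 1] grid_term_measurable h) (auto elim!: eventually_mono)
    show "AE \<omega> in N. summable (\<lambda>m. norm (?t m \<omega>))"
      using nn by (simp add: summable_grid_term)
    show "summable (\<lambda>m. \<integral>\<omega>. norm (?t m \<omega>) \<partial>N)"
      using nn sums_summable[OF int] by simp
  qed
  then have E: "?E = exp (h * \<phi> (z 0)) * s"
    using sums_unique[OF int] by simp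
  show "?lower \<le> ?E" "?E \<le> ?upper"
    unfolding E using lower upper by (auto intro!: mult_left_mono)
qed

lemma
  assumes zmin: "0 < zmin" "\<And>i. zmin \<le> z i"
  shows laplace_functional_measurable: "laplace_functional z n \<in> borel_measurable N"
    and laplace_functional_integral: "(\<integral>\<omega>. laplace_functional z n \<omega> \<partial>N) = (\<Prod>i\<le>n. lam / (lam + \<phi> (z i)))"
proof -
  interpret complete_measure N by (rule complete)
  have z: "0 < z i" for i using zmin(1) zmin(2)[of i] by linarith
  define G where "G k \<omega> = (\<Sum>m. grid_term Q (\<lambda>t. D t \<omega>) z n (step_size k) m \<omega>)" for k \<omega>
  have Gm[measurable]: "G k \<in> borel_measurable N" for k
    unfolding G_def by (intro borel_measurable_suminf grid_term_measurable step_size)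
  have lim: "AE \<omega> in N. (\<lambda>k. G k \<omega>) \<longlonglongrightarrow> laplace_functional z n \<omega>"
    using Qc Ds
  proof eventually_elim
    case (elim \<omega>)
    show ?case
      unfolding G_def laplace_functional_def
      by (rule strict_path.grid_functional_tendsto[OF elim(2) _ zmin step_size(2,1)]) (use elim(1) in simp)
  qed
  have G1: "AE \<omega> in N. norm (G k \<omega>) \<le> 1" for k
    using grid_term_bounds[of "step_size k" z n, OF step_size(1) less_imp_le[OF z]]
  proof eventually_elim
    case (elim \<omega>)
    show ?case
    proof (cases "\<exists>m. grid_count Q (step_size k) m \<omega> = n \<and> grid_arrival Q (step_size k) m \<omega>")
      case True
      then obtain m where m: "grid_count Q (step_size k) m \<omega> = n" "grid_arrival Q (step_size k) m \<omega>" by blast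
      have "G k \<omega> = exp (- grid_sum Q (\<lambda>t. D t \<omega>) z (step_size k) m \<omega>)"
        unfolding G_def by (rule sums_unique[OF grid_term_sums[OF m], symmetric])
      also have "\<dots> = grid_term Q (\<lambda>t. D t \<omega>) z n (step_size k) m \<omega>"
        using m by (simp add: grid_term_def)
      finally show ?thesis using elim by simp
    next
      case False
      then have "G k \<omega> = 0"
        unfolding G_def by (intro sums_unique[OF grid_term_sums_0, symmetric]) blast
      then show ?thesis by simp
    qed
  qed
  have "(\<lambda>\<omega>. lim (\<lambda>k. G k \<omega>)) \<in> borel_measurable N"
    by measurable
  then show fm: "laplace_functional z n \<in> borel_measurable N"
    by (rule borel_measurable_AE_eq) (use lim in \<open>auto elim!: eventually_mono intro: limI\<close>)
  have "(\<lambda>k. \<integral>\<omega>. G k \<omega> \<partial>N) \<longlonglongrightarrow> (\<integral>\<omega>. laplace_functional z n \<omega> \<partial>N)"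
    by (rule integral_dominated_convergence[where w = "\<lambda>_. 1"]) (use fm lim G1 in auto)
  moreover have "(\<lambda>k. \<integral>\<omega>. G k \<omega> \<partial>N) \<longlonglongrightarrow> (\<Prod>i\<le>n. lam / (lam + \<phi> (z i)))"
  proof (rule tendsto_sandwich)
    let ?b = "\<lambda>c h. exp (h * \<phi> (z 0)) * (\<Prod>i\<le>n. exp (- (h * \<phi> (z i))) * (lam * h + c * h\<^sup>2) / (1 - exp (- (h * \<phi> (z i))) + exp (- (h * \<phi> (z i))) * (lam * h + c * h\<^sup>2)))"
    \<comment> \<open>\<open>K + 1\<close> instead of \<open>K\<close> covers \<open>K = 0\<close>
      and still yields \<open>K * step_size k \<le> lam\<close>.\<close>
    have "\<forall>\<^sub>F k in sequentially. step_size k < min h0 (lam / (K + 1))"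
      using step_size(2) by (rule order_tendstoD) (use h0 lam K in auto)
    then have ev: "\<forall>\<^sub>F k in sequentially. step_size k < h0 \<and> K * step_size k \<le> lam"
    proof eventually_elim
      case (elim k)
      then have "step_size k * (K + 1) < lam" using K by (simp add: pos_less_divide_eq)
      then show ?case using elim step_size(1)[of k] by (simp add: algebra_simps)
    qed
    show "\<forall>\<^sub>F k in sequentially. ?b (- K) (step_size k) \<le> (\<integral>\<omega>. G k \<omega> \<partial>N)"
      using ev unfolding G_def by eventually_elim (rule grid_expectation_bounds(1)[OF step_size(1) _ _ zmin]; blast)
    show "\<forall>\<^sub>F k in sequentially. (\<integral>\<omega>. G k \<omega> \<partial>N) \<le> ?b K (step_size k)"
      using ev unfolding G_def by eventually_elim (rule grid_expectation_bounds(2)[OF step_size(1) _ _ zmin]; blast)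
    have b: "(?b c \<longlongrightarrow> 1 * (\<Prod>i\<le>n. lam / (lam + \<phi> (z i)))) (at_right 0)" for c
    proof (intro tendsto_mult tendsto_prod success_ratio_tendsto phi_pos z)
      show "((\<lambda>h. exp (h * \<phi> (z 0))) \<longlongrightarrow> 1) (at_right 0)" by real_asymp
    qed
    show "(\<lambda>k. ?b (- K) (step_size k)) \<longlonglongrightarrow> (\<Prod>i\<le>n. lam / (lam + \<phi> (z i)))"
      using filterlim_compose[OF b step_size(3), of "- K"] by simp
    show "(\<lambda>k. ?b K (step_size k)) \<longlonglongrightarrow> (\<Prod>i\<le>n. lam / (lam + \<phi> (z i)))"
      using filterlim_compose[OF b step_size(3), of K] by simp
  qed
  ultimately show "(\<integral>\<omega>. laplace_functional z n \<omega> \<partial>N) = (\<Prod>i\<le>n. lam / (lam + \<phi> (z i)))"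
    by (rule LIMSEQ_unique)
qed

section \<open>Gaps, their joint transform and their joint tails\<close>

abbreviation arrivals :: "'w \<Rightarrow> nat \<Rightarrow> ereal" where
  "arrivals \<omega> \<equiv> nth_arrival_time (\<lambda>t. Q t \<omega>)"

abbreviation D_left :: "'w \<Rightarrow> real \<Rightarrow> real" where
  "D_left \<omega> \<equiv> left_limit (\<lambda>t. D t \<omega>)"

text \<open>The total mass \<open>1\<close> is obtained from the joint Laplace transform by letting its arguments tend to 0.\<close>

lemma nth_arrival_finite: "AE \<omega> in N. \<forall>n. arrivals \<omega> n \<noteq> \<infinity>"
proof -
  interpret complete_measure N by (rule complete)
  have "AE \<omega> in N. arrivals \<omega> (Suc n) \<noteq> \<infinity>" for n
  proof -
    let ?f = "\<lambda>\<omega>. of_bool (arrivals \<omega> (Suc n) \<noteq> \<infinity>) :: real"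
    let ?F = "\<lambda>k. laplace_functional (\<lambda>_. step_size k) n"
    have Fm[measurable]: "?F k \<in> borel_measurable N" for k
      by (rule laplace_functional_measurable[of "step_size k"]) (auto intro: step_size)
    \<comment> \<open>As the common argument tends to 0 the exponential tends to 1, while paths
      without the arrival keep the value 0; the limit is therefore the indicator of a finite arrival
      time.\<close>
    have lim: "(\<lambda>k. ?F k \<omega>) \<longlonglongrightarrow> ?f \<omega>" for \<omega>
    proof (cases "arrivals \<omega> (Suc n) = \<infinity>")
      case False
      define s where "s = (\<Sum>i\<le>n. D_left \<omega> (real_of_ereal (arrivals \<omega> (Suc i)))
        - D_left \<omega> (real_of_ereal (arrivals \<omega> i)))"
      have "(\<lambda>k. exp (- (step_size k * s))) \<longlonglongrightarrow> exp (- (0 * s))"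
        by (intro tendsto_intros step_size)
      then show ?thesis
        using False by (simp add: laplace_functional_def arrival_functional_def s_def sum_distrib_left)
    qed (simp add: laplace_functional_def arrival_functional_def)
    have [measurable]: "?f \<in> borel_measurable N"
      by (rule borel_measurable_LIMSEQ_metric[OF Fm lim])
    have F1: "AE \<omega> in N. norm (?F k \<omega>) \<le> 1" for k
      using Qc Ds
    proof eventually_elim
      case (elim \<omega>)
      interpret strict_path "\<lambda>t. D t \<omega>" by (rule elim)
      show ?case
      proof (cases "arrivals \<omega> (Suc n) = \<infinity>")
        case False
        have "D_left \<omega> (real_of_ereal (arrivals \<omega> i))
            \<le> D_left \<omega> (real_of_ereal (arrivals \<omega> (Suc i)))" if "i \<le> n" for i
        proof (rule less_imp_le, rule left_limit_strict)
          have "arrivals \<omega> (Suc i) \<noteq> \<infinity>"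
            using nth_arrival_time_real(2)[OF elim(1) False, of "Suc i"] that False by auto
          then have "arrivals \<omega> i < arrivals \<omega> (Suc i)"
            by (rule nth_arrival_time_less_Suc[OF elim(1)])
          then show "real_of_ereal (arrivals \<omega> i) < real_of_ereal (arrivals \<omega> (Suc i))"
            using nth_arrival_time_real(1)[OF elim(1) False, of i] nth_arrival_time_real(1)[OF elim(1) False, of "Suc i"] that
            by (metis Suc_le_mono le_SucI less_ereal.simps(1))
          show "0 \<le> real_of_ereal (arrivals \<omega> i)"
            by (intro real_of_ereal_pos nth_arrival_time_nonneg)
        qed
        then show ?thesis
          using step_size(1)[of k] False
          by (auto simp: laplace_functional_def arrival_functional_def intro!: sum_nonneg)
      qed (simp add: laplace_functional_def arrival_functional_def)
    qed
    have "(\<lambda>k. \<integral>\<omega>. ?F k \<omega> \<partial>N) \<longlonglongrightarrow> (\<integral>\<omega>. ?f \<omega> \<partial>N)"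
      by (rule integral_dominated_convergence[where w = "\<lambda>_. 1"]) (use lim F1 in auto)
    moreover have "(\<lambda>k. \<integral>\<omega>. ?F k \<omega> \<partial>N) \<longlonglongrightarrow> (\<Prod>i\<le>n. lam / (lam + 0))"
    proof -
      have eq: "(\<integral>\<omega>. ?F k \<omega> \<partial>N) = (\<Prod>i\<le>n. lam / (lam + \<phi> (step_size k)))" for k
        by (rule laplace_functional_integral[of "step_size k"]) (auto intro: step_size)
      have "(\<lambda>k. \<phi> (step_size k)) \<longlonglongrightarrow> \<phi> 0"
        by (rule continuous_on_tendsto_compose[OF phi_cont step_size(2)])
           (auto intro: always_eventually less_imp_le step_size)
      then have t: "(\<lambda>k. \<phi> (step_size k)) \<longlonglongrightarrow> 0" by (simp add: phi0)
      show ?thesis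
        unfolding eq using lam
        by (intro tendsto_prod tendsto_divide tendsto_add tendsto_const t) simp
    qed
    ultimately have "(\<integral>\<omega>. ?f \<omega> \<partial>N) = 1"
      using lam by (simp add: LIMSEQ_unique)
    moreover have int: "integrable N ?f"
      by (rule integrable_const_bound[where B = 1]) auto
    ultimately have "(\<integral>\<omega>. 1 - ?f \<omega> \<partial>N) = 0"
      by (simp add: prob_space)
    then have "AE \<omega> in N. 1 - ?f \<omega> = 0"
      using int by (subst (asm) integral_nonneg_eq_0_iff_AE) auto
    then show ?thesis
      by eventually_elim (simp split: if_splits)
  qed
  then have "AE \<omega> in N. \<forall>n. arrivals \<omega> (Suc n) \<noteq> \<infinity>"
    by (simp add: AE_all_countable)
  then show ?thesis
  proof eventually_elim
    case (elim \<omega>)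
    show ?case
    proof
      fix n show "arrivals \<omega> n \<noteq> \<infinity>"
        using elim by (cases n) auto
    qed
  qed
qed

definition gap :: "nat \<Rightarrow> 'w \<Rightarrow> real" where
  "gap i \<omega> = D_left \<omega> (real_of_ereal (arrivals \<omega> (Suc i)))
     - D_left \<omega> (real_of_ereal (arrivals \<omega> i))"

lemma gap_nonneg: "AE \<omega> in N. \<forall>i. 0 \<le> gap i \<omega>"
  using Qc Ds nth_arrival_finite
proof eventually_elim
  case (elim \<omega>)
  interpret strict_path "\<lambda>t. D t \<omega>" by (rule elim)
  show ?case
  proof
    fix i
    have "arrivals \<omega> i < arrivals \<omega> (Suc i)"
      using elim(3) by (intro nth_arrival_time_less_Suc elim(1)) auto
    then have "real_of_ereal (arrivals \<omega> i) < real_of_ereal (arrivals \<omega> (Suc i))"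
      using elim(3) nth_arrival_time_nonneg[of "\<lambda>t. Q t \<omega>" i]
      by (cases "arrivals \<omega> i"; cases "arrivals \<omega> (Suc i)") (auto simp del: nth_arrival_time.simps)
    then show "0 \<le> gap i \<omega>"
      unfolding gap_def using left_limit_strict[OF real_of_ereal_pos[OF nth_arrival_time_nonneg]] by (simp add: less_imp_le del: nth_arrival_time.simps)
  qed
qed

lemma laplace_functional_gap: "AE \<omega> in N. laplace_functional z n \<omega> = exp (- (\<Sum>i\<le>n. z i * gap i \<omega>))"
  using nth_arrival_finite
  by eventually_elim (simp add: laplace_functional_def arrival_functional_def gap_def del: nth_arrival_time.simps)

text \<open>Two functionals whose arguments differ only at \<open>i\<close>, 2 against 1, have the
  quotient \<open>exp (- gap i)\<close> almost everywhere.\<close>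

lemma gap_measurable: "gap i \<in> borel_measurable N"
proof -
  interpret complete_measure N by (rule complete)
  let ?z = "\<lambda>j. if j = i then 2 else 1 :: real"
  have [measurable]: "laplace_functional ?z i \<in> borel_measurable N" "laplace_functional (\<lambda>_. 1) i \<in> borel_measurable N"
    by (rule laplace_functional_measurable[of 1]; simp)+
  have "(\<lambda>\<omega>. - ln (laplace_functional ?z i \<omega> / laplace_functional (\<lambda>_. 1) i \<omega>)) \<in> borel_measurable N"
    by measurable
  then show ?thesis
  proof (rule borel_measurable_AE_eq)
    show "AE \<omega> in N. - ln (laplace_functional ?z i \<omega> / laplace_functional (\<lambda>_. 1) i \<omega>) = gap i \<omega>"
      using laplace_functional_gap[of ?z i] laplace_functional_gap[of "\<lambda>_. 1" i]
    proof eventually_elim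
      case (elim \<omega>)
      have "(\<Sum>j\<le>i. ?z j * gap j \<omega>) = (\<Sum>j\<le>i. gap j \<omega> + (if j = i then gap j \<omega> else 0))"
        by (intro sum.cong) auto
      also have "\<dots> = (\<Sum>j\<le>i. 1 * gap j \<omega>) + gap i \<omega>"
        by (simp add: sum.distrib)
      finally have *: "(\<Sum>j\<le>i. ?z j * gap j \<omega>) = (\<Sum>j\<le>i. 1 * gap j \<omega>) + gap i \<omega>" .
      show ?case
        unfolding elim * exp_diff[symmetric] by simp
    qed
  qed
qed

text \<open>Adding \<open>step_size k\<close> to every argument bounds the arguments away from 0;
  continuity of \<open>\<phi>\<close> up to 0 then removes the shift. Arguments equal to 0 are what
  gives access to single gaps.\<close>

lemma joint_laplace:
  assumes z: "\<And>i. 0 \<le> z i"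
  shows "(\<integral>\<omega>. exp (- (\<Sum>i\<le>n. z i * gap i \<omega>)) \<partial>N) = (\<Prod>i\<le>n. lam / (lam + \<phi> (z i)))"
proof -
  note [measurable] = gap_measurable
  have eq: "(\<integral>\<omega>. exp (- (\<Sum>i\<le>n. (z i + step_size k) * gap i \<omega>)) \<partial>N) = (\<Prod>i\<le>n. lam / (lam + \<phi> (z i + step_size k)))" for k
  proof -
    have "(\<integral>\<omega>. exp (- (\<Sum>i\<le>n. (z i + step_size k) * gap i \<omega>)) \<partial>N) = (\<integral>\<omega>. laplace_functional (\<lambda>i. z i + step_size k) n \<omega> \<partial>N)"
      using laplace_functional_gap[of "\<lambda>i. z i + step_size k" n] z step_size(1)[of k]
      by (intro integral_cong_AE laplace_functional_measurable[of "step_size k"]) (auto elim!: eventually_mono)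
    also have "\<dots> = (\<Prod>i\<le>n. lam / (lam + \<phi> (z i + step_size k)))"
      using z step_size(1)[of k] by (intro laplace_functional_integral[of "step_size k"]) auto
    finally show ?thesis .
  qed
  have "(\<lambda>k. \<integral>\<omega>. exp (- (\<Sum>i\<le>n. (z i + step_size k) * gap i \<omega>)) \<partial>N) \<longlonglongrightarrow> (\<integral>\<omega>. exp (- (\<Sum>i\<le>n. (z i + 0) * gap i \<omega>)) \<partial>N)"
  proof (rule integral_dominated_convergence[where w = "\<lambda>_. 1"])
    show "AE \<omega> in N. (\<lambda>k. exp (- (\<Sum>i\<le>n. (z i + step_size k) * gap i \<omega>))) \<longlonglongrightarrow> exp (- (\<Sum>i\<le>n. (z i + 0) * gap i \<omega>))"
      by (intro AE_I2 tendsto_intros step_size)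
    show "AE \<omega> in N. norm (exp (- (\<Sum>i\<le>n. (z i + step_size k) * gap i \<omega>))) \<le> 1" for k
      using gap_nonneg z step_size(1)[of k]
      by (auto elim!: eventually_mono intro!: sum_nonneg mult_nonneg_nonneg add_nonneg_nonneg intro: less_imp_le)
  qed auto
  moreover have "(\<lambda>k. \<Prod>i\<le>n. lam / (lam + \<phi> (z i + step_size k))) \<longlonglongrightarrow> (\<Prod>i\<le>n. lam / (lam + \<phi> (z i)))"
  proof (intro tendsto_prod tendsto_divide tendsto_add tendsto_const)
    fix i
    have zi: "(\<lambda>k. z i + step_size k) \<longlonglongrightarrow> z i"
      using tendsto_add[OF tendsto_const step_size(2), of "z i"] by simp
    show "(\<lambda>k. \<phi> (z i + step_size k)) \<longlonglongrightarrow> \<phi> (z i)"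
      by (rule continuous_on_tendsto_compose[OF phi_cont zi])
         (use z[of i] step_size(1) in \<open>auto intro!: always_eventually add_nonneg_nonneg intro: less_imp_le\<close>)
    have "0 \<le> \<phi> (z i)" using phi_mono[of 0 "z i"] z[of i] phi0 by simp
    then show "lam + \<phi> (z i) \<noteq> 0" using lam by simp
  qed
  ultimately show ?thesis
    unfolding eq by (simp add: LIMSEQ_unique)
qed

lemma gap_laplace:
  assumes "0 \<le> x"
  shows "(\<integral>\<omega>. exp (- (x * gap i \<omega>)) \<partial>N) = lam / (lam + \<phi> x)"
proof -
  let ?z = "\<lambda>j. if j = i then x else 0"
  have "(\<Sum>j\<le>i. ?z j * gap j \<omega>) = x * gap i \<omega>" for \<omega>
  proof -
    have "(\<Sum>j\<le>i. ?z j * gap j \<omega>) = (\<Sum>j\<le>i. if j = i then x * gap j \<omega> else 0)"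
      by (intro sum.cong) auto
    then show ?thesis by simp
  qed
  moreover have "(\<Prod>j\<le>i. lam / (lam + \<phi> (?z j))) = lam / (lam + \<phi> x)"
  proof -
    have "(\<Prod>j\<le>i. lam / (lam + \<phi> (?z j))) = (\<Prod>j\<le>i. if j = i then lam / (lam + \<phi> x) else 1)"
      using lam by (intro prod.cong) (auto simp: phi0)
    then show ?thesis by simp
  qed
  ultimately show ?thesis
    using joint_laplace[of ?z i] assms by simp
qed

text \<open>The exponentials in the joint Laplace transform are replaced by indicators one at a time.\<close>

lemma mixed_laplace_tail:
  assumes "k \<le> Suc n" "\<And>i. 0 \<le> z i"
  shows "(\<integral>\<omega>. (\<Prod>i<k. indicator {a i<..} (ereal (gap i \<omega>))) * exp (- (\<Sum>i\<in>{k..n}. z i * gap i \<omega>)) \<partial>N)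
    = (\<Prod>i<k. prob {\<omega>\<in>space N. a i < ereal (gap i \<omega>)}) * (\<Prod>i\<in>{k..n}. lam / (lam + \<phi> (z i)))"
  using assms
proof (induction k arbitrary: z)
  case 0
  then show ?case using joint_laplace[of z n] by (simp add: atMost_atLeast0)
next
  case (Suc k)
  note [measurable] = gap_measurable
  \<comment> \<open>With all other coordinates packed into the weight \<open>W\<close>, uniqueness
    is applied in coordinate \<open>k\<close> alone, against the constant weight \<open>c\<close> on
    the other side.\<close>
  define W where "W \<omega> = (\<Prod>i<k. indicator {a i<..} (ereal (gap i \<omega>))) * exp (- (\<Sum>i\<in>{Suc k..n}. z i * gap i \<omega>))" for \<omega>
  define c where "c = (\<Prod>i<k. prob {\<omega>\<in>space N. a i < ereal (gap i \<omega>)}) * (\<Prod>i\<in>{Suc k..n}. lam / (lam + \<phi> (z i)))"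
  have k: "{k..n} = insert k {Suc k..n}" using Suc.prems by auto
  have [measurable]: "W \<in> borel_measurable N" unfolding W_def by measurable
  have W: "integrable N W"
  proof (rule integrable_const_bound[where B = 1])
    show "AE \<omega> in N. norm (W \<omega>) \<le> 1"
      using gap_nonneg
    proof eventually_elim
      case (elim \<omega>)
      have 1: "0 \<le> (\<Prod>i<k. indicator {a i<..} (ereal (gap i \<omega>)) :: real)" "(\<Prod>i<k. indicator {a i<..} (ereal (gap i \<omega>)) :: real) \<le> 1"
        by (auto intro!: prod_nonneg prod_le_1)
      have 2: "exp (- (\<Sum>i\<in>{Suc k..n}. z i * gap i \<omega>)) \<le> 1"
        using elim Suc.prems(2) by (auto intro!: sum_nonneg)
      show ?case
        unfolding W_def using 1 mult_le_one[OF 1(2) exp_ge_zero 2] by (simp add: abs_mult)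
    qed
  qed measurable
  have "(\<integral>\<omega>. W \<omega> * indicator {a k<..} (ereal (gap k \<omega>)) \<partial>N) = (\<integral>\<omega>. c * indicator {a k<..} (ereal (gap k \<omega>)) \<partial>N)"
  proof (rule laplace_unique[OF W])
    show "AE \<omega> in N. 0 \<le> gap k \<omega>" "AE \<omega> in N. 0 \<le> gap k \<omega>"
      using gap_nonneg by auto
    fix m :: nat
    have "(\<integral>\<omega>. W \<omega> * exp (- (real m * gap k \<omega>)) \<partial>N)
       = (\<integral>\<omega>. (\<Prod>i<k. indicator {a i<..} (ereal (gap i \<omega>))) * exp (- (\<Sum>i\<in>{k..n}. (z(k := real m)) i * gap i \<omega>)) \<partial>N)"
      unfolding W_def k by (intro Bochner_Integration.integral_cong) (auto simp: exp_add[symmetric])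
    also have "\<dots> = (\<Prod>i<k. prob {\<omega>\<in>space N. a i < ereal (gap i \<omega>)}) * (\<Prod>i\<in>{k..n}. lam / (lam + \<phi> ((z(k := real m)) i)))"
      using Suc.prems by (intro Suc.IH) auto
    also have "\<dots> = c * (lam / (lam + \<phi> (real m)))"
      unfolding k c_def by simp
    also have "\<dots> = (\<integral>\<omega>. c * exp (- (real m * gap k \<omega>)) \<partial>N)"
      by (simp add: gap_laplace)
    finally show "(\<integral>\<omega>. W \<omega> * exp (- (real m * gap k \<omega>)) \<partial>N) = (\<integral>\<omega>. c * exp (- (real m * gap k \<omega>)) \<partial>N)" .
  qed auto
  also have "\<dots> = c * (\<integral>\<omega>. indicator {\<omega>\<in>space N. a k < ereal (gap k \<omega>)} \<omega> \<partial>N)"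
    by (subst integral_mult_right_zero[symmetric], intro Bochner_Integration.integral_cong) (auto simp: indicator_def)
  also have "\<dots> = (\<Prod>i<Suc k. prob {\<omega>\<in>space N. a i < ereal (gap i \<omega>)}) * (\<Prod>i\<in>{Suc k..n}. lam / (lam + \<phi> (z i)))"
    by (simp add: c_def)
  also have "(\<integral>\<omega>. W \<omega> * indicator {a k<..} (ereal (gap k \<omega>)) \<partial>N)
    = (\<integral>\<omega>. (\<Prod>i<Suc k. indicator {a i<..} (ereal (gap i \<omega>))) * exp (- (\<Sum>i\<in>{Suc k..n}. z i * gap i \<omega>)) \<partial>N)"
    by (intro Bochner_Integration.integral_cong) (simp_all add: W_def mult_ac)
  finally show ?case .
qed

lemma joint_tail:
  "prob {\<omega>\<in>space N. \<forall>i\<le>n. a i < ereal (gap i \<omega>)} = (\<Prod>i\<le>n. prob {\<omega>\<in>space N. a i < ereal (gap i \<omega>)})"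
proof -
  note [measurable] = gap_measurable
  have "prob {\<omega>\<in>space N. \<forall>i\<le>n. a i < ereal (gap i \<omega>)} = (\<integral>\<omega>. indicator {\<omega>\<in>space N. \<forall>i\<le>n. a i < ereal (gap i \<omega>)} \<omega> \<partial>N)"
    by simp
  also have "\<dots> = (\<integral>\<omega>. (\<Prod>i<Suc n. indicator {a i<..} (ereal (gap i \<omega>))) * exp (- (\<Sum>i\<in>{Suc n..n}. 0 * gap i \<omega>)) \<partial>N)"
  proof (intro Bochner_Integration.integral_cong refl)
    fix \<omega> assume w: "\<omega> \<in> space N"
    show "indicator {\<omega>\<in>space N. \<forall>i\<le>n. a i < ereal (gap i \<omega>)} \<omega> = (\<Prod>i<Suc n. indicator {a i<..} (ereal (gap i \<omega>))) * exp (- (\<Sum>i\<in>{Suc n..n}. 0 * gap i \<omega>))"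
    proof (cases "\<forall>i\<le>n. a i < ereal (gap i \<omega>)")
      case True
      then show ?thesis using w by (simp add: lessThan_Suc_atMost)
    next
      case False
      then obtain j where j: "j \<le> n" "\<not> a j < ereal (gap j \<omega>)" by blast
      then have "(\<Prod>i<Suc n. indicator {a i<..} (ereal (gap i \<omega>)) :: real) = 0"
        by (intro prod_zero) (auto intro!: bexI[of _ j])
      then show ?thesis using False by simp
    qed
  qed
  also have "\<dots> = (\<Prod>i<Suc n. prob {\<omega>\<in>space N. a i < ereal (gap i \<omega>)})"
    using mixed_laplace_tail[of "Suc n" n "\<lambda>_. 0" a] by simp
  finally show ?thesis by (simp add: lessThan_Suc_atMost)
qed

lemma gap_same_tail:
  "prob {\<omega>\<in>space N. a < ereal (gap i \<omega>)} = prob {\<omega>\<in>space N. a < ereal (gap j \<omega>)}"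
proof -
  note [measurable] = gap_measurable
  have "(\<integral>\<omega>. (1 :: real) * indicator {a<..} (ereal (gap i \<omega>)) \<partial>N) = (\<integral>\<omega>. (1 :: real) * indicator {a<..} (ereal (gap j \<omega>)) \<partial>N)"
    by (rule laplace_unique) (use gap_nonneg in \<open>auto simp: gap_laplace\<close>)
  moreover have "(\<integral>\<omega>. (1 :: real) * indicator {a<..} (ereal (gap i \<omega>)) \<partial>N) = prob {\<omega>\<in>space N. a < ereal (gap i \<omega>)}" for i
  proof -
    have "(\<integral>\<omega>. (1 :: real) * indicator {a<..} (ereal (gap i \<omega>)) \<partial>N) = (\<integral>\<omega>. indicator {\<omega>\<in>space N. a < ereal (gap i \<omega>)} \<omega> \<partial>N :: real)"
      by (intro Bochner_Integration.integral_cong) (auto simp: indicator_def)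
    then show ?thesis by simp
  qed
  ultimately show ?thesis by simp
qed

context
  fixes T :: "nat \<Rightarrow> 'w \<Rightarrow> ereal"
  assumes T: "AE \<omega> in N. \<forall>i. T i \<omega> = ereal (gap i \<omega>)"
begin

lemma interarrival_measurable: "T i \<in> borel_measurable N"
proof -
  interpret complete_measure N by (rule complete)
  show ?thesis
    by (rule borel_measurable_AE_eq[of "\<lambda>\<omega>. ereal (gap i \<omega>)"])
       (use T gap_measurable in \<open>auto elim!: eventually_mono\<close>)
qed

lemma prob_interarrival_greater: "prob {\<omega>\<in>space N. a < T i \<omega>} = prob {\<omega>\<in>space N. a < ereal (gap i \<omega>)}"
proof -
  note [measurable] = gap_measurable interarrival_measurable
  show ?thesis
    by (rule finite_measure_eq_AE) (use T in \<open>auto elim!: eventually_mono\<close>)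
qed

text \<open>Rays generate the Borel sets and are stable under intersection, so the product formula
  for joint tails is enough.\<close>

lemma indep_vars_interarrivals: "indep_vars (\<lambda>_. borel) T UNIV"
proof -
  note [measurable] = gap_measurable interarrival_measurable
  let ?G = "\<lambda>i. {T i -` A \<inter> space N | A. A \<in> range greaterThan}"
  have "indep_sets ?G UNIV"
  proof (rule indep_setsI)
    show "?G i \<subseteq> events" for i
      by (auto intro: measurable_sets[OF interarrival_measurable])
    fix A J assume J: "J \<noteq> {}" "J \<subseteq> (UNIV :: nat set)" "finite J" and A: "\<forall>j\<in>J. A j \<in> ?G j"
    then have "\<forall>j\<in>J. \<exists>a. A j = {\<omega>\<in>space N. a < T j \<omega>}" by fastforce
    then obtain a where a: "\<And>j. j \<in> J \<Longrightarrow> A j = {\<omega>\<in>space N. a j < T j \<omega>}" by metis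
    define n where "n = Max J"
    \<comment> \<open>The threshold minus infinity imposes no condition on a real gap, which extends
      an arbitrary finite index set to an initial segment.\<close>
    define b where "b i = (if i \<in> J then a i else - \<infinity>)" for i
    have n: "j \<le> n" if "j \<in> J" for j using that J by (simp add: n_def)
    have "prob (\<Inter>j\<in>J. A j) = prob {\<omega>\<in>space N. \<forall>i\<le>n. b i < ereal (gap i \<omega>)}"
    proof (rule finite_measure_eq_AE)
      show "(\<Inter>j\<in>J. A j) \<in> events"
        using J A by (intro sets.finite_INT) (auto intro: measurable_sets[OF interarrival_measurable])
      show "{\<omega>\<in>space N. \<forall>i\<le>n. b i < ereal (gap i \<omega>)} \<in> events" by measurable
      show "AE \<omega> in N. \<omega> \<in> (\<Inter>j\<in>J. A j) \<longleftrightarrow> \<omega> \<in> {\<omega>\<in>space N. \<forall>i\<le>n. b i < ereal (gap i \<omega>)}"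
        using T AE_space
      proof eventually_elim
        case (elim \<omega>)
        then show ?case using n J(1) by (auto simp: a b_def split: if_splits)
      qed
    qed
    also have "\<dots> = (\<Prod>i\<le>n. prob {\<omega>\<in>space N. b i < ereal (gap i \<omega>)})"
      by (rule joint_tail)
    also have "\<dots> = (\<Prod>i\<in>J. prob {\<omega>\<in>space N. b i < ereal (gap i \<omega>)})"
      by (rule prod.mono_neutral_right) (use n in \<open>auto simp: b_def prob_space\<close>)
    also have "\<dots> = (\<Prod>j\<in>J. prob (A j))"
      by (intro prod.cong) (auto simp: a b_def prob_interarrival_greater)
    finally show "prob (\<Inter>j\<in>J. A j) = (\<Prod>j\<in>J. prob (A j))" .
  qed
  moreover have "Int_stable (?G i)" for i
  proof (rule Int_stableI)
    fix x y assume "x \<in> ?G i" "y \<in> ?G i"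
    then obtain a b where "x = T i -` {a<..} \<inter> space N" "y = T i -` {b<..} \<inter> space N" by blast
    then have "x \<inter> y = T i -` {max a b<..} \<inter> space N" by auto
    then show "x \<inter> y \<in> ?G i" by blast
  qed
  ultimately have "indep_sets (\<lambda>i. sigma_sets (space N) (?G i)) UNIV"
    by (rule indep_sets_sigma)
  moreover have "sigma_sets (space N) (?G i) = {T i -` A \<inter> space N | A. A \<in> sets borel}" for i
  proof -
    have "sets (borel :: ereal measure) = sigma_sets UNIV (range greaterThan)"
      by (subst borel_Ioi) simp
    then show ?thesis
      using sigma_sets_vimage_commute[of "T i" "space N" UNIV "range greaterThan"] by simp
  qed
  ultimately show ?thesis
    unfolding indep_vars_def2 by (simp add: interarrival_measurable)
qed

lemma distr_interarrivals_eq: "distr N borel (T i) = distr N borel (T j)"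
proof -
  \<comment> \<open>No ray \<open>{a<..}\<close> of extended reals contains minus infinity, so the
    rays do not exhaust the space; \<open>UNIV\<close> is added for the uniqueness theorem for
    measures.\<close>
  let ?E = "insert UNIV (range greaterThan) :: ereal set set"
  have E: "sets (borel :: ereal measure) = sigma_sets UNIV ?E"
  proof
    have "sets (borel :: ereal measure) = sigma_sets UNIV (range greaterThan)"
      by (subst borel_Ioi) simp
    then show "sets (borel :: ereal measure) \<subseteq> sigma_sets UNIV ?E"
      using sigma_sets_mono'[of "range greaterThan" ?E UNIV] by blast
    show "sigma_sets UNIV ?E \<subseteq> sets (borel :: ereal measure)"
    proof -
      have "?E \<subseteq> sets (borel :: ereal measure)" by auto
      from sets.sigma_sets_subset[OF this] show ?thesis by simp
    qed
  qed
  note [measurable] = interarrival_measurable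
  interpret I: prob_space "distr N borel (T i)" by (rule prob_space_distr) (rule interarrival_measurable)
  interpret J: prob_space "distr N borel (T j)" by (rule prob_space_distr) (rule interarrival_measurable)
  show ?thesis
  proof (rule measure_eqI_generator_eq[where E = ?E and \<Omega> = UNIV and A = "\<lambda>_. UNIV"])
    show "Int_stable ?E"
    proof (rule Int_stableI)
      fix x y assume "x \<in> ?E" "y \<in> ?E"
      moreover have "{a<..} \<inter> {b<..} = {max a b<..}" for a b :: ereal by auto
      ultimately show "x \<inter> y \<in> ?E" by auto
    qed
    fix X assume "X \<in> ?E"
    then consider "X = UNIV" | a where "X = {a<..}" by blast
    then show "emeasure (distr N borel (T i)) X = emeasure (distr N borel (T j)) X"
    proof cases
      case 1
      then show ?thesis using I.emeasure_space_1 J.emeasure_space_1 by simp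
    next
      case (2 a)
      have "T k -` {a<..} \<inter> space N = {\<omega>\<in>space N. a < T k \<omega>}" for k by auto
      then show ?thesis
        using gap_same_tail[of a i j] by (simp add: 2 emeasure_distr emeasure_eq_measure prob_interarrival_greater)
    qed
  qed (use E I.emeasure_space_1 in auto)
qed

end

lemma gap_tail:
  assumes z0: "0 < z0"
    and g: "\<And>z. z0 \<le> z \<Longrightarrow> has_bochner_integral lborel (\<lambda>t. indicator {0<..} t * exp (- (z * t)) * g t) (\<phi> z / (z * (lam + \<phi> z)))"
    and cont: "\<And>t. 0 < t \<Longrightarrow> isCont g t" and t: "0 < t"
  shows "prob {\<omega>\<in>space N. t < gap i \<omega>} = g t"
proof (rule tail_eq_of_laplace[OF gap_measurable _ z0 _ cont t])
  show "AE \<omega> in N. 0 \<le> gap i \<omega>" using gap_nonneg by auto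
  fix z assume z: "z0 \<le> z"
  have "0 \<le> \<phi> z" using phi_mono[of 0 z] z z0 phi0 by simp
  then have "lam + \<phi> z \<noteq> 0" using lam by linarith
  then have "(1 - lam / (lam + \<phi> z)) / z = \<phi> z / (z * (lam + \<phi> z))"
    using z z0 by (simp add: field_simps)
  then show "has_bochner_integral lborel (\<lambda>t. indicator {0<..} t * exp (- (z * t)) * g t)
     ((1 - (\<integral>\<omega>. exp (- (z * gap i \<omega>)) \<partial>N)) / z)"
    using g[OF z] gap_laplace[of z i] z z0 by simp
qed

end

text \<open>Multiplication by \<open>p = c1 * z powr \<alpha>1\<close> turns \<open>r\<close> into
  \<open>\<phi>\<close> and the common denominator into \<open>\<phi> + lam\<close>. Read backwards,
  division by \<open>p\<close> is what produces the coefficients \<open>A\<close> and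
  \<open>B\<close>.\<close>

lemma mixed_tail_laplace:
  fixes c1 c2 lam z \<alpha>1 \<alpha>2 A B :: real
  assumes par: "0 < \<alpha>2" "\<alpha>2 < \<alpha>1" "c1 > 0" "c2 \<ge> 0" "0 < lam" "0 < z"
    and A: "A = - (c2 / c1)" and B: "B = - (lam / c1)"
  shows "z powr (- 0 - 1) / (1 - (A * z powr - (\<alpha>1 - \<alpha>2) + B * z powr - \<alpha>1))
      - A * (z powr (- (\<alpha>1 - \<alpha>2) - 1) / (1 - (A * z powr - (\<alpha>1 - \<alpha>2) + B * z powr - \<alpha>1)))
    = (c1 * z powr \<alpha>1 + c2 * z powr \<alpha>2) / (z * (lam + (c1 * z powr \<alpha>1 + c2 * z powr \<alpha>2)))"
proof -
  define \<phi> where "\<phi> = c1 * z powr \<alpha>1 + c2 * z powr \<alpha>2"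
  define p where "p = c1 * z powr \<alpha>1"
  define r where "r = 1 - A * z powr - (\<alpha>1 - \<alpha>2)"
  have p: "0 < p" unfolding p_def using par by (intro mult_pos_pos) auto
  have q: "p * z powr - (\<alpha>1 - \<alpha>2) = c1 * z powr \<alpha>2" "p * z powr - \<alpha>1 = c1"
    using par by (simp_all add: p_def powr_add[symmetric])
  have "p * r = p + c2 / c1 * (p * z powr - (\<alpha>1 - \<alpha>2))"
    unfolding r_def A by (simp add: algebra_simps)
  then have r: "p * r = \<phi>"
    unfolding q using par by (simp add: \<phi>_def p_def)
  have "p * (r - B * z powr - \<alpha>1) = p * r + lam / c1 * (p * z powr - \<alpha>1)"
    unfolding B by (simp add: algebra_simps)
  then have s: "p * (r - B * z powr - \<alpha>1) = \<phi> + lam"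
    unfolding q r using par by simp
  have "z powr (- 0 - 1) = 1 / z" "z powr (- (\<alpha>1 - \<alpha>2) - 1) = z powr - (\<alpha>1 - \<alpha>2) / z"
    using par by (simp_all add: powr_diff powr_minus_divide)
  then have "z powr (- 0 - 1) / (1 - (A * z powr - (\<alpha>1 - \<alpha>2) + B * z powr - \<alpha>1))
      - A * (z powr (- (\<alpha>1 - \<alpha>2) - 1) / (1 - (A * z powr - (\<alpha>1 - \<alpha>2) + B * z powr - \<alpha>1)))
    = (1 / z) / (r - B * z powr - \<alpha>1) - A * ((z powr - (\<alpha>1 - \<alpha>2) / z) / (r - B * z powr - \<alpha>1))"
    by (simp only: r_def diff_diff_eq)
  also have "\<dots> = r / (z * (r - B * z powr - \<alpha>1))"
    by (simp add: r_def diff_divide_distrib)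
  also have "\<dots> = (p * r) / (z * (p * (r - B * z powr - \<alpha>1)))"
    using p by simp
  also have "\<dots> = \<phi> / (z * (lam + \<phi>))"
    unfolding r s by (simp add: add.commute)
  finally show ?thesis by (simp add: \<phi>_def)
qed

theorem theorem3p6:
  fixes M :: "'w measure"
    and Q :: "real \<Rightarrow> 'w \<Rightarrow> nat \<times> nat"
    and D :: "real \<Rightarrow> 'w \<Rightarrow> real"
    and T :: "nat \<Rightarrow> 'w \<Rightarrow> ereal"
    and lam mu c1 c2 \<alpha>1 \<alpha>2 :: real
    and k :: nat
  assumes "prob_space M"
    and "lam > 0" and "mu > 0" and "k \<ge> 1"
    and "0 < \<alpha>2" and "\<alpha>2 < \<alpha>1" and "\<alpha>1 < 1"
    and "c1 > 0" and "c2 \<ge> 0" and "c1 + c2 = 1"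
    and "erlang_queue M lam mu k Q"
    and "mixed_stable_subordinator M c1 c2 \<alpha>1 \<alpha>2 D"
    and "indep_processes (completion M) (count_space UNIV) Q borel (inverse_process D)"
    and T: "T = interarrival_time (time_change Q (inverse_process D))"
  shows "prob_space.indep_vars (completion M) (\<lambda>_. borel) T UNIV \<and>
    (\<forall>m n. distr (completion M) borel (T m) = distr (completion M) borel (T n)) \<and>
    (\<forall>n. \<forall>t>0.
       summable (\<lambda>r. (- (c2 / c1)) ^ r * t powr ((\<alpha>1 - \<alpha>2) * real r)
         * mittag_leffler3 (real r + 1) \<alpha>1 ((\<alpha>1 - \<alpha>2) * real r + 1) (- (lam / c1) * t powr \<alpha>1)) \<and>
       summable (\<lambda>r. (- (c2 / c1)) ^ (r + 1) * t powr ((\<alpha>1 - \<alpha>2) * (real r + 1))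
         * mittag_leffler3 (real r + 1) \<alpha>1 ((\<alpha>1 - \<alpha>2) * (real r + 1) + 1) (- (lam / c1) * t powr \<alpha>1)) \<and>
       \<P>(\<omega> in completion M. T n \<omega> > ereal t) =
         (\<Sum>r. (- (c2 / c1)) ^ r * t powr ((\<alpha>1 - \<alpha>2) * real r)
           * mittag_leffler3 (real r + 1) \<alpha>1 ((\<alpha>1 - \<alpha>2) * real r + 1) (- (lam / c1) * t powr \<alpha>1))
         - (\<Sum>r. (- (c2 / c1)) ^ (r + 1) * t powr ((\<alpha>1 - \<alpha>2) * (real r + 1))
           * mittag_leffler3 (real r + 1) \<alpha>1 ((\<alpha>1 - \<alpha>2) * (real r + 1) + 1) (- (lam / c1) * t powr \<alpha>1)))"
proof -
  interpret M: prob_space M by fact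
  define C where "C = lam + real k * mu"
  have C: "0 < C" using assms(2,3) by (simp add: C_def add_pos_nonneg)
  define \<phi> where "\<phi> z = c1 * z powr \<alpha>1 + c2 * z powr \<alpha>2" for z
  note par = \<open>0 < \<alpha>2\<close> \<open>\<alpha>2 < \<alpha>1\<close> \<open>c1 > 0\<close> \<open>c2 \<ge> 0\<close> \<open>lam > 0\<close>
  have Q: "\<And>t. 0 \<le> t \<Longrightarrow> Q t \<in> measurable M (count_space UNIV)"
      "AE \<omega> in M. \<forall>t\<ge>0. Q t \<omega> \<in> erlang_states k" "AE \<omega> in M. cadlag (\<lambda>t. Q t \<omega>)"
    using \<open>erlang_queue M lam mu k Q\<close> by (auto simp: erlang_queue_def markov_chain_with_rates_def elim: eventually_mono)
  obtain p where p: "transition_function_with_rates (erlang_states k) (erlang_rate lam mu k) p"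
    and markov: "\<And>(n::nat) (t::nat \<Rightarrow> real) x.
           0 \<le> t 0 \<Longrightarrow> (\<And>i. i\<le>n \<Longrightarrow> t i < t (Suc i)) \<Longrightarrow> (\<And>i. i\<le>Suc n \<Longrightarrow> x i \<in> erlang_states k) \<Longrightarrow>
           M.prob {\<omega>\<in>space M. \<forall>i\<le>Suc n. Q (t i) \<omega> = x i} =
           M.prob {\<omega>\<in>space M. \<forall>i\<le>n. Q (t i) \<omega> = x i} * p (t (Suc n) - t n) (x n) (x (Suc n))"
    using \<open>erlang_queue M lam mu k Q\<close> unfolding erlang_queue_def markov_chain_with_rates_def by blast
  have levy: "levy_process M D" and mono: "AE \<omega> in M. \<forall>s t. 0 \<le> s \<and> s \<le> t \<longrightarrow> D s \<omega> \<le> D t \<omega>"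
    and \<phi>: "\<And>t z. 0 \<le> t \<Longrightarrow> 0 < z \<Longrightarrow> M.expectation (\<lambda>\<omega>. exp (- z * D t \<omega>)) = exp (- t * \<phi> z)"
    using \<open>mixed_stable_subordinator M c1 c2 \<alpha>1 \<alpha>2 D\<close> by (auto simp: mixed_stable_subordinator_def \<phi>_def)
  have strict: "AE \<omega> in M. strict_path (\<lambda>t. D t \<omega>)"
  proof (rule M.levy_strict_path[OF levy \<phi> mono])
    show "filterlim \<phi> at_top at_top"
    proof (rule filterlim_at_top_mono)
      show "filterlim (\<lambda>z. c1 * z powr \<alpha>1) at_top at_top"
        using par by real_asymp
      show "\<forall>\<^sub>F z in at_top. c1 * z powr \<alpha>1 \<le> \<phi> z"
        using par by (intro always_eventually) (simp add: \<phi>_def)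
    qed
    show "0 < \<phi> 1" using par by (simp add: \<phi>_def)
  qed
  \<comment> \<open>The constants come from the bounds for one step: their error is
    \<open>2 * C\<^sup>2 * h\<^sup>2\<close>, valid as long as \<open>C * h \<le> 1\<close>.\<close>
  interpret subordinated_arrivals "completion M" Q D lam "2 * C\<^sup>2" "1 / C" \<phi>
  proof (intro subordinated_arrivals.intro subordinated_arrivals_axioms.intro M.prob_space_completion)
    show "complete_measure (completion M)" by (rule completion.complete_measure_axioms)
    show "0 < lam" "0 \<le> 2 * C\<^sup>2" "0 < 1 / C" using par C by auto
    show "Q t \<in> measurable (completion M) (count_space UNIV)" if "0 \<le> t" for t
      by (rule measurable_completion[OF Q(1)[OF that]])
    show "AE \<omega> in completion M. cadlag (\<lambda>t. Q t \<omega>)"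
      by (rule AE_completion[OF Q(3)])
    show "D t \<in> borel_measurable (completion M)" if "0 \<le> t" for t
      using levy that by (intro measurable_completion) (simp add: levy_process_def)
    show "AE \<omega> in completion M. strict_path (\<lambda>t. D t \<omega>)"
      by (rule AE_completion[OF strict])
    fix h :: real and m l assume h: "0 < h" "h < 1 / C"
    have Ch: "C * h \<le> 1" using h C by (simp add: pos_less_divide_eq mult.commute)
    note bounds = M.grid_arrival_path_bounds[OF Q(1,2) p markov \<open>k \<ge> 1\<close> \<open>lam > 0\<close> \<open>mu > 0\<close> C_def h(1) Ch, of m l]
    have A: "{\<omega>\<in>space M. grid_arrival Q h m \<omega>} \<in> sets M"
      using h M.pred_grid_arrival[of Q h m, OF Q(1)] by (simp add: pred_def)
    have E: "{\<omega>\<in>space M. grid_path Q h m \<omega> = l} \<in> sets M"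
    proof -
      have "grid_path Q h m -` {l} \<inter> space M \<in> sets M"
        using h by (intro measurable_sets[OF M.measurable_grid_path] Q) auto
      also have "grid_path Q h m -` {l} \<inter> space M = {\<omega>\<in>space M. grid_path Q h m \<omega> = l}" by auto
      finally show ?thesis .
    qed
    have "{\<omega>\<in>space M. grid_path Q h m \<omega> = l \<and> grid_arrival Q h m \<omega>} = {\<omega>\<in>space M. grid_path Q h m \<omega> = l} \<inter> {\<omega>\<in>space M. grid_arrival Q h m \<omega>}"
      by auto
    also have "\<dots> \<in> sets M" using E A by (rule sets.Int)
    finally have E': "{\<omega>\<in>space M. grid_path Q h m \<omega> = l \<and> grid_arrival Q h m \<omega>} \<in> sets M" .
    show "(lam * h - 2 * C\<^sup>2 * h\<^sup>2) * measure (completion M) {\<omega>\<in>space (completion M). grid_path Q h m \<omega> = l}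
       \<le> measure (completion M) {\<omega>\<in>space (completion M). grid_path Q h m \<omega> = l \<and> grid_arrival Q h m \<omega>}"
      unfolding space_completion measure_completion[OF E] measure_completion[OF E'] by (rule bounds(1))
    show "measure (completion M) {\<omega>\<in>space (completion M). grid_path Q h m \<omega> = l \<and> grid_arrival Q h m \<omega>}
       \<le> (lam * h + 2 * C\<^sup>2 * h\<^sup>2) * measure (completion M) {\<omega>\<in>space (completion M). grid_path Q h m \<omega> = l}"
      unfolding space_completion measure_completion[OF E] measure_completion[OF E'] by (rule bounds(2))
  next
    fix h :: real and m :: nat and A and u :: "nat \<Rightarrow> real" assume hu: "0 < h" "\<And>i. 0 < u i"
    show "(\<integral>\<omega>. (\<Prod>j\<le>m. exp (- (u j * (D (real j * h) \<omega> - D (real (j - 1) * h) \<omega>)))) * indicator A (grid_path Q h (Suc m) \<omega>) \<partial>completion M)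
       = (\<Prod>j<m. exp (- (h * \<phi> (u (Suc j))))) * measure (completion M) {\<omega>\<in>space (completion M). grid_path Q h (Suc m) \<omega> \<in> A}"
      by (rule subordinated_factor[OF M.prob_space_axioms levy \<phi> mono strict assms(13) hu])
  next
    show "\<phi> 0 = 0" by (simp add: \<phi>_def)
    show "0 < \<phi> x" if "0 < x" for x
      using that par by (simp add: \<phi>_def add_pos_nonneg)
    show "\<phi> x \<le> \<phi> y" if "0 \<le> x" "x \<le> y" for x y
      unfolding \<phi>_def using that par by (intro add_mono mult_left_mono powr_mono2) auto
    show "continuous_on {0..} \<phi>"
      unfolding \<phi>_def using par by (intro continuous_intros continuous_on_powr') auto
  qed
  have T_gap: "AE \<omega> in completion M. \<forall>i. T i \<omega> = ereal (gap i \<omega>)"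
    using Qc Ds nth_arrival_finite
  proof eventually_elim
    case (elim \<omega>)
    interpret strict_path "\<lambda>t. D t \<omega>" by (rule elim)
    have tc: "(\<lambda>t. time_change Q (inverse_process D) t \<omega>) = (\<lambda>t. Q (inverse_path (\<lambda>s. D s \<omega>) t) \<omega>)"
      by (simp add: time_change_def inverse_process_def fun_eq_iff)
    have "nth_arrival_time (\<lambda>t. Q (inverse_path (\<lambda>s. D s \<omega>) t) \<omega>) n
      = ereal (left_limit (\<lambda>t. D t \<omega>) (real_of_ereal (nth_arrival_time (\<lambda>t. Q t \<omega>) n)))" for n
    proof (rule nth_arrival_time_change[OF elim(1)])
      show "nth_arrival_time (\<lambda>t. Q t \<omega>) n = ereal (real_of_ereal (nth_arrival_time (\<lambda>t. Q t \<omega>) n))"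
        using elim(3) nth_arrival_time_nonneg[of "\<lambda>t. Q t \<omega>" n] by (cases "nth_arrival_time (\<lambda>t. Q t \<omega>) n") auto
    qed
    then show ?case
      by (simp add: T interarrival_time_def tc gap_def)
  qed
  define A where "A = - (c2 / c1)"
  define B where "B = - (lam / c1)"
  interpret S1: npow_series \<alpha>1 "\<alpha>1 - \<alpha>2" 0
    using par by unfold_locales auto
  interpret S2: npow_series \<alpha>1 "\<alpha>1 - \<alpha>2" "\<alpha>1 - \<alpha>2"
    using par by unfold_locales auto
  \<comment> \<open>The second series of the theorem carries one more power of \<open>A\<close> than
    \<open>S2\<close> does; it is taken out in front.\<close>
  define g where "g t = S1.dsum A B t - A * S2.dsum A B t" for t
  have sums1: "(\<lambda>r. A ^ r * t powr ((\<alpha>1 - \<alpha>2) * real r) * mittag_leffler3 (real r + 1) \<alpha>1 ((\<alpha>1 - \<alpha>2) * real r + 1) (B * t powr \<alpha>1))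
      sums S1.dsum A B t" if "0 < t" for t
    using S1.dterm_iterated(2)[of t A B] S1.mittag_leffler3_dterm[OF that, of A _ B] that by simp
  have sums2: "(\<lambda>r. A ^ (r + 1) * t powr ((\<alpha>1 - \<alpha>2) * (real r + 1)) * mittag_leffler3 (real r + 1) \<alpha>1 ((\<alpha>1 - \<alpha>2) * (real r + 1) + 1) (B * t powr \<alpha>1))
      sums (A * S2.dsum A B t)" if "0 < t" for t
  proof -
    have "(\<lambda>r. A * (\<Sum>j. S2.dterm A B t r j)) sums (A * S2.dsum A B t)"
      using that by (intro sums_mult S2.dterm_iterated) auto
    then show ?thesis
      unfolding S2.mittag_leffler3_dterm[OF that, symmetric] by (simp add: distrib_left mult.assoc)
  qed
  have "\<forall>\<^sub>F z in at_top. S1.rho \<bar>A\<bar> \<bar>B\<bar> z < 1 \<and> 0 < z"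
    by (intro eventually_conj S1.rho_eventually eventually_gt_at_top)
  \<comment> \<open>\<open>rho\<close> does not involve the offset, so one \<open>z0\<close> serves
    both series.\<close>
  then obtain z0 where z0: "\<And>z. z0 \<le> z \<Longrightarrow> S1.rho \<bar>A\<bar> \<bar>B\<bar> z < 1 \<and> 0 < z"
    unfolding eventually_at_top_linorder by blast
  have tail: "prob {\<omega>\<in>space (completion M). t < gap n \<omega>} = g t" if t: "0 < t" for n t
  proof (rule gap_tail[OF _ _ _ t])
    show "0 < z0" using z0[of z0] by simp
    show "isCont g t" if "0 < t" for t
      unfolding g_def using that by (intro continuous_intros S1.isCont_dsum S2.isCont_dsum)
    fix z assume z: "z0 \<le> z"
    have zp: "0 < z" and rho: "S1.rho \<bar>A\<bar> \<bar>B\<bar> z < 1" "S2.rho \<bar>A\<bar> \<bar>B\<bar> z < 1"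
      using z0[OF z] by (auto simp: S1.rho_def S2.rho_def)
    have "has_bochner_integral lborel
       (\<lambda>t. indicator {0<..} t * exp (- (z * t)) * S1.dsum A B t - A * (indicator {0<..} t * exp (- (z * t)) * S2.dsum A B t))
       (z powr (- 0 - 1) / (1 - S1.rho A B z) - A * (z powr (- (\<alpha>1 - \<alpha>2) - 1) / (1 - S2.rho A B z)))"
      by (intro has_bochner_integral_diff has_bochner_integral_mult_right S1.dsum_laplace S2.dsum_laplace zp rho)
    moreover have "(\<lambda>t. indicator {0<..} t * exp (- (z * t)) * S1.dsum A B t - A * (indicator {0<..} t * exp (- (z * t)) * S2.dsum A B t))
       = (\<lambda>t. indicator {0<..} t * exp (- (z * t)) * g t)"
      by (simp add: g_def fun_eq_iff algebra_simps)
    moreover have "z powr (- 0 - 1) / (1 - S1.rho A B z) - A * (z powr (- (\<alpha>1 - \<alpha>2) - 1) / (1 - S2.rho A B z)) = \<phi> z / (z * (lam + \<phi> z))"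
      unfolding S1.rho_def S2.rho_def \<phi>_def by (rule mixed_tail_laplace[OF par zp A_def B_def])
    ultimately show "has_bochner_integral lborel (\<lambda>t. indicator {0<..} t * exp (- (z * t)) * g t) (\<phi> z / (z * (lam + \<phi> z)))"
      by simp
  qed
  show ?thesis
  proof (intro conjI allI impI)
    show "indep_vars (\<lambda>_. borel) T UNIV"
      by (rule indep_vars_interarrivals[OF T_gap])
    show "distr (completion M) borel (T m) = distr (completion M) borel (T n)" for m n
      by (rule distr_interarrivals_eq[OF T_gap])
    fix n and t :: real assume t: "0 < t"
    note s1 = sums1[OF t, unfolded A_def B_def] and s2 = sums2[OF t, unfolded A_def B_def]
    show "summable (\<lambda>r. (- (c2 / c1)) ^ r * t powr ((\<alpha>1 - \<alpha>2) * real r)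
         * mittag_leffler3 (real r + 1) \<alpha>1 ((\<alpha>1 - \<alpha>2) * real r + 1) (- (lam / c1) * t powr \<alpha>1))"
      using s1 by (rule sums_summable)
    show "summable (\<lambda>r. (- (c2 / c1)) ^ (r + 1) * t powr ((\<alpha>1 - \<alpha>2) * (real r + 1))
         * mittag_leffler3 (real r + 1) \<alpha>1 ((\<alpha>1 - \<alpha>2) * (real r + 1) + 1) (- (lam / c1) * t powr \<alpha>1))"
      using s2 by (rule sums_summable)
    have "prob {\<omega>\<in>space (completion M). ereal t < T n \<omega>} = g t"
      using prob_interarrival_greater[OF T_gap, of "ereal t" n] tail[OF t, of n] by simp
    then show "prob {\<omega>\<in>space (completion M). ereal t < T n \<omega>} =
         (\<Sum>r. (- (c2 / c1)) ^ r * t powr ((\<alpha>1 - \<alpha>2) * real r)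
           * mittag_leffler3 (real r + 1) \<alpha>1 ((\<alpha>1 - \<alpha>2) * real r + 1) (- (lam / c1) * t powr \<alpha>1))
         - (\<Sum>r. (- (c2 / c1)) ^ (r + 1) * t powr ((\<alpha>1 - \<alpha>2) * (real r + 1))
           * mittag_leffler3 (real r + 1) \<alpha>1 ((\<alpha>1 - \<alpha>2) * (real r + 1) + 1) (- (lam / c1) * t powr \<alpha>1))"
      unfolding sums_unique[OF s1, symmetric] sums_unique[OF s2, symmetric] g_def A_def B_def .
  qed
qed

end
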